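(* Let $\mathfrak m\in\mathbb{R}$ and for $\zeta\in\mathcal{C}^{\alpha_0}_{\mathfrak m}(\mathbb{T})$ let $u(\zeta)$ be the unique mild solution of the SPDE with $\chi=1$. Then for every $p\in[1,\infty)$, $$\sup_{\zeta\in\mathcal{C}^{\alpha_0}_{\mathfrak m}(\mathbb{T})}\;\sup_{T>0}\;\sup_{t\in(0,T]}\big(t^{p/2}\wedge1\big)\,\mathbb{E}\big[\|u_t(\zeta)\|^p_{L^p}\big]<\infty.$$
   Context: $\mathbb{T}=\mathbb{R}/\mathbb{Z}$; $\bar f=\langle f,1\rangle$; $\mathcal{C}^\beta=\mathcal{B}^\beta_{\infty,\infty}(\mathbb{T})$ (Hölder–Besov space), subscript $\mathfrak m$ for mean $\mathfrak m$. Fixed parameters $\alpha_0\in(-\tfrac12,0)$, $\alpha\in(0,\alpha_0+\tfrac12)$, $\frac{\alpha-\alpha_0}2<\eta<\frac14$. $\rho_f$ is the mean-zero solution of $-\partial_{xx}\rho_f=f-\bar f$. $\xi$ is a spatially mean-free space-time white noise on $\mathbb{R}_+\times\mathbb{T}$ and $v_t=\int_0^te^{(t-s)\Delta}\xi(ds)$ the stochastic heat equation from $0$. The mild solution of $\partial_tu-\partial_{xx}u=\chi\partial_x(u^2\partial_x\rho_u)+\xi$, $u_0=\zeta$, is $u=w+v$ where $w$ (continuous $(0,\infty)\to\mathcal{C}^\alpha$ with $\sup_{t\le T}(t^\eta\wedge1)\|w_t\|_{\mathcal{C}^\alpha}<\infty$ for each $T$) solves $w_t=e^{t\Delta}\zeta+\int_0^te^{(t-s)\Delta}\chi\partial_x((w_s+v_s)^2\partial_x\rho_{w_s+v_s})ds$.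 *)

theory Defs
  imports "HOL-Probability.Probability"
begin

text \<open>Functions on T are 1-periodic functions real => real.  Periodic distributions
  are represented by their Fourier coefficients  c :: int => complex, with the
  convention  c k = <f, e_{-k}>,  e_k(x) = exp(2 pi i k x).\<close>

definition periodic1 :: "(real \<Rightarrow> real) \<Rightarrow> bool" where
  "periodic1 f \<longleftrightarrow> (\<forall>x. f (x + 1) = f x)"

definition tmean :: "(real \<Rightarrow> real) \<Rightarrow> real" where
  "tmean f = (LINT x:{0..1}|lborel. f x)"

definition fcoef :: "(real \<Rightarrow> real) \<Rightarrow> int \<Rightarrow> complex" where
  "fcoef f k = (LINT x:{0..1}|lborel. complex_of_real (f x) * cis (- 2 * pi * real_of_int k * x))"

definition periodic_distribution :: "(int \<Rightarrow> complex) \<Rightarrow> bool" where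
  "periodic_distribution c \<longleftrightarrow>
     (\<exists>C N. \<forall>k. cmod (c k) \<le> C * (1 + \<bar>real_of_int k\<bar>) ^ N)"

definition real_distribution :: "(int \<Rightarrow> complex) \<Rightarrow> bool" where
  "real_distribution c \<longleftrightarrow> (\<forall>k. c (- k) = cnj (c k))"

definition smooth_fun :: "(real \<Rightarrow> real) \<Rightarrow> bool" where
  "smooth_fun f \<longleftrightarrow> (\<forall>n x. ((deriv ^^ n) f) differentiable (at x))"

definition dyadic_partition :: "(real \<Rightarrow> real) \<Rightarrow> (real \<Rightarrow> real) \<Rightarrow> bool" where
  "dyadic_partition chi rh \<longleftrightarrow>
     smooth_fun chi \<and> smooth_fun rh \<and>
     (\<forall>\<xi>. chi (- \<xi>) = chi \<xi> \<and> rh (- \<xi>) = rh \<xi>) \<and>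
     (\<forall>\<xi>. 0 \<le> chi \<xi> \<and> chi \<xi> \<le> 1 \<and> 0 \<le> rh \<xi> \<and> rh \<xi> \<le> 1) \<and>
     closure {\<xi>. chi \<xi> \<noteq> 0} \<subseteq> ball 0 (4/3) \<and>
     closure {\<xi>. rh \<xi> \<noteq> 0} \<subseteq> {\<xi>. 3/4 \<le> \<bar>\<xi>\<bar> \<and> \<bar>\<xi>\<bar> \<le> 8/3} \<and>
     (\<forall>\<xi>. chi \<xi> + (\<Sum>j. rh (\<xi> / 2 ^ j)) = 1) \<and>
     (\<forall>j::nat. j \<ge> 1 \<longrightarrow>
        closure {\<xi>. chi \<xi> \<noteq> 0} \<inter> closure {\<xi>. rh (\<xi> / 2 ^ j) \<noteq> 0} = {}) \<and>
     (\<forall>i j::nat. i + 2 \<le> j \<longrightarrow>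
        closure {\<xi>. rh (\<xi> / 2 ^ i) \<noteq> 0} \<inter> closure {\<xi>. rh (\<xi> / 2 ^ j) \<noteq> 0} = {})"

text \<open>A fixed dyadic partition of unity (the space C^beta does not depend on the choice).\<close>
definition lp_pair :: "(real \<Rightarrow> real) \<times> (real \<Rightarrow> real)" where
  "lp_pair = (SOME p. dyadic_partition (fst p) (snd p))"

definition lp_mult :: "int \<Rightarrow> real \<Rightarrow> real" where
  "lp_mult j \<xi> = (if j = -1 then fst lp_pair \<xi> else snd lp_pair (\<xi> / 2 powr real_of_int j))"

text \<open>Littlewood--Paley block Delta_j c (a trigonometric polynomial; the multiplier
  vanishes for |k| > 2^(j+2)).\<close>
definition lp_block :: "int \<Rightarrow> (int \<Rightarrow> complex) \<Rightarrow> real \<Rightarrow> complex" where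
  "lp_block j c x = (\<Sum>k\<in>{k. \<bar>real_of_int k\<bar> \<le> 2 powr real_of_int (j + 2)}.
      complex_of_real (lp_mult j (real_of_int k)) * c k * cis (2 * pi * real_of_int k * x))"

definition besov_seq :: "real \<Rightarrow> (int \<Rightarrow> complex) \<Rightarrow> int \<Rightarrow> real" where
  "besov_seq \<beta> c j = 2 powr (real_of_int j * \<beta>) * (SUP x. cmod (lp_block j c x))"

definition besov_norm :: "real \<Rightarrow> (int \<Rightarrow> complex) \<Rightarrow> real" where
  "besov_norm \<beta> c = (SUP j\<in>{-1..}. besov_seq \<beta> c j)"

definition holder_besov :: "real \<Rightarrow> (int \<Rightarrow> complex) \<Rightarrow> bool" where
  "holder_besov \<beta> c \<longleftrightarrow> periodic_distribution c \<and> real_distribution c \<and>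
     bdd_above (besov_seq \<beta> c ` {-1..})"

definition holder_besov_m :: "real \<Rightarrow> real \<Rightarrow> (int \<Rightarrow> complex) set" where
  "holder_besov_m \<beta> m = {c. holder_besov \<beta> c \<and> c 0 = complex_of_real m}"

definition rho :: "(real \<Rightarrow> real) \<Rightarrow> real \<Rightarrow> real" where
  "rho f = (THE r. periodic1 r \<and> tmean r = 0 \<and>
     (\<exists>r'. \<forall>x. (r has_real_derivative r' x) (at x) \<and>
              (r' has_real_derivative (tmean f - f x)) (at x)))"

definition st_dom :: "(real \<times> real) set" where
  "st_dom = {0..} \<times> {0..1}"

definition sq_int :: "(real \<times> real \<Rightarrow> real) \<Rightarrow> bool" where
  "sq_int \<phi> \<longleftrightarrow> \<phi> \<in> borel_measurable borel \<and> set_integrable lborel st_dom (\<lambda>z. (\<phi> z)\<^sup>2)"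

definition spatial_proj :: "(real \<times> real \<Rightarrow> real) \<Rightarrow> real \<times> real \<Rightarrow> real" where
  "spatial_proj \<phi> z = \<phi> z - (LINT y:{0..1}|lborel. \<phi> (fst z, y))"

definition centered_gaussian :: "'w measure \<Rightarrow> ('w \<Rightarrow> real) \<Rightarrow> real \<Rightarrow> bool" where
  "centered_gaussian M X v \<longleftrightarrow>
     X \<in> borel_measurable M \<and>
     (v = 0 \<longrightarrow> (AE \<omega> in M. X \<omega> = 0)) \<and>
     (v > 0 \<longrightarrow> distributed M lborel X (normal_density 0 (sqrt v)))"

text \<open>xi is a spatially mean-free space-time white noise on R_+ x T, i.e. an isonormal
  Gaussian process indexed by L^2(R_+ x T) with covariance <Pi phi, Pi psi>, Pi removing the
  spatial mean.\<close>
definition mean_free_white_noise :: "'w measure \<Rightarrow> ('w \<Rightarrow> (real \<times> real \<Rightarrow> real) \<Rightarrow> real) \<Rightarrow> bool" where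
  "mean_free_white_noise M \<xi> \<longleftrightarrow> prob_space M \<and>
     (\<forall>\<phi>. sq_int \<phi> \<longrightarrow> centered_gaussian M (\<lambda>\<omega>. \<xi> \<omega> \<phi>)
          (LINT z:st_dom|lborel. (spatial_proj \<phi> z)\<^sup>2)) \<and>
     (\<forall>\<phi> \<psi> a b. sq_int \<phi> \<longrightarrow> sq_int \<psi> \<longrightarrow>
        (AE \<omega> in M. \<xi> \<omega> (\<lambda>z. a * \<phi> z + b * \<psi> z) = a * \<xi> \<omega> \<phi> + b * \<xi> \<omega> \<psi>))"

text \<open>Heat kernel of T:  p_r(y) = sum_k exp(-4 pi^2 k^2 r) e_k(y).\<close>
definition heat_kernel :: "real \<Rightarrow> real \<Rightarrow> real" where
  "heat_kernel r y = 1 + (\<Sum>k. 2 * exp (- 4 * pi\<^sup>2 * (real (Suc k))\<^sup>2 * r) * cos (2 * pi * real (Suc k) * y))"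

text \<open>v_t = int_0^t e^{(t-s) Delta} xi(ds): a continuous version of the Gaussian field
  v_t(x) = xi(1_{s<t} p_{t-s}(x - .)).\<close>
definition stoch_heat :: "'w measure \<Rightarrow> ('w \<Rightarrow> (real \<times> real \<Rightarrow> real) \<Rightarrow> real)
     \<Rightarrow> ('w \<Rightarrow> real \<Rightarrow> real \<Rightarrow> real) \<Rightarrow> bool" where
  "stoch_heat M \<xi> v \<longleftrightarrow>
     (\<forall>\<omega>. continuous_on ({0..} \<times> UNIV) (\<lambda>(t, x). v \<omega> t x)) \<and>
     (\<forall>\<omega> t. periodic1 (v \<omega> t)) \<and>
     (\<forall>t\<ge>0. \<forall>x. AE \<omega> in M.
        v \<omega> t x = \<xi> \<omega> (\<lambda>(s, y). if s < t then heat_kernel (t - s) (x - y) else 0))"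

definition nonlin :: "(real \<Rightarrow> real) \<Rightarrow> real \<Rightarrow> real" where
  "nonlin u x = (u x)\<^sup>2 * deriv (rho u) x"

text \<open>w solves, in the sense of distributions (Fourier coefficientwise),
  w_t = e^{t Delta} zeta + int_0^t e^{(t-s) Delta} d_x(u_s^2 d_x rho_{u_s}) ds,  u = w + v,
  and lies in the solution class of the paper.\<close>
definition mild_solution :: "real \<Rightarrow> real \<Rightarrow> (int \<Rightarrow> complex) \<Rightarrow> (real \<Rightarrow> real \<Rightarrow> real)
     \<Rightarrow> (real \<Rightarrow> real \<Rightarrow> real) \<Rightarrow> bool" where
  "mild_solution \<alpha> \<eta> \<zeta> v w \<longleftrightarrow>
     (\<forall>t>0. continuous_on UNIV (w t) \<and> periodic1 (w t) \<and> holder_besov \<alpha> (fcoef (w t))) \<and>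
     (\<forall>t>0. ((\<lambda>s. besov_norm \<alpha> (\<lambda>k. fcoef (w s) k - fcoef (w t) k)) \<longlongrightarrow> 0)
              (at t within {0<..})) \<and>
     (\<forall>T>0. \<exists>B. \<forall>t\<in>{0<..T}. min (t powr \<eta>) 1 * besov_norm \<alpha> (fcoef (w t)) \<le> B) \<and>
     (\<forall>t>0. \<forall>k.
        set_integrable lborel {0..t} (\<lambda>s. complex_of_real (exp (- 4 * pi\<^sup>2 * (real_of_int k)\<^sup>2 * (t - s)))
            * (2 * pi * \<i> * of_int k) * fcoef (nonlin (\<lambda>x. w s x + v s x)) k) \<and>
        fcoef (w t) k =
          complex_of_real (exp (- 4 * pi\<^sup>2 * (real_of_int k)\<^sup>2 * t)) * \<zeta> k +
          (LINT s:{0..t}|lborel. complex_of_real (exp (- 4 * pi\<^sup>2 * (real_of_int k)\<^sup>2 * (t - s)))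
            * (2 * pi * \<i> * of_int k) * fcoef (nonlin (\<lambda>x. w s x + v s x)) k))"

definition Lp_pow :: "real \<Rightarrow> (real \<Rightarrow> real) \<Rightarrow> ennreal" where
  "Lp_pow p f = (\<integral>\<^sup>+ x. ennreal (\<bar>f x\<bar> powr p) * indicator {0..1} x \<partial>lborel)"

end

theory Submission
  imports Defs
begin

text \<open>
  Write u = w + v and let z be a Fejer mean of w in space.  Up to a uniformly small error z solves
  z_t = d_x (z_x + (z + v)^2 R), where R = d_x rho_u for u = z + v, so that R' = mean(u) - u.  In the balance of
  y = int z^P (P even) the term int z^P z_x R equals int z^(P+1) (u - mean(u)) / (P+1) and yields the damping
  int z^(P+2).  All remaining terms are of lower order by Young's inequality except 2 z v R, which is
  critical: there v is split into a C^1 part, for which one integrates by parts, and a remainder that is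
  small in sup norm.  Weighting y by (s - s0)^(P/2+1) turns the superlinear damping into the bound
  (t - s0)^(P/2) int w_t^P <= C (1 + average of g over [s0, t]) from any starting time s0 > 0, so nothing is needed about
  the solution near time 0, and g(s) is a polynomial in the size and roughness of the noise v_s at one time s.

  The size of the C^1 part is controlled by the dyadic increments of v_s, whose moments are bounded uniformly in
  time because the variance of v_s(x) - v_s(y) is at most C |x - y|^(1/2).  General p follows from
  (t^(1/2) |u|)^p <= 1 + t^(P/2) u^P for P >= p.
\<close>

section \<open>Fejer means\<close>

text \<open>Why the constants do not see \<zeta>: the mean of \<open>w\<close> is conserved, so the
  mean of u is bounded through \<open>m\<close> and the noise, and R is bounded by twice the L^1
  norm of u, hence counts as one more power of z. Testing with z^(P-1), Young's inequality turns the
  flux 2 z v R into int z^P v^2 R^2. This has the full degree P + 2 of the damping, with a prefactor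
  v^2 that is not small; nor can the derivative be moved onto v, whose paths are only Hoelder
  continuous. In the splitting of v the threshold for the remainder depends on P alone, so a rougher
  path only requires a shorter averaging length and enters polynomially. Fejer means are chosen
  because their kernel is positive with unit mass: they do not increase the sup norm, and they
  commute with d_x and the heat semigroup, so the coefficientwise mild equation becomes a classical
  equation for z. Their derivatives need not stay bounded as the truncation is removed, but the
  dissipation enters only with its sign. Since g(s) involves one time only, Tonelli's theorem
  reduces the estimate to moments at fixed times.\<close>

definition ccoef :: "(real \<Rightarrow> complex) \<Rightarrow> int \<Rightarrow> complex" where
  "ccoef g k = integral {0..1} (\<lambda>x. g x * cis (- 2 * pi * real_of_int k * x))"

definition fejer_kernel :: "nat \<Rightarrow> real \<Rightarrow> real" where
  "fejer_kernel N x = (cmod (\<Sum>j\<le>N. cis (2 * pi * real j * x)))\<^sup>2 / real (Suc N)"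

text \<open>The frequency k arises from N + 1 - |k| pairs, so this is the Cesaro mean with weights 1
  - |k| / (N + 1). The double sum matches the expansion of the squared modulus in
  \<open>fejer_kernel\<close>, so the convolution formula involves no counting of pairs.\<close>

definition fejer_mean :: "nat \<Rightarrow> (int \<Rightarrow> complex) \<Rightarrow> real \<Rightarrow> complex" where
  "fejer_mean N c x =
     (\<Sum>j\<le>N. \<Sum>l\<le>N. c (int j - int l) * cis (2 * pi * real_of_int (int j - int l) * x)) / of_nat (Suc N)"

lemma set_lint_continuous:
  fixes f :: "real \<Rightarrow> 'a::euclidean_space"
  assumes "continuous_on {a..b} f"
  shows "set_integrable lborel {a..b} f" "(LINT x:{a..b}|lborel. f x) = integral {a..b} f"
proof -
  show *: "set_integrable lborel {a..b} f"
    using borel_integrable_atLeastAtMost'[OF assms] .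
  show "(LINT x:{a..b}|lborel. f x) = integral {a..b} f"
    using set_borel_integral_eq_integral(2)[OF *] .
qed

lemma fcoef_eq_ccoef:
  assumes "continuous_on UNIV f"
  shows "fcoef f k = ccoef (\<lambda>x. complex_of_real (f x)) k"
  unfolding fcoef_def ccoef_def
  by (rule set_lint_continuous(2))
     (intro continuous_intros continuous_on_subset[OF assms] subset_UNIV)

lemma tmean_eq_integral:
  assumes "continuous_on UNIV f"
  shows "tmean f = integral {0..1} f"
  unfolding tmean_def by (rule set_lint_continuous(2)) (rule continuous_on_subset[OF assms subset_UNIV])

lemma tmean_fcoef:
  assumes "continuous_on UNIV f"
  shows "fcoef f 0 = complex_of_real (tmean f)"
proof -
  have "((\<lambda>x. complex_of_real (f x)) has_integral complex_of_real (integral {0..1} f)) {0..1}"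
    by (intro has_integral_of_real integrable_integral integrable_continuous_real
        continuous_on_subset[OF assms subset_UNIV])
  then show ?thesis
    by (simp add: fcoef_eq_ccoef[OF assms] ccoef_def tmean_eq_integral[OF assms] integral_unique)
qed

lemma has_vector_derivative_cis:
  "((\<lambda>x. cis (a * x)) has_vector_derivative (\<i> * a * cis (a * x))) (at x within S)"
  unfolding has_vector_derivative_def
  by (rule has_derivative_eq_rhs, (rule derivative_eq_intros refl)+)
     (auto simp: scaleR_conv_of_real algebra_simps)

lemma integral_cis:
  "integral {0..1} (\<lambda>x. cis (2 * pi * real_of_int k * x)) = (if k = 0 then 1 else 0)"
proof (cases "k = 0")
  case False
  let ?a = "2 * pi * real_of_int k"
  have nz: "\<i> * complex_of_real ?a \<noteq> 0" using False by simp
  have "((\<lambda>x. (\<i> * ?a) * cis (?a * x)) has_integral (cis (?a * 1) - cis (?a * 0))) {0..1}"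
    by (rule fundamental_theorem_of_calculus) (simp, rule has_vector_derivative_cis)
  moreover have "cis (?a * 1) = 1"
    using cis_multiple_2pi[of "real_of_int k"] by (simp add: mult.commute)
  ultimately have "((\<lambda>x. (\<i> * ?a) * cis (?a * x)) has_integral 0) {0..1}"
    by simp
  then have "((\<lambda>x. cis (?a * x)) has_integral 0) {0..1}"
    using has_integral_mult_right[of "\<lambda>x. (\<i> * ?a) * cis (?a * x)" 0 "{0..1}" "1/(\<i> * ?a)"] nz
    by (simp add: field_simps)
  then show ?thesis using False by (simp add: integral_unique)
qed simp

lemma fejer_kernel_eq:
  "complex_of_real (fejer_kernel N x) =
    (\<Sum>j\<le>N. \<Sum>l\<le>N. cis (2 * pi * real_of_int (int j - int l) * x)) / of_nat (Suc N)"
proof -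
  let ?s = "\<Sum>j\<le>N. cis (2 * pi * real j * x)"
  have "complex_of_real ((cmod ?s)\<^sup>2) = ?s * cnj ?s"
    by (rule complex_norm_square)
  also have "\<dots> = (\<Sum>j\<le>N. \<Sum>l\<le>N. cis (2 * pi * real j * x) * cnj (cis (2 * pi * real l * x)))"
    by (simp add: sum_product)
  also have "\<dots> = (\<Sum>j\<le>N. \<Sum>l\<le>N. cis (2 * pi * real_of_int (int j - int l) * x))"
    by (intro sum.cong refl) (simp add: cis_cnj cis_mult algebra_simps)
  finally show ?thesis by (simp add: fejer_kernel_def)
qed

lemma fejer_kernel_nonneg: "0 \<le> fejer_kernel N x"
  by (simp add: fejer_kernel_def)

lemma fejer_kernel_continuous [continuous_intros]:
  "continuous_on A f \<Longrightarrow> continuous_on A (\<lambda>x. fejer_kernel N (f x))"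
  unfolding fejer_kernel_def by (intro continuous_intros) auto

lemma fejer_mean_conv:
  assumes "continuous_on {0..1} g"
  shows "fejer_mean N (ccoef g) x = integral {0..1} (\<lambda>y. g y * complex_of_real (fejer_kernel N (x - y)))"
proof -
  have 1: "ccoef g k * cis (2 * pi * real_of_int k * x) =
     integral {0..1} (\<lambda>y. g y * cis (2 * pi * real_of_int k * (x - y)))" for k
  proof -
    have "integral {0..1} (\<lambda>y. g y * cis (2 * pi * real_of_int k * (x - y))) =
      integral {0..1} (\<lambda>y. (g y * cis (- 2 * pi * real_of_int k * y)) * cis (2 * pi * real_of_int k * x))"
      by (intro integral_cong) (simp add: cis_mult algebra_simps)
    also have "\<dots> = ccoef g k * cis (2 * pi * real_of_int k * x)"
      by (simp only: ccoef_def integral_mult_left)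
    finally show ?thesis by simp
  qed
  have ig: "(\<lambda>y. g y * cis (2 * pi * real_of_int k * (x - y))) integrable_on {0..1}" for k
    by (intro integrable_continuous_real continuous_intros assms)
  have "integral {0..1} (\<lambda>y. g y * complex_of_real (fejer_kernel N (x - y))) =
    integral {0..1} (\<lambda>y. (\<Sum>j\<le>N. \<Sum>l\<le>N. g y * cis (2 * pi * real_of_int (int j - int l) * (x - y))) * (1 / of_nat (Suc N)))"
    by (intro integral_cong) (simp only: fejer_kernel_eq sum_distrib_left times_divide_eq_right mult_1_right)
  also have "\<dots> = (\<Sum>j\<le>N. \<Sum>l\<le>N. integral {0..1} (\<lambda>y. g y * cis (2 * pi * real_of_int (int j - int l) * (x - y)))) * (1 / of_nat (Suc N))"
    by (subst integral_mult_left, subst integral_sum, simp, intro integrable_sum ig, simp, 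
        subst integral_sum, simp, rule ig, simp)
  also have "\<dots> = fejer_mean N (ccoef g) x"
    by (simp only: fejer_mean_def 1 times_divide_eq_right mult_1_right)
  finally show ?thesis by simp
qed

lemma ccoef_const: "ccoef (\<lambda>_. 1) k = (if k = 0 then 1 else 0)"
  using integral_cis[of "- k"] by (simp add: ccoef_def)

lemma fejer_kernel_integral: "integral {0..1} (\<lambda>y. fejer_kernel N (x - y)) = 1"
proof -
  have i: "(\<lambda>y. fejer_kernel N (x - y)) integrable_on {0..1}"
    by (intro integrable_continuous_real continuous_intros)
  have "complex_of_real (integral {0..1} (\<lambda>y. fejer_kernel N (x - y))) =
     integral {0..1} (\<lambda>y. complex_of_real (fejer_kernel N (x - y)))"
    by (rule integral_unique[symmetric], rule has_integral_of_real, rule integrable_integral, rule i)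
  also have "\<dots> = fejer_mean N (ccoef (\<lambda>_. 1)) x"
    by (subst fejer_mean_conv) (auto intro: continuous_intros)
  also have "\<dots> = (\<Sum>j\<le>N. \<Sum>l\<le>N. if l = j then 1 else 0) / of_nat (Suc N)"
    unfolding fejer_mean_def ccoef_const by (intro arg_cong2[where f="(/)"] sum.cong refl) auto
  also have "\<dots> = 1"
    using of_nat_neq_0[of N, where 'a=complex] by (simp add: sum.delta)
  finally show ?thesis by (simp only: of_real_eq_1_iff)
qed

text \<open>The kernel is nonnegative with integral 1, so averaging against it cannot enlarge the
  sup norm; Dirichlet partial sums would lose a factor log N.\<close>

lemma fejer_mean_norm_le:
  assumes "continuous_on {0..1} g" "\<And>y. y \<in> {0..1} \<Longrightarrow> cmod (g y) \<le> M"
  shows "cmod (fejer_mean N (ccoef g) x) \<le> M"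
proof -
  have "cmod (fejer_mean N (ccoef g) x) \<le> integral {0..1} (\<lambda>y. M * fejer_kernel N (x - y))"
    unfolding fejer_mean_conv[OF assms(1)]
    by (intro integral_norm_bound_integral integrable_continuous_real continuous_intros assms)
       (auto simp: norm_mult fejer_kernel_nonneg intro!: mult_right_mono assms)
  also have "\<dots> = M" by (simp add: fejer_kernel_integral)
  finally show ?thesis .
qed

text \<open>The exponential sum is geometric with ratio \<open>cis (2 * pi * x)\<close>, whose
  distance from 1 is 2 |sin (pi x)|; the division by N + 1 then makes the kernel small away from the
  integers.\<close>

lemma fejer_kernel_decay:
  assumes "0 < \<kappa>" "\<kappa> \<le> \<bar>sin (pi * x)\<bar>"
  shows "fejer_kernel N x \<le> 1 / (real (Suc N) * \<kappa>\<^sup>2)"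
proof -
  let ?z = "cis (2 * pi * x)"
  have nz: "cmod (?z - 1) = 2 * \<bar>sin (pi * x)\<bar>"
  proof -
    have "(cmod (?z - 1))\<^sup>2 = (2 * sin (pi * x))\<^sup>2"
    proof -
      have "(cmod (?z - 1))\<^sup>2 = (cos (2 * pi * x) - 1)\<^sup>2 + (sin (2 * pi * x))\<^sup>2"
        by (simp add: cmod_power2)
      also have "\<dots> = 2 - 2 * cos (2 * (pi * x))"
        using sin_cos_squared_add[of "2 * pi * x"] by (simp add: power2_eq_square algebra_simps)
      also have "\<dots> = (2 * sin (pi * x))\<^sup>2"
        by (subst cos_double_sin) (simp add: power2_eq_square)
      finally show ?thesis .
    qed
    then have "(cmod (?z - 1))\<^sup>2 = (2 * \<bar>sin (pi * x)\<bar>)\<^sup>2"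
      by (simp add: power_mult_distrib)
    then show ?thesis by (rule power2_eq_imp_eq) auto
  qed
  then have ne: "?z \<noteq> 1" using assms by auto
  have "(\<Sum>j\<le>N. cis (2 * pi * real j * x)) = (\<Sum>j\<le>N. ?z ^ j)"
    by (intro sum.cong refl) (simp add: Complex.DeMoivre algebra_simps)
  also have "\<dots> = (1 - ?z ^ Suc N) / (1 - ?z)"
    using ne by (subst sum_gp0) simp
  finally have "cmod (\<Sum>j\<le>N. cis (2 * pi * real j * x)) = cmod (1 - ?z ^ Suc N) / cmod (?z - 1)"
    by (simp only: norm_divide norm_minus_commute)
  also have "\<dots> \<le> 2 / (2 * \<kappa>)"
  proof (rule frac_le)
    have "cmod (1 - ?z ^ Suc N) \<le> cmod 1 + cmod (?z ^ Suc N)" by (rule norm_triangle_ineq4)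
    then show "cmod (1 - ?z ^ Suc N) \<le> 2" by (simp add: norm_power norm_mult)
  qed (use assms nz in auto)
  finally have "cmod (\<Sum>j\<le>N. cis (2 * pi * real j * x)) \<le> 1 / \<kappa>" by simp
  then have "(cmod (\<Sum>j\<le>N. cis (2 * pi * real j * x)))\<^sup>2 \<le> (1 / \<kappa>)\<^sup>2"
    by (intro power_mono) auto
  then show ?thesis
    unfolding fejer_kernel_def
    using divide_right_mono[of _ _ "real (Suc N)"] by (fastforce simp: power_divide mult.commute)
qed

text \<open>Approximate identity: the error is the average of \<open>g y - g x\<close> against the
  kernel. Points with small |sin (pi (x - y))| contribute at most \<epsilon> by the unit mass, the
  others are controlled by the decay of the kernel. Measuring distance by the sine respects
  periodicity.\<close>

lemma fejer_mean_approx: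
  assumes g: "continuous_on {0..1} g" and M: "\<And>y. y \<in> {0..1} \<Longrightarrow> cmod (g y - g x) \<le> M"
    and \<kappa>: "0 < \<kappa>" and \<epsilon>: "\<And>y. y \<in> {0..1} \<Longrightarrow> \<bar>sin (pi * (x - y))\<bar> < \<kappa> \<Longrightarrow> cmod (g y - g x) \<le> \<epsilon>"
    and "0 \<le> \<epsilon>" "0 \<le> M"
  shows "cmod (fejer_mean N (ccoef g) x - g x) \<le> \<epsilon> + M / (real (Suc N) * \<kappa>\<^sup>2)"
proof -
  have i1: "(\<lambda>y. g y * complex_of_real (fejer_kernel N (x - y))) integrable_on {0..1}"
    and i2: "(\<lambda>y. g x * complex_of_real (fejer_kernel N (x - y))) integrable_on {0..1}"
    by (intro integrable_continuous_real continuous_intros g)+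
  have "g x = integral {0..1} (\<lambda>y. g x * complex_of_real (fejer_kernel N (x - y)))"
  proof -
    have "((\<lambda>y. complex_of_real (fejer_kernel N (x - y))) has_integral complex_of_real 1) {0..1}"
      using has_integral_of_real[OF integrable_integral[OF integrable_continuous_real[of 0 1 "\<lambda>y. fejer_kernel N (x - y)"]]]
      by (simp add: fejer_kernel_integral continuous_intros)
    then show ?thesis by (simp add: integral_unique)
  qed
  then have "fejer_mean N (ccoef g) x - g x =
     integral {0..1} (\<lambda>y. (g y - g x) * complex_of_real (fejer_kernel N (x - y)))"
    unfolding fejer_mean_conv[OF g] left_diff_distrib integral_diff[OF i1 i2] by simp
  also have "cmod \<dots> \<le> integral {0..1} (\<lambda>y. \<epsilon> * fejer_kernel N (x - y) + M / (real (Suc N) * \<kappa>\<^sup>2))"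
  proof (intro integral_norm_bound_integral integrable_continuous_real continuous_intros g)
    fix y :: real assume y: "y \<in> {0..1}"
    show "cmod ((g y - g x) * complex_of_real (fejer_kernel N (x - y))) \<le> \<epsilon> * fejer_kernel N (x - y) + M / (real (Suc N) * \<kappa>\<^sup>2)"
    proof (cases "\<bar>sin (pi * (x - y))\<bar> < \<kappa>")
      case True
      have "cmod ((g y - g x) * complex_of_real (fejer_kernel N (x - y))) \<le> \<epsilon> * fejer_kernel N (x - y)"
        using \<epsilon>[OF y True] by (simp add: norm_mult fejer_kernel_nonneg mult_right_mono)
      moreover have "0 \<le> M / (real (Suc N) * \<kappa>\<^sup>2)" using \<open>0 \<le> M\<close> by simp
      ultimately show ?thesis by linarith
    next
      case False
      have "cmod ((g y - g x) * complex_of_real (fejer_kernel N (x - y))) \<le> M * (1 / (real (Suc N) * \<kappa>\<^sup>2))"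
        using M[OF y] fejer_kernel_decay[OF \<kappa>, of "x - y" N] False fejer_kernel_nonneg[of N "x - y"] \<open>0 \<le> M\<close>
        by (simp only: norm_mult norm_of_real abs_of_nonneg) (intro mult_mono, auto)
      moreover have "0 \<le> \<epsilon> * fejer_kernel N (x - y)" using \<open>0 \<le> \<epsilon>\<close> by (simp add: fejer_kernel_nonneg)
      ultimately show ?thesis by simp
    qed
  qed
  also have "\<dots> = \<epsilon> + M / (real (Suc N) * \<kappa>\<^sup>2)"
    by (subst integral_add) (auto intro!: integrable_continuous_real continuous_intros simp: fejer_kernel_integral)
  finally show ?thesis .
qed

text \<open>Translates nearness in the sense of the sine into nearness modulo 1, which the modulus
  of continuity of a periodic function can use.\<close>

lemma sin_pi_small:
  assumes "0 < \<delta>" "\<delta> \<le> 1/2" "\<bar>sin (pi * x)\<bar> < sin (pi * \<delta>)"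
  shows "\<exists>n::int. \<bar>x - of_int n\<bar> < \<delta>"
proof -
  define n where "n = round x"
  define y where "y = x - of_int n"
  have n: "\<bar>y\<bar> \<le> 1/2" using of_int_round_abs_le[of x] by (simp add: n_def y_def abs_minus_commute)
  have "pi * x = pi * of_int n + pi * y" by (simp add: y_def algebra_simps)
  then have "sin (pi * x) = sin (pi * of_int n) * cos (pi * y) + cos (pi * of_int n) * sin (pi * y)"
    by (simp only: sin_add)
  moreover have "sin (pi * of_int n) = 0" by (simp add: sin_times_pi_eq_0 mult.commute)
  moreover from this have "\<bar>cos (pi * of_int n)\<bar> = 1" using sin_zero_abs_cos_one by blast
  ultimately have "\<bar>sin (pi * x)\<bar> = \<bar>sin (pi * y)\<bar>"
    by (simp add: abs_mult)
  moreover have "\<bar>sin (pi * y)\<bar> = sin (pi * \<bar>y\<bar>)"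
  proof -
    have "0 \<le> sin (pi * \<bar>y\<bar>)" using n by (intro sin_ge_zero) auto
    then show ?thesis by (auto simp: abs_if split: if_splits)
  qed
  ultimately have "sin (pi * \<bar>y\<bar>) < sin (pi * \<delta>)" using assms by simp
  have "\<bar>y\<bar> < \<delta>"
  proof (rule ccontr)
    assume "\<not> \<bar>y\<bar> < \<delta>"
    moreover have "- (pi / 2) \<le> pi * \<delta>"
      using assms(1) by (meson order_trans[of _ 0] less_imp_le mult_nonneg_nonneg pi_ge_zero neg_le_0_iff_le pi_half_ge_zero)
    moreover have "pi * \<bar>y\<bar> \<le> pi / 2" using n mult_left_mono[of "\<bar>y\<bar>" "1/2" pi] by simp
    ultimately have "sin (pi * \<delta>) \<le> sin (pi * \<bar>y\<bar>)"
      by (intro sin_monotone_2pi_le) auto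
    then show False using \<open>sin (pi * \<bar>y\<bar>) < sin (pi * \<delta>)\<close> by simp
  qed
  then show ?thesis unfolding y_def by blast
qed

section \<open>Existence of the dyadic partition of unity\<close>

text \<open>\<open>smooth_fun\<close> iterates \<open>deriv\<close>, which is awkward under products
  and compositions. Here each derivative is an existential witness, so closure properties follow by
  induction; \<open>smooth_funI\<close> translates back.\<close>

primrec times_differentiable :: "nat \<Rightarrow> (real \<Rightarrow> real) \<Rightarrow> bool" where
  "times_differentiable 0 f \<longleftrightarrow> True"
| "times_differentiable (Suc n) f \<longleftrightarrow>
     (\<exists>f'. (\<forall>x. (f has_real_derivative f' x) (at x)) \<and> times_differentiable n f')"

lemma times_differentiable_mono: "times_differentiable (Suc n) f \<Longrightarrow> times_differentiable n f"
  by (induction n arbitrary: f) (simp, metis times_differentiable.simps(2))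

lemma times_differentiable_const: "times_differentiable n (\<lambda>_. c)"
proof (induction n arbitrary: c)
  case (Suc n)
  show ?case by (auto intro!: exI[of _ "\<lambda>_. 0"] Suc.IH)
qed simp

lemma times_differentiable_id: "times_differentiable n (\<lambda>x. x)"
proof (cases n)
  case (Suc k)
  then show ?thesis by (auto intro!: exI[of _ "\<lambda>_. 1"] times_differentiable_const)
qed simp

lemma times_differentiable_add:
  "times_differentiable n f \<Longrightarrow> times_differentiable n g \<Longrightarrow> times_differentiable n (\<lambda>x. f x + g x)"
proof (induction n arbitrary: f g)
  case (Suc n)
  then obtain f' g' where "\<forall>x. (f has_real_derivative f' x) (at x)" "times_differentiable n f'"
     "\<forall>x. (g has_real_derivative g' x) (at x)" "times_differentiable n g'" by auto
  then show ?case by (auto intro!: exI[of _ "\<lambda>x. f' x + g' x"] Suc.IH derivative_intros)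
qed simp

lemma times_differentiable_mult:
  "times_differentiable n f \<Longrightarrow> times_differentiable n g \<Longrightarrow> times_differentiable n (\<lambda>x. f x * g x)"
proof (induction n arbitrary: f g)
  case (Suc n)
  then obtain f' g' where "\<forall>x. (f has_real_derivative f' x) (at x)" "times_differentiable n f'"
     "\<forall>x. (g has_real_derivative g' x) (at x)" "times_differentiable n g'" by auto
  with times_differentiable_mono[OF Suc.prems(1)] times_differentiable_mono[OF Suc.prems(2)] show ?case
    by (auto intro!: exI[of _ "\<lambda>x. f' x * g x + g' x * f x"] Suc.IH times_differentiable_add derivative_intros)
qed simp

lemma times_differentiable_inverse:
  "times_differentiable n f \<Longrightarrow> (\<And>x. f x \<noteq> 0) \<Longrightarrow> times_differentiable n (\<lambda>x. inverse (f x))"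
proof (induction n arbitrary: f)
  case (Suc n)
  then obtain f' where f': "\<forall>x. (f has_real_derivative f' x) (at x)" "times_differentiable n f'" by auto
  have "times_differentiable n (\<lambda>x. inverse (f x))"
    using times_differentiable_mono[OF Suc.prems(1)] Suc by blast
  then have "times_differentiable n (\<lambda>x. (- 1) * (inverse (f x) * f' x * inverse (f x)))"
    using f' by (intro times_differentiable_mult times_differentiable_const)
  moreover have "\<forall>x. ((\<lambda>x. inverse (f x)) has_real_derivative (- 1) * (inverse (f x) * f' x * inverse (f x))) (at x)"
    using f' Suc.prems(2) by (auto intro!: derivative_eq_intros)
  ultimately show ?case unfolding times_differentiable.simps
    by (intro exI[of _ "\<lambda>x. (- 1) * (inverse (f x) * f' x * inverse (f x))"] conjI)
qed simp

lemma times_differentiable_compose: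
  "times_differentiable n f \<Longrightarrow> times_differentiable n g \<Longrightarrow> times_differentiable n (\<lambda>x. f (g x))"
proof (induction n arbitrary: f g)
  case (Suc n)
  then obtain f' g' where d: "\<forall>x. (f has_real_derivative f' x) (at x)" "times_differentiable n f'"
     "\<forall>x. (g has_real_derivative g' x) (at x)" "times_differentiable n g'" by auto
  then have "times_differentiable n (\<lambda>x. f' (g x) * g' x)"
    using Suc.IH[OF d(2) times_differentiable_mono[OF Suc.prems(2)]] by (intro times_differentiable_mult)
  moreover have "\<forall>x. ((\<lambda>x. f (g x)) has_real_derivative f' (g x) * g' x) (at x)"
    using d by (auto intro: DERIV_chain2)
  ultimately show ?case unfolding times_differentiable.simps
    by (intro exI[of _ "\<lambda>x. f' (g x) * g' x"] conjI)
qed simp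

lemma smooth_funI:
  assumes "\<And>n. times_differentiable n f"
  shows "smooth_fun f"
proof -
  have "times_differentiable (Suc n) f \<Longrightarrow> (deriv ^^ n) f differentiable (at x)" for n x f
  proof (induction n arbitrary: f)
    case 0
    then show ?case by (auto simp: real_differentiable_def)
  next
    case (Suc n)
    then obtain f' where f': "\<forall>x. (f has_real_derivative f' x) (at x)" "times_differentiable (Suc n) f'"
      by (auto simp del: times_differentiable.simps(2) simp: times_differentiable.simps(2)[of "Suc n"])
    then have "deriv f = f'" by (auto intro!: ext DERIV_imp_deriv)
    then show ?case using Suc.IH[OF f'(2)] by (simp add: funpow_Suc_right del: funpow.simps)
  qed
  then show ?thesis using assms unfolding smooth_fun_def by blast
qed

text \<open>The classical flat function exp (-1/x) with polynomial factors in 1/x: the family is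
  closed under differentiation, so smoothness follows by induction over all \<open>p\<close> at
  once.\<close>

definition flat_fun :: "real poly \<Rightarrow> real \<Rightarrow> real" where
  "flat_fun p x = (if x > 0 then poly p (1 / x) * exp (- 1 / x) else 0)"

lemma poly_exp_tendsto_0: "((\<lambda>y::real. poly p y * exp (- y)) \<longlongrightarrow> 0) at_top"
proof -
  have "((\<lambda>y::real. y ^ i / exp y) \<longlongrightarrow> 0) at_top" for i
    by (rule tendsto_power_div_exp_0)
  then have "((\<lambda>y::real. \<Sum>i\<le>degree p. coeff p i * (y ^ i / exp y)) \<longlongrightarrow> (\<Sum>i\<le>degree p. coeff p i * 0)) at_top"
    by (intro tendsto_sum tendsto_mult tendsto_const)
  moreover have "(\<Sum>i\<le>degree p. coeff p i * (y ^ i / exp y)) = poly p y * exp (- y)" for y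
    by (simp add: poly_altdef sum_distrib_right exp_minus divide_inverse mult.assoc)
  ultimately show ?thesis by simp
qed

text \<open>With y = 1/x one has dy/dx = - y^2, so p(y) exp(-y) has derivative y^2 (p - p')(y)
  exp(-y), and \<open>[:0, 0, 1:]\<close> is y^2. At 0 the difference quotient from the right is y
  p(y) exp(-y), which tends to 0.\<close>

lemma flat_fun_derivative:
  "(flat_fun p has_real_derivative flat_fun ([:0, 0, 1:] * (p - pderiv p)) x) (at x)"
proof -
  consider "x > 0" | "x < 0" | "x = 0" by linarith
  then show ?thesis
  proof cases
    case 1
    have "((\<lambda>x. poly p (1 / x) * exp (- 1 / x)) has_real_derivative
        poly ([:0, 0, 1:] * (p - pderiv p)) (1 / x) * exp (- 1 / x)) (at x)"
      using 1 by (auto intro!: derivative_eq_intros simp: field_simps power2_eq_square)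
    then have "((\<lambda>x. poly p (1 / x) * exp (- 1 / x)) has_real_derivative
        flat_fun ([:0, 0, 1:] * (p - pderiv p)) x) (at x)" using 1 by (simp add: flat_fun_def)
    then show ?thesis
      by (rule has_field_derivative_transform_within_open[of _ _ _ "{0<..}"])
         (use 1 in \<open>auto simp: flat_fun_def\<close>)
  next
    case 2
    have "((\<lambda>x. 0) has_real_derivative flat_fun ([:0, 0, 1:] * (p - pderiv p)) x) (at x)"
      using 2 by (simp add: flat_fun_def)
    then show ?thesis
      by (rule has_field_derivative_transform_within_open[of _ _ _ "{..<0}"])
         (use 2 in \<open>auto simp: flat_fun_def\<close>)
  next
    case 3
    have "((\<lambda>h. flat_fun p h / h) \<longlongrightarrow> 0) (at_right 0)"
    proof -
      have "((\<lambda>h. poly (pCons 0 p) (inverse h) * exp (- inverse h)) \<longlongrightarrow> 0) (at_right 0)"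
        by (rule filterlim_compose[OF poly_exp_tendsto_0 filterlim_inverse_at_top_right])
      then show ?thesis
        by (rule Lim_transform_eventually)
           (auto simp: flat_fun_def eventually_at_right_less field_simps intro!: eventually_mono[OF eventually_at_right_less[of 0]])
    qed
    moreover have "((\<lambda>h. flat_fun p h / h) \<longlongrightarrow> 0) (at_left 0)"
      by (rule Lim_transform_eventually[OF tendsto_const])
         (auto simp: flat_fun_def eventually_at_left_field intro!: exI[of _ "-1"])
    ultimately have "((\<lambda>h. flat_fun p h / h) \<longlongrightarrow> 0) (at 0)"
      by (simp add: filterlim_split_at)
    then show ?thesis using 3 by (simp add: DERIV_def flat_fun_def)
  qed
qed

lemma times_differentiable_flat_fun: "times_differentiable n (flat_fun p)"
proof (induction n arbitrary: p)
  case (Suc n)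
  show ?case using flat_fun_derivative Suc.IH by auto
qed simp

text \<open>Composing with the square makes the cutoff even and smooth at 0.\<close>

definition cutoff :: "real \<Rightarrow> real" where
  "cutoff x = flat_fun 1 (25/16 - x * x) * inverse (flat_fun 1 (25/16 - x * x) + flat_fun 1 (x * x + (- 9/16)))"

lemma flat_fun_1: "flat_fun 1 x = (if x > 0 then exp (- 1 / x) else 0)"
  by (simp add: flat_fun_def)

text \<open>The two arguments add up to 1, so at least one is positive. Their constants are the
  squares of 5/4 and 3/4, the radii between which the cutoff falls from 1 to 0.\<close>

lemma cutoff_denom_pos: "flat_fun 1 (25/16 - x * x) + flat_fun 1 (x * x + (- 9/16)) > 0"
  by (simp add: flat_fun_1 add_pos_pos)

lemma cutoff_nonneg: "0 \<le> cutoff x"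
  and cutoff_le_1: "cutoff x \<le> 1"
  and cutoff_even: "cutoff (- x) = cutoff x"
  using cutoff_denom_pos[of x] by (auto simp: cutoff_def flat_fun_1 field_simps)

lemma cutoff_eq_1:
  assumes "\<bar>x\<bar> \<le> 3/4"
  shows "cutoff x = 1"
proof -
  have "x * x \<le> (3/4) * (3/4)" using abs_mult_self_eq[of x] assms by (metis abs_ge_zero mult_mono order_trans)
  then show ?thesis using cutoff_denom_pos[of x] by (auto simp: cutoff_def flat_fun_1)
qed

lemma cutoff_eq_0:
  assumes "5/4 \<le> \<bar>x\<bar>"
  shows "cutoff x = 0"
proof -
  have "(5/4) * (5/4) \<le> \<bar>x\<bar> * \<bar>x\<bar>" using assms by (intro mult_mono) auto
  then show ?thesis by (simp add: cutoff_def flat_fun_1)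
qed

lemma times_differentiable_cutoff: "times_differentiable n cutoff"
proof -
  have 1: "times_differentiable n (\<lambda>x. 25/16 + (- 1) * (x * x))" "times_differentiable n (\<lambda>x. x * x + (- 9/16))"
    by (intro times_differentiable_add times_differentiable_mult times_differentiable_id times_differentiable_const)+
  have "times_differentiable n (\<lambda>x. flat_fun 1 (25/16 + (- 1) * (x * x)) *
      inverse (flat_fun 1 (25/16 + (- 1) * (x * x)) + flat_fun 1 (x * x + (- 9/16))))"
    using cutoff_denom_pos
    by (intro times_differentiable_mult times_differentiable_inverse times_differentiable_add
        times_differentiable_compose[OF times_differentiable_flat_fun 1(1)]
        times_differentiable_compose[OF times_differentiable_flat_fun 1(2)])
       (simp add: less_imp_neq[symmetric])
  then show ?thesis by (simp add: cutoff_def[abs_def])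
qed

text \<open>\<open>lp_pair\<close> is a choice by \<open>SOME\<close>; it is this existence result
  that gives \<open>besov_norm\<close> its content.\<close>

lemma dyadic_partition_exists: "\<exists>chi rh. dyadic_partition chi rh"
proof -
  \<comment> \<open>A difference of dilated cutoffs, so that the sum over the dyadic scales
    telescopes. It lives on 3/4 <= |x| <= 5/2, inside the prescribed annulus.\<close>
  define rh where "rh = (\<lambda>x. cutoff ((1/2) * x) + (- 1) * cutoff x)"
  have smooth: "smooth_fun cutoff" "smooth_fun rh"
    unfolding rh_def
    by (intro smooth_funI times_differentiable_cutoff times_differentiable_add times_differentiable_mult
      times_differentiable_compose[OF times_differentiable_cutoff] times_differentiable_const times_differentiable_id)+
  have rh0: "rh x = 0" if "\<bar>x\<bar> < 3/4 \<or> 5/2 < \<bar>x\<bar>" for x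
    using that cutoff_eq_1[of x] cutoff_eq_1[of "1/2 * x"] cutoff_eq_0[of x] cutoff_eq_0[of "1/2*x"] by (auto simp: rh_def)
  have rh01: "0 \<le> rh x \<and> rh x \<le> 1" for x
  proof (cases "\<bar>x\<bar> \<le> 5/4")
    case True
    then show ?thesis using cutoff_eq_1[of "1/2 * x"] cutoff_nonneg[of x] cutoff_le_1[of x] by (auto simp: rh_def)
  next
    case False
    then show ?thesis using cutoff_eq_0[of x] cutoff_nonneg[of "1/2*x"] cutoff_le_1[of "1/2*x"] by (auto simp: rh_def)
  qed
  have csupp: "closure {x. cutoff x \<noteq> 0} \<subseteq> {x. \<bar>x\<bar> \<le> 5/4}"
    by (rule closure_minimal) (use cutoff_eq_0 in \<open>force\<close>, intro closed_Collect_le continuous_intros)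
  have rsupp: "closure {x. rh (x / 2 ^ j) \<noteq> 0} \<subseteq> {x::real. 3/4 * 2 ^ j \<le> \<bar>x\<bar> \<and> \<bar>x\<bar> \<le> 5/2 * 2 ^ j}" for j :: nat
  proof (rule closure_minimal)
    show "{x. rh (x / 2 ^ j) \<noteq> 0} \<subseteq> {x::real. 3/4 * 2 ^ j \<le> \<bar>x\<bar> \<and> \<bar>x\<bar> \<le> 5/2 * 2 ^ j}"
    proof safe
      fix x assume "rh (x / 2 ^ j) \<noteq> 0"
      then have "\<not> (\<bar>x / 2 ^ j\<bar> < 3/4 \<or> 5/2 < \<bar>x / 2 ^ j\<bar>)" using rh0 by blast
      then show "3/4 * 2 ^ j \<le> \<bar>x\<bar>" "\<bar>x\<bar> \<le> 5/2 * 2 ^ j" by (auto simp: field_simps)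
    qed
    show "closed {x::real. 3/4 * 2 ^ j \<le> \<bar>x\<bar> \<and> \<bar>x\<bar> \<le> 5/2 * 2 ^ j}"
      by (intro closed_Collect_conj closed_Collect_le continuous_intros)
  qed
  have sums: "cutoff x + (\<Sum>j. rh (x / 2 ^ j)) = 1" for x
  proof -
    have "(\<lambda>j. cutoff (x / 2 ^ j)) \<longlonglongrightarrow> 1"
    proof (rule tendsto_eventually)
      have "(\<lambda>j. \<bar>x\<bar> / 2 ^ j) \<longlonglongrightarrow> 0" by (rule LIMSEQ_divide_realpow_zero) simp
      then have "eventually (\<lambda>j. \<bar>x\<bar> / 2 ^ j < 3/4) sequentially" by (rule order_tendstoD) simp
      then show "eventually (\<lambda>j. cutoff (x / 2 ^ j) = 1) sequentially"
        by eventually_elim (auto intro!: cutoff_eq_1)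
    qed
    from telescope_sums[OF this] have "(\<lambda>j. cutoff (x / 2 ^ Suc j) - cutoff (x / 2 ^ j)) sums (1 - cutoff x)" by simp
    then have "(\<lambda>j. rh (x / 2 ^ j)) sums (1 - cutoff x)" by (simp add: rh_def field_simps)
    then show ?thesis by (simp add: sums_unique[symmetric])
  qed
  \<comment> \<open>Scales at least two apart have disjoint supports because 5/2 * 2^i < 3 * 2^i <=
    3/4 * 2^j.\<close>
  have two: "(2::real) ^ j \<ge> 4 * 2 ^ i" if "i + 2 \<le> j" for i j :: nat
    using power_increasing[OF that, of "2::real"] by (simp add: power_add)
  show ?thesis unfolding dyadic_partition_def
  proof (rule exI[of _ cutoff], rule exI[of _ rh], intro conjI allI impI smooth)
    show "closure {x. cutoff x \<noteq> 0} \<subseteq> ball 0 (4/3)" using csupp by (force simp: dist_real_def)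
    show "closure {x. rh x \<noteq> 0} \<subseteq> {x. 3/4 \<le> \<bar>x\<bar> \<and> \<bar>x\<bar> \<le> 8/3}" using rsupp[of 0] by force
    show "closure {x. cutoff x \<noteq> 0} \<inter> closure {x. rh (x / 2 ^ j) \<noteq> 0} = {}" if "j \<ge> 1" for j :: nat
    proof -
      have "(2::real) ^ j \<ge> 2" using power_increasing[OF that, of "2::real"] by simp
      then show ?thesis using csupp rsupp[of j] by (force)
    qed
    show "closure {x. rh (x / 2 ^ i) \<noteq> 0} \<inter> closure {x. rh (x / 2 ^ j) \<noteq> 0} = {}" if "i + 2 \<le> j" for i j :: nat
      using rsupp[of i] rsupp[of j] two[OF that] zero_less_power[of "2::real" i] by fastforce
    show "cutoff x + (\<Sum>j. rh (x / 2 ^ j)) = 1" for x by (rule sums)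
    show "cutoff (- x) = cutoff x" "rh (- x) = rh x" for x
      using cutoff_even[of x] cutoff_even[of "1/2*x"] by (simp_all add: rh_def)
  qed (use cutoff_nonneg cutoff_le_1 rh01 in auto)
qed

lemma lp_pair: "dyadic_partition (fst lp_pair) (snd lp_pair)"
  unfolding lp_pair_def by (rule someI_ex) (use dyadic_partition_exists in auto)

section \<open>Sup-norm control by the Hoelder--Besov norm\<close>

lemma periodic1_of_int:
  assumes "periodic1 f"
  shows "f (x + of_int n) = f x"
proof (induction n rule: int_induct[where k = 0])
  case base show ?case by simp
next
  case (step1 i)
  then show ?case using assms unfolding periodic1_def by (metis add.assoc of_int_1 of_int_add)
next
  case (step2 i)
  have "f (x + of_int (i - 1) + 1) = f (x + of_int (i - 1))" using assms unfolding periodic1_def by blast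
  then show ?case using step2 by (simp add: algebra_simps)
qed

lemma periodic_family_uniform:
  fixes F :: "real \<Rightarrow> real \<Rightarrow> real"
  assumes cont: "continuous_on ({a..b} \<times> UNIV) (\<lambda>(s, x). F s x)"
    and per: "\<And>s. s \<in> {a..b} \<Longrightarrow> periodic1 (F s)"
  shows "\<exists>M. \<forall>s\<in>{a..b}. \<forall>x. \<bar>F s x\<bar> \<le> M"
    and "0 < \<epsilon> \<Longrightarrow> \<exists>\<delta>>0. \<forall>s\<in>{a..b}. \<forall>t\<in>{a..b}. \<forall>x y. \<bar>s - t\<bar> < \<delta> \<longrightarrow> \<bar>x - y\<bar> < \<delta> \<longrightarrow> \<bar>F s x - F t y\<bar> < \<epsilon>"
proof -
  \<comment> \<open>Both points are shifted by the same integer, the floor of x: then x lies in [0,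
    1) and a point y at distance below 1 lands in [-1, 2].\<close>
  let ?K = "{a..b} \<times> {- 1..2::real}"
  have c: "continuous_on ?K (\<lambda>(s, x). F s x)" by (rule continuous_on_subset[OF cont]) auto
  have K: "compact ?K" by (intro compact_Times compact_Icc)
  have sh: "F s x = F s (x - of_int \<lfloor>x\<rfloor>)" if "s \<in> {a..b}" for s x
    using periodic1_of_int[OF per[OF that], of "x - of_int \<lfloor>x\<rfloor>" "\<lfloor>x\<rfloor>"] by simp
  have fl: "0 \<le> x - of_int \<lfloor>x\<rfloor>" "x - of_int \<lfloor>x\<rfloor> < 1" for x :: real by linarith+
  have "bounded ((\<lambda>(s, x). F s x) ` ?K)"
    by (intro compact_imp_bounded compact_continuous_image c K)
  then obtain M where M: "\<And>s x. s \<in> {a..b} \<Longrightarrow> x \<in> {- 1..2} \<Longrightarrow> \<bar>F s x\<bar> \<le> M"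
    unfolding bounded_iff by fastforce
  show "\<exists>M. \<forall>s\<in>{a..b}. \<forall>x. \<bar>F s x\<bar> \<le> M"
  proof (intro exI[of _ M] ballI allI)
    fix s x assume s: "s \<in> {a..b}"
    show "\<bar>F s x\<bar> \<le> M"
      unfolding sh[OF s, of x] by (rule M[OF s]) (use fl[of x] in \<open>auto intro: order_trans[of _ 0]\<close>)
  qed
  assume "0 < \<epsilon>"
  have "uniformly_continuous_on ?K (\<lambda>(s, x). F s x)" by (rule compact_uniformly_continuous[OF c K])
  then obtain \<delta> where \<delta>: "0 < \<delta>" "\<And>p q. p \<in> ?K \<Longrightarrow> q \<in> ?K \<Longrightarrow> dist q p < \<delta> \<Longrightarrow> dist ((\<lambda>(s, x). F s x) q) ((\<lambda>(s, x). F s x) p) < \<epsilon>"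
    unfolding uniformly_continuous_on_def using \<open>0 < \<epsilon>\<close> by metis
  show "\<exists>\<delta>>0. \<forall>s\<in>{a..b}. \<forall>t\<in>{a..b}. \<forall>x y. \<bar>s - t\<bar> < \<delta> \<longrightarrow> \<bar>x - y\<bar> < \<delta> \<longrightarrow> \<bar>F s x - F t y\<bar> < \<epsilon>"
  proof (intro exI[of _ "min (\<delta>/2) 1"] conjI ballI allI impI)
    fix s t x y assume s: "s \<in> {a..b}" and t: "t \<in> {a..b}"
      and st: "\<bar>s - t\<bar> < min (\<delta>/2) 1" and xy: "\<bar>x - y\<bar> < min (\<delta>/2) 1"
    let ?n = "\<lfloor>x\<rfloor>"
    have e: "F s x = F s (x - of_int ?n)" "F t y = F t (y - of_int ?n)"
      using periodic1_of_int[OF per[OF s], of "x - of_int ?n" "?n"]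
        periodic1_of_int[OF per[OF t], of "y - of_int ?n" "?n"] by simp_all
    have m: "-1 \<le> y - of_int ?n" "y - of_int ?n \<le> 2" using xy fl[of x] by linarith+
    have "dist (s, x - of_int ?n) (t, y - of_int ?n) \<le> \<bar>s - t\<bar> + \<bar>x - y\<bar>"
      unfolding dist_Pair_Pair using sqrt_sum_squares_le_sum_abs[of "s - t" "x - y"] by (simp add: dist_real_def)
    also have "\<dots> < \<delta>" using st xy by linarith
    finally show "\<bar>F s x - F t y\<bar> < \<epsilon>"
      unfolding e using \<delta>(2)[of "(t, y - of_int ?n)" "(s, x - of_int ?n)"] s t fl[of x] m
      by (auto simp: dist_real_def)
  qed (use \<delta> in auto)
qed

lemma continuous_on_const_family:
  "continuous_on UNIV f \<Longrightarrow> continuous_on (A \<times> UNIV) (\<lambda>(s, x). f x)"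
  unfolding split_beta by (rule continuous_on_compose2[of UNIV f]) (auto intro: continuous_intros)

lemma continuous_on_slice:
  assumes "continuous_on (A \<times> UNIV) (\<lambda>(s, x). F s x)" "s \<in> A"
  shows "continuous_on UNIV (F s)"
proof -
  have "continuous_on UNIV (\<lambda>x. (\<lambda>(s, x). F s x) (s, x))"
    by (rule continuous_on_compose2[OF assms(1)]) (auto intro: continuous_intros assms)
  then show ?thesis by simp
qed

text \<open>Sup bound and modulus of continuity are uniform over the compact time interval, so one
  truncation order serves all times in it.\<close>

lemma fejer_uniform:
  fixes F :: "real \<Rightarrow> real \<Rightarrow> real"
  assumes cont: "continuous_on ({a..b} \<times> UNIV) (\<lambda>(s, x). F s x)"
    and per: "\<And>s. s \<in> {a..b} \<Longrightarrow> periodic1 (F s)"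
    and "0 < \<epsilon>"
  shows "\<exists>N0. \<forall>N\<ge>N0. \<forall>s\<in>{a..b}. \<forall>x. cmod (fejer_mean N (fcoef (F s)) x - of_real (F s x)) \<le> \<epsilon>"
proof -
  obtain M0 where M0: "\<And>s x. s \<in> {a..b} \<Longrightarrow> \<bar>F s x\<bar> \<le> M0"
    using periodic_family_uniform(1)[OF cont per] by blast
  define M where "M = max M0 0"
  have M: "\<bar>F s x\<bar> \<le> M" if "s \<in> {a..b}" for s x using M0[OF that, of x] by (simp add: M_def)
  have "0 \<le> M" by (simp add: M_def)
  obtain \<delta>0 where \<delta>0: "\<delta>0 > 0" "\<And>s x y. s \<in> {a..b} \<Longrightarrow> \<bar>x - y\<bar> < \<delta>0 \<Longrightarrow> \<bar>F s x - F s y\<bar> < \<epsilon>/2"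
  proof -
    obtain d where "d > 0" "\<forall>s\<in>{a..b}. \<forall>t\<in>{a..b}. \<forall>x y. \<bar>s - t\<bar> < d \<longrightarrow> \<bar>x - y\<bar> < d \<longrightarrow> \<bar>F s x - F t y\<bar> < \<epsilon>/2"
      using periodic_family_uniform(2)[OF cont per, of "\<epsilon>/2"] \<open>0 < \<epsilon>\<close> by auto
    then show ?thesis by (intro that[of d]) auto
  qed
  define \<delta> where "\<delta> = min \<delta>0 (1/2)"
  have \<delta>: "0 < \<delta>" "\<delta> \<le> 1/2" "\<delta> \<le> \<delta>0" using \<delta>0 by (auto simp: \<delta>_def)
  define \<kappa> where "\<kappa> = sin (pi * \<delta>)"
  have "0 < \<kappa>" unfolding \<kappa>_def using \<delta> by (intro sin_gt_zero) auto
  obtain N0 :: nat where N0: "2 * M / \<kappa>\<^sup>2 / (\<epsilon>/2) < real N0" using reals_Archimedean2 by blast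
  show ?thesis
  proof (intro exI[of _ N0] allI impI ballI)
    fix N s x assume N: "N \<ge> N0" and s: "s \<in> {a..b}"
    let ?g = "\<lambda>x. complex_of_real (F s x)"
    have cs: "continuous_on UNIV (F s)" by (rule continuous_on_slice[OF cont s])
    have "cmod (fejer_mean N (ccoef ?g) x - ?g x) \<le> \<epsilon>/2 + (2 * M) / (real (Suc N) * \<kappa>\<^sup>2)"
    proof (rule fejer_mean_approx)
      show "continuous_on {0..1} ?g"
        by (intro continuous_intros continuous_on_subset[OF cs]) auto
      show "cmod (?g y - ?g x) \<le> 2 * M" for y
        using M[OF s, of y] M[OF s, of x] by (simp flip: of_real_diff)
      fix y assume "\<bar>sin (pi * (x - y))\<bar> < \<kappa>"
      then obtain n :: int where n: "\<bar>(x - y) - of_int n\<bar> < \<delta>"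
        using sin_pi_small[OF \<delta>(1,2)] unfolding \<kappa>_def by blast
      have "\<bar>F s (y + of_int n) - F s x\<bar> < \<epsilon>/2"
        by (rule \<delta>0(2)[OF s]) (use n \<delta>(3) in linarith)
      then show "cmod (?g y - ?g x) \<le> \<epsilon>/2"
        using periodic1_of_int[OF per[OF s], of y n] by (simp flip: of_real_diff)
    qed (use \<open>0 < \<epsilon>\<close> \<open>0 \<le> M\<close> \<open>0 < \<kappa>\<close> in auto)
    also have "(2 * M) / (real (Suc N) * \<kappa>\<^sup>2) \<le> \<epsilon>/2"
    proof -
      have "2 * M / \<kappa>\<^sup>2 \<le> (\<epsilon>/2) * real (Suc N)"
      proof -
        have "2 * M / \<kappa>\<^sup>2 < real N0 * (\<epsilon>/2)" using N0 \<open>0 < \<epsilon>\<close> by (subst (asm) pos_divide_less_eq) auto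
        also have "real N0 * (\<epsilon>/2) \<le> real (Suc N) * (\<epsilon>/2)" using N \<open>0 < \<epsilon>\<close> by (intro mult_right_mono) auto
        finally show ?thesis by (simp add: mult.commute)
      qed
      then have "2 * M / \<kappa>\<^sup>2 / real (Suc N) \<le> \<epsilon>/2" by (subst pos_divide_le_eq) simp_all
      then show ?thesis by (simp only: divide_divide_eq_left mult.commute)
    qed
    finally show "cmod (fejer_mean N (fcoef (F s)) x - ?g x) \<le> \<epsilon>"
      using fcoef_eq_ccoef[OF cs] by (simp add: ext[of "fcoef (F s)" "ccoef ?g"])
  qed
qed

section \<open>Littlewood-Paley blocks and the sup norm\<close>

lemma lp_mult_eq_0:
  assumes "j \<ge> -1" "2 powr real_of_int (j + 2) < \<bar>\<xi>\<bar>"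
  shows "lp_mult j \<xi> = 0"
proof (cases "j = -1")
  case True
  then have "\<xi> \<notin> ball 0 (4/3)" using assms by (simp add: dist_real_def)
  then have "fst lp_pair \<xi> = 0" using lp_pair unfolding dyadic_partition_def
    by (metis (mono_tags, lifting) closure_subset mem_Collect_eq subsetD)
  then show ?thesis using True by (simp add: lp_mult_def)
next
  case False
  let ?y = "\<xi> / 2 powr real_of_int j"
  have "8/3 < \<bar>?y\<bar>" using assms(2) by (simp add: powr_add field_simps)
  then have "?y \<notin> {\<xi>. 3/4 \<le> \<bar>\<xi>\<bar> \<and> \<bar>\<xi>\<bar> \<le> 8/3}" by auto
  then have "snd lp_pair ?y = 0" using lp_pair unfolding dyadic_partition_def
    by (metis (mono_tags, lifting) closure_subset mem_Collect_eq subsetD)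
  then show ?thesis using False by (simp add: lp_mult_def)
qed

text \<open>Above level J all annuli start beyond the given frequency, so the partition of unity is
  already complete.\<close>

lemma lp_mult_sum:
  assumes "\<bar>\<xi>\<bar> < 3/4 * 2 ^ Suc J"
  shows "(\<Sum>j\<in>{-1..int J}. lp_mult j \<xi>) = 1"
proof -
  have z: "snd lp_pair (\<xi> / 2 ^ j) = 0" if "j \<notin> {..J}" for j
  proof -
    have "(2::real) ^ Suc J \<le> 2 ^ j" using that by (intro power_increasing) auto
    then have "\<bar>\<xi>\<bar> < 3/4 * 2 ^ j" using assms by linarith
    then have "\<bar>\<xi> / 2 ^ j\<bar> < 3/4" by (simp add: field_simps)
    then have "\<xi> / 2 ^ j \<notin> {\<xi>. 3/4 \<le> \<bar>\<xi>\<bar> \<and> \<bar>\<xi>\<bar> \<le> 8/3}" by auto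
    then show ?thesis using lp_pair unfolding dyadic_partition_def
      by (metis (mono_tags, lifting) closure_subset mem_Collect_eq subsetD)
  qed
  have "(\<Sum>j. snd lp_pair (\<xi> / 2 ^ j)) = (\<Sum>j\<le>J. snd lp_pair (\<xi> / 2 ^ j))"
    by (rule suminf_finite) (use z in auto)
  moreover have "fst lp_pair \<xi> + (\<Sum>j. snd lp_pair (\<xi> / 2 ^ j)) = 1"
    using lp_pair unfolding dyadic_partition_def by blast
  moreover have "{-1..int J} = insert (-1) (int ` {..J})"
  proof (intro equalityI subsetI)
    fix j assume j: "j \<in> {-1..int J}"
    show "j \<in> insert (-1) (int ` {..J})"
    proof (cases "j = -1")
      case False
      then have "j = int (nat j)" "nat j \<in> {..J}" using j by auto
      then show ?thesis by blast
    qed simp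
  qed auto
  moreover have "(\<Sum>j\<in>int ` {..J}. lp_mult j \<xi>) = (\<Sum>j\<le>J. snd lp_pair (\<xi> / 2 ^ j))"
    by (subst sum.reindex) (auto simp: lp_mult_def powr_realpow intro!: sum.cong)
  ultimately show ?thesis by (subst \<open>{-1..int J} = _\<close>, subst sum.insert) (auto simp: lp_mult_def)
qed

lemma finite_int_abs_le: "finite {k::int. \<bar>real_of_int k\<bar> \<le> r}"
proof (rule finite_subset)
  show "{k::int. \<bar>real_of_int k\<bar> \<le> r} \<subseteq> {- \<lceil>r\<rceil>..\<lceil>r\<rceil>}"
    by (auto simp: abs_le_iff) linarith+
qed simp

lemma lp_block_continuous: "continuous_on A (lp_block j c)"
  unfolding lp_block_def[abs_def] by (intro continuous_intros)

lemma lp_block_bdd: "bdd_above (range (\<lambda>x. cmod (lp_block j c x)))"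
proof (rule bdd_aboveI2)
  fix x
  show "cmod (lp_block j c x) \<le> (\<Sum>k\<in>{k. \<bar>real_of_int k\<bar> \<le> 2 powr real_of_int (j + 2)}.
      cmod (complex_of_real (lp_mult j (real_of_int k)) * c k))"
    unfolding lp_block_def by (rule sum_norm_le) (simp add: norm_mult)
qed

text \<open>Holds for every k, also beyond the summation range of \<open>lp_block\<close>, because
  the multiplier vanishes there. It presents each block as a continuous function with known
  coefficients, to which \<open>fejer_mean_norm_le\<close> applies.\<close>

lemma ccoef_lp_block:
  assumes "j \<ge> -1"
  shows "ccoef (lp_block j c) k = complex_of_real (lp_mult j (real_of_int k)) * c k"
proof -
  let ?S = "{k. \<bar>real_of_int k\<bar> \<le> 2 powr real_of_int (j + 2)}"
  have "ccoef (lp_block j c) k = integral {0..1} (\<lambda>x. \<Sum>l\<in>?S.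
      (complex_of_real (lp_mult j (real_of_int l)) * c l) * cis (2 * pi * real_of_int (l - k) * x))"
    unfolding ccoef_def lp_block_def sum_distrib_right
    by (intro integral_cong sum.cong refl) (simp add: mult.assoc cis_mult, simp add: algebra_simps)
  also have "\<dots> = (\<Sum>l\<in>?S. (complex_of_real (lp_mult j (real_of_int l)) * c l) * (if l - k = 0 then 1 else 0))"
    by (subst integral_sum) (auto simp: finite_int_abs_le integral_cis simp del: of_int_diff
        intro!: integrable_continuous_real continuous_intros)
  also have "\<dots> = (if k \<in> ?S then complex_of_real (lp_mult j (real_of_int k)) * c k else 0)"
    by (simp add: finite_int_abs_le if_distrib sum.delta' cong: if_cong) 
  also have "\<dots> = complex_of_real (lp_mult j (real_of_int k)) * c k"
    using lp_mult_eq_0[OF assms, of "real_of_int k"] by auto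
  finally show ?thesis .
qed

lemma fejer_mean_add:
  "fejer_mean N (\<lambda>k. c k + d k) x = fejer_mean N c x + fejer_mean N d x"
  by (simp add: fejer_mean_def distrib_right sum.distrib add_divide_distrib)

lemma fejer_mean_sum:
  "finite S \<Longrightarrow> fejer_mean N (\<lambda>k. \<Sum>j\<in>S. c j k) x = (\<Sum>j\<in>S. fejer_mean N (c j) x)"
  by (induction S rule: finite_induct) (simp_all add: fejer_mean_add, simp add: fejer_mean_def)

text \<open>A Fejer mean of order N sees only |k| <= N, hence finitely many blocks. Each block is
  contracted in sup norm and is at most 2^(-j \<alpha>) times the norm; the geometric series
  starting at j = -1 with ratio 2^(-\<alpha>) gives the constant, independent of N.\<close>

lemma fejer_mean_le_besov:
  assumes bdd: "bdd_above (besov_seq \<alpha> c ` {-1..})" and "0 < \<alpha>"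
  shows "cmod (fejer_mean N c x) \<le> 2 powr \<alpha> / (1 - 2 powr - \<alpha>) * besov_norm \<alpha> c"
proof -
  obtain J :: nat where "real (Suc N) / (3/4) < 2 ^ J" using real_arch_pow[of 2 "real (Suc N) / (3/4)"] by auto
  then have J: "real N < 3/4 * 2 ^ Suc J" by (simp add: field_simps)
  let ?q = "2 powr - \<alpha> :: real"
  have q: "0 < ?q" "?q < 1" using \<open>0 < \<alpha>\<close> by (auto simp: powr_less_one)
  have bs: "besov_seq \<alpha> c j \<le> besov_norm \<alpha> c" if "j \<ge> -1" for j
    unfolding besov_norm_def by (rule cSUP_upper) (use that bdd in auto)
  have "0 \<le> besov_seq \<alpha> c 0"
    unfolding besov_seq_def by (intro mult_nonneg_nonneg order_trans[OF norm_ge_zero cSUP_upper[OF UNIV_I lp_block_bdd]]) auto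
  then have bn: "0 \<le> besov_norm \<alpha> c" using bs[of 0] by simp
  have "fejer_mean N c x = fejer_mean N (\<lambda>k. \<Sum>j\<in>{-1..int J}. complex_of_real (lp_mult j (real_of_int k)) * c k) x"
  proof -
    have "(\<Sum>j\<in>{-1..int J}. complex_of_real (lp_mult j (real_of_int (int i - int l))) * c (int i - int l)) = c (int i - int l)"
      if "i \<le> N" "l \<le> N" for i l
    proof -
      have "real i \<le> real N" "real l \<le> real N" using that by auto
      then have "\<bar>real_of_int (int i - int l)\<bar> < 3/4 * 2 ^ Suc J" using J unfolding of_int_diff of_int_of_nat_eq by linarith
      from lp_mult_sum[OF this] show ?thesis
        unfolding sum_distrib_right[symmetric] of_real_sum[symmetric] by simp
    qed
    then show ?thesis unfolding fejer_mean_def by (intro arg_cong2[where f="(/)"] sum.cong refl) auto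
  qed
  also have "\<dots> = (\<Sum>j\<in>{-1..int J}. fejer_mean N (\<lambda>k. complex_of_real (lp_mult j (real_of_int k)) * c k) x)"
    by (rule fejer_mean_sum) simp
  also have "\<dots> = (\<Sum>j\<in>{-1..int J}. fejer_mean N (ccoef (lp_block j c)) x)"
    by (intro sum.cong refl arg_cong[where f="\<lambda>c. fejer_mean N c x"] ext) (auto simp: ccoef_lp_block)
  also have "cmod \<dots> \<le> (\<Sum>j\<in>{-1..int J}. 2 powr (- real_of_int j * \<alpha>) * besov_norm \<alpha> c)"
  proof (rule sum_norm_le)
    fix j assume j: "j \<in> {-1..int J}"
    have "cmod (fejer_mean N (ccoef (lp_block j c)) x) \<le> (SUP x. cmod (lp_block j c x))"
      by (rule fejer_mean_norm_le[OF lp_block_continuous]) (rule cSUP_upper[OF _ lp_block_bdd], simp)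
    also have "\<dots> = 2 powr (- real_of_int j * \<alpha>) * besov_seq \<alpha> c j"
      by (simp add: besov_seq_def powr_minus field_simps)
    also have "\<dots> \<le> 2 powr (- real_of_int j * \<alpha>) * besov_norm \<alpha> c"
      using bs[of j] j by (intro mult_left_mono) auto
    finally show "cmod (fejer_mean N (ccoef (lp_block j c)) x) \<le> 2 powr (- real_of_int j * \<alpha>) * besov_norm \<alpha> c" .
  qed
  also have "\<dots> = (\<Sum>i\<le>Suc J. 2 powr \<alpha> * ?q ^ i) * besov_norm \<alpha> c"
  proof -
    have "(\<Sum>j\<in>{-1..int J}. 2 powr (- real_of_int j * \<alpha>)) = (\<Sum>i\<le>Suc J. 2 powr \<alpha> * ?q ^ i)"
      by (rule sum.reindex_bij_witness[of _ "\<lambda>i. int i - 1" "\<lambda>j. nat (j + 1)"])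
         (auto simp: powr_realpow[symmetric] powr_powr powr_add[symmetric] algebra_simps)
    then show ?thesis unfolding sum_distrib_right[symmetric] by (rule arg_cong)
  qed
  also have "\<dots> \<le> 2 powr \<alpha> / (1 - ?q) * besov_norm \<alpha> c"
  proof (rule mult_right_mono[OF _ bn])
    have "(\<Sum>i\<le>Suc J. ?q ^ i) \<le> (\<Sum>i. ?q ^ i)"
      by (rule sum_le_suminf) (use q in \<open>auto intro: summable_geometric\<close>)
    also have "\<dots> = 1 / (1 - ?q)" using q by (intro suminf_geometric) auto
    finally show "(\<Sum>i\<le>Suc J. 2 powr \<alpha> * ?q ^ i) \<le> 2 powr \<alpha> / (1 - ?q)"
      by (simp add: sum_distrib_left[symmetric] mult_left_mono[of _ "1 / (1 - ?q)" "2 powr \<alpha>", simplified])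
  qed
  finally show ?thesis .
qed

text \<open>Letting N grow transfers the bound for Fejer means to f itself, without discussing
  convergence of the Littlewood-Paley series of f.\<close>

lemma abs_le_besov:
  assumes f: "continuous_on UNIV f" "periodic1 f"
    and bdd: "bdd_above (besov_seq \<alpha> (fcoef f) ` {-1..})" and "0 < \<alpha>"
  shows "\<bar>f x\<bar> \<le> 2 powr \<alpha> / (1 - 2 powr - \<alpha>) * besov_norm \<alpha> (fcoef f)" (is "_ \<le> ?B")
proof (rule field_le_epsilon)
  fix e :: real assume "0 < e"
  obtain N where N: "\<And>x. cmod (fejer_mean N (fcoef f) x - of_real (f x)) \<le> e"
    using fejer_uniform[of 0 0 "\<lambda>_. f" e, OF continuous_on_const_family[OF f(1)] f(2) \<open>0 < e\<close>] by auto
  have "cmod (of_real (f x)) \<le> cmod (fejer_mean N (fcoef f) x) + cmod (fejer_mean N (fcoef f) x - of_real (f x))"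
    by (metis norm_triangle_sub norm_minus_commute)
  then show "\<bar>f x\<bar> \<le> ?B + e"
    using fejer_mean_le_besov[OF bdd \<open>0 < \<alpha>\<close>, of N x] N[of x] by simp
qed

lemma fcoef_diff:
  assumes "continuous_on UNIV f" "continuous_on UNIV g"
  shows "fcoef (\<lambda>x. f x - g x) k = fcoef f k - fcoef g k"
proof -
  have *: "set_integrable lborel {0..1} (\<lambda>x. complex_of_real (h x) * cis (- 2 * pi * real_of_int k * x))"
    if "continuous_on UNIV h" for h
    by (rule set_lint_continuous(1)) (intro continuous_intros continuous_on_subset[OF that] subset_UNIV)
  show ?thesis unfolding fcoef_def using set_integral_diff(2)[OF *[OF assms(1)] *[OF assms(2)]]
    by (simp add: left_diff_distrib)
qed

text \<open>\<open>besov_norm\<close> is a supremum of reals and means something only for bounded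
  sequences; the difference of a solution at two times has to be brought into this case.\<close>

lemma bdd_besov_diff:
  assumes "bdd_above (besov_seq \<alpha> c ` {-1..})" "bdd_above (besov_seq \<alpha> d ` {-1..})"
  shows "bdd_above (besov_seq \<alpha> (\<lambda>k. c k - d k) ` {-1..})"
proof -
  obtain A where A: "\<And>j. j \<ge> -1 \<Longrightarrow> besov_seq \<alpha> c j \<le> A" using assms(1) by (auto simp: bdd_above_def)
  obtain B where B: "\<And>j. j \<ge> -1 \<Longrightarrow> besov_seq \<alpha> d j \<le> B" using assms(2) by (auto simp: bdd_above_def)
  show ?thesis
  proof (rule bdd_aboveI2)
    fix j :: int assume j: "j \<in> {-1..}"
    have "(SUP x. cmod (lp_block j (\<lambda>k. c k - d k) x)) \<le> (SUP x. cmod (lp_block j c x)) + (SUP x. cmod (lp_block j d x))"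
    proof (rule cSUP_least)
      fix x
      have "lp_block j (\<lambda>k. c k - d k) x = lp_block j c x - lp_block j d x"
        by (simp add: lp_block_def sum_subtractf algebra_simps)
      then have "cmod (lp_block j (\<lambda>k. c k - d k) x) \<le> cmod (lp_block j c x) + cmod (lp_block j d x)"
        by (simp add: norm_triangle_ineq4)
      also have "\<dots> \<le> (SUP x. cmod (lp_block j c x)) + (SUP x. cmod (lp_block j d x))"
        by (intro add_mono cSUP_upper lp_block_bdd) auto
      finally show "cmod (lp_block j (\<lambda>k. c k - d k) x) \<le> (SUP x. cmod (lp_block j c x)) + (SUP x. cmod (lp_block j d x))" .
    qed simp
    then have "besov_seq \<alpha> (\<lambda>k. c k - d k) j \<le> besov_seq \<alpha> c j + besov_seq \<alpha> d j"
      unfolding besov_seq_def by (simp add: distrib_left[symmetric])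
    then show "besov_seq \<alpha> (\<lambda>k. c k - d k) j \<le> A + B" using A[of j] B[of j] j by auto
  qed
qed

text \<open>Applied to \<open>w s - w t\<close>, the sup-norm bound turns continuity in time for the
  Besov norm into continuity uniform in x; with continuity in x at fixed t this gives joint
  continuity.\<close>

lemma mild_solution_continuous:
  assumes w: "mild_solution \<alpha> \<eta> \<zeta> v w" and "0 < \<alpha>"
  shows "continuous_on ({0<..} \<times> UNIV) (\<lambda>(t, x). w t x)"
proof -
  define K where "K = (2 powr \<alpha> / (1 - 2 powr - \<alpha>) :: real)"
  have wc: "continuous_on UNIV (w t)" "periodic1 (w t)" "bdd_above (besov_seq \<alpha> (fcoef (w t)) ` {-1..})"
    if "t > 0" for t using w that by (auto simp: mild_solution_def holder_besov_def)
  have bound: "\<bar>w s x - w t x\<bar> \<le> K * besov_norm \<alpha> (\<lambda>k. fcoef (w s) k - fcoef (w t) k)"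
    if "s > 0" "t > 0" for s t x
  proof -
    have e: "fcoef (\<lambda>x. w s x - w t x) = (\<lambda>k. fcoef (w s) k - fcoef (w t) k)"
      using fcoef_diff wc(1) that by blast
    have "\<bar>(\<lambda>x. w s x - w t x) x\<bar> \<le> K * besov_norm \<alpha> (fcoef (\<lambda>x. w s x - w t x))"
      unfolding K_def by (rule abs_le_besov) (use wc that bdd_besov_diff \<open>0 < \<alpha>\<close> in \<open>auto simp: e periodic1_def intro!: continuous_intros\<close>)
    then show ?thesis by (simp add: e K_def)
  qed
  show ?thesis unfolding continuous_on_def
  proof (rule ballI)
    let ?A = "{0<..} \<times> (UNIV::real set)"
    fix q :: "real \<times> real" assume q: "q \<in> ?A"
    obtain t x where tx: "q = (t, x)" by (cases q)
    have t: "t \<in> {0<..}" using q tx by simp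
    have "((\<lambda>s. besov_norm \<alpha> (\<lambda>k. fcoef (w s) k - fcoef (w t) k)) \<longlongrightarrow> 0) (at t within {0<..})"
      using w t by (auto simp: mild_solution_def)
    then have "((\<lambda>s. K * besov_norm \<alpha> (\<lambda>k. fcoef (w s) k - fcoef (w t) k)) \<longlongrightarrow> K * 0) (at t within {0<..})"
      by (intro tendsto_mult tendsto_const)
    then have b0: "((\<lambda>s. K * besov_norm \<alpha> (\<lambda>k. fcoef (w s) k - fcoef (w t) k)) \<longlongrightarrow> 0) (at t within {0<..})" by simp
    have c: "(w t \<longlongrightarrow> w t x) (nhds x)" using wc(1)[of t] t by (simp add: continuous_on_eq_continuous_at continuous_at isCont_def tendsto_at_iff_tendsto_nhds)
    have "((\<lambda>(t, x). w t x) \<longlongrightarrow> w t x) (at (t, x) within ?A)"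
    proof (rule tendstoI)
      fix e :: real assume "0 < e"
      have "eventually (\<lambda>s. K * besov_norm \<alpha> (\<lambda>k. fcoef (w s) k - fcoef (w t) k) < e/2) (at t within {0<..})"
        using b0 by (rule order_tendstoD) (use \<open>0 < e\<close> in simp)
      then obtain d1 where d1: "d1 > 0" "\<And>s. s > 0 \<Longrightarrow> s \<noteq> t \<Longrightarrow> dist s t < d1 \<Longrightarrow> K * besov_norm \<alpha> (\<lambda>k. fcoef (w s) k - fcoef (w t) k) < e/2"
        unfolding eventually_at by auto
      have "eventually (\<lambda>y. dist (w t y) (w t x) < e/2) (nhds x)" using c by (rule tendstoD) (use \<open>0 < e\<close> in simp)
      then obtain d2 where d2: "d2 > 0" "\<And>y. dist y x < d2 \<Longrightarrow> dist (w t y) (w t x) < e/2"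
        unfolding eventually_nhds_metric by auto
      show "eventually (\<lambda>p. dist ((\<lambda>(t, x). w t x) p) (w t x) < e) (at (t, x) within ?A)"
        unfolding eventually_at
      proof (intro exI[of _ "min d1 d2"] conjI ballI impI)
        fix p assume p: "p \<in> ?A" "p \<noteq> (t, x) \<and> dist p (t, x) < min d1 d2"
        obtain s y where sy: "p = (s, y)" by (cases p)
        have "s > 0" using p sy by auto
        have ds: "dist s t < d1" "dist y x < d2"
          using p(2) sy dist_fst_le[of p "(t, x)"] dist_snd_le[of p "(t, x)"] by auto
        have "\<bar>w s y - w t y\<bar> < e/2"
          using bound[OF \<open>s > 0\<close>, of t y] d1(2)[OF \<open>s > 0\<close> _ ds(1)] t \<open>0 < e\<close> by (cases "s = t") auto
        then show "dist ((\<lambda>(t, x). w t x) p) (w t x) < e"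
          using d2(2)[OF ds(2)] unfolding sy dist_real_def by (simp, linarith)
      qed (use d1 d2 in auto)
    qed
    then show "((\<lambda>(t, x). w t x) \<longlongrightarrow> (case q of (t, x) \<Rightarrow> w t x)) (at q within ?A)"
      by (simp add: tx)
  qed
qed

section \<open>The drift and the Fourier coefficients of a mild solution\<close>

definition drho :: "(real \<Rightarrow> real) \<Rightarrow> real \<Rightarrow> real" where
  "drho u = deriv (rho u)"

section \<open>Mean-zero periodic antiderivatives and the drift d_x rho\<close>

lemma antiderivative_exists:
  fixes f :: "real \<Rightarrow> real"
  assumes "continuous_on UNIV f"
  shows "\<exists>F. \<forall>x. (F has_real_derivative f x) (at x)"
proof (intro exI allI)
  fix x :: real
  let ?a = "- \<bar>x\<bar> - 1" and ?b = "\<bar>x\<bar> + 1"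
  have "((\<lambda>u. LBINT y=ereal 0..u. f y) has_vector_derivative f x) (at x within {?a..?b})"
    by (rule interval_integral_FTC2) (auto intro: continuous_on_subset[OF assms])
  moreover have "at x within {?a..?b} = at x"
    by (rule at_within_interior) (simp add: abs_if)
  ultimately show "((\<lambda>u. LBINT y=ereal 0..u. f y) has_real_derivative f x) (at x)"
    by (simp add: has_real_derivative_iff_has_vector_derivative)
qed

lemma has_integral_derivative_unit:
  fixes F :: "real \<Rightarrow> real"
  assumes "\<And>x. (F has_real_derivative f x) (at x)"
  shows "(f has_integral (F 1 - F 0)) {0..1}"
  by (rule fundamental_theorem_of_calculus)
     (use assms in \<open>auto simp: has_real_derivative_iff_has_vector_derivative[symmetric] intro: has_field_derivative_at_within\<close>)

lemma periodic_integral_derivative: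
  fixes F :: "real \<Rightarrow> real"
  assumes "\<And>x. (F has_real_derivative f x) (at x)" "periodic1 F"
  shows "(f has_integral 0) {0..1}"
proof -
  have "F (0 + 1) = F 0" using assms(2) unfolding periodic1_def by blast
  then show ?thesis using has_integral_derivative_unit[of F f, OF assms(1)] by simp
qed

lemma has_real_derivative_zero_periodic:
  fixes F :: "real \<Rightarrow> real"
  assumes "\<And>x. (F has_real_derivative 0) (at x)"
  shows "F x = F y"
  using DERIV_isconst_all[of F x y] assms by blast

lemma continuous_on_of_derivative:
  fixes F :: "real \<Rightarrow> real"
  assumes "\<And>x. (F has_real_derivative f x) (at x)"
  shows "continuous_on A F"
  using assms by (meson DERIV_isCont continuous_at_imp_continuous_on)

lemma tmean_diff:
  assumes "continuous_on UNIV f" "continuous_on UNIV g"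
  shows "tmean (\<lambda>x. f x - g x) = tmean f - tmean g"
proof -
  have i: "h integrable_on {0..1}" if "continuous_on UNIV h" for h :: "real \<Rightarrow> real"
    by (rule integrable_continuous_real) (rule continuous_on_subset[OF that subset_UNIV])
  show ?thesis using assms integral_diff[OF i i, of f g]
    by (simp add: tmean_eq_integral continuous_on_diff)
qed

lemma tmean_const: "tmean (\<lambda>_. c) = c"
  by (simp add: tmean_eq_integral)

text \<open>The increment of an antiderivative over one period is constant, and it is the integral
  of f, hence 0. Subtracting the mean fixes the free constant.\<close>

lemma periodic_antiderivative:
  assumes f: "continuous_on UNIV f" "periodic1 f" "tmean f = 0"
  shows "\<exists>F. (\<forall>x. (F has_real_derivative f x) (at x)) \<and> periodic1 F \<and> tmean F = 0"
proof -
  obtain F where F: "\<And>x. (F has_real_derivative f x) (at x)"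
    using antiderivative_exists[OF f(1)] by auto
  have cF: "continuous_on UNIV F" by (rule continuous_on_of_derivative[OF F])
  have "((\<lambda>x. F (x + 1) - F x) has_real_derivative 0) (at x)" for x
  proof -
    have "((\<lambda>x. F (x + 1)) has_real_derivative f (x + 1)) (at x)"
      using F[of "x + 1"] by (simp add: DERIV_shift)
    then show ?thesis using F[of x] f(2) by (auto intro!: derivative_eq_intros simp: periodic1_def)
  qed
  then have "F (x + 1) - F x = F (0 + 1) - F 0" for x
    by (rule has_real_derivative_zero_periodic)
  moreover have "F (0 + 1) - F 0 = 0"
    using integral_unique[OF has_integral_derivative_unit[OF F]] f(3) tmean_eq_integral[OF f(1)] by simp
  ultimately have "F (x + 1) = F x" for x by (metis eq_iff_diff_eq_0)
  moreover have "tmean (\<lambda>x. F x - tmean F) = 0"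
    using tmean_diff[OF cF, of "\<lambda>_. tmean F"] by (simp add: tmean_const)
  moreover have "((\<lambda>x. F x - tmean F) has_real_derivative f x) (at x)" for x
    using F[of x] by (auto intro!: derivative_eq_intros)
  ultimately show ?thesis by (intro exI[of _ "\<lambda>x. F x - tmean F"]) (auto simp: periodic1_def)
qed

lemma periodic_antiderivative_unique:
  assumes "\<And>x. (F has_real_derivative f x) (at x)" "\<And>x. (G has_real_derivative f x) (at x)"
    and "tmean F = tmean G"
  shows "F = G"
proof
  fix x
  have "((\<lambda>x. F x - G x) has_real_derivative 0) (at x)" for x
    using DERIV_diff[OF assms(1)[of x] assms(2)[of x]] by simp
  then have e: "(\<lambda>x. F x - G x) = (\<lambda>_. F x - G x)"
    using has_real_derivative_zero_periodic by blast
  have "tmean (\<lambda>x. F x - G x) = 0"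
    using tmean_diff[OF continuous_on_of_derivative[OF assms(1)] continuous_on_of_derivative[OF assms(2)]] assms(3) by simp
  then show "F x = G x" by (subst (asm) e) (simp add: tmean_const)
qed

text \<open>As F has mean zero, F(x) is the average of F(x) - F(y), and each such difference is the
  integral of f over part of one period.\<close>

lemma periodic_antiderivative_bound:
  assumes F: "\<And>x. (F has_real_derivative f x) (at x)" "periodic1 F" "tmean F = 0"
    and f: "continuous_on UNIV f"
  shows "\<bar>F x\<bar> \<le> integral {0..1} (\<lambda>y. \<bar>f y\<bar>)"
proof -
  let ?I = "integral {0..1} (\<lambda>y. \<bar>f y\<bar>)"
  have cf: "continuous_on {a..b} f" "continuous_on {a..b} (\<lambda>y. \<bar>f y\<bar>)" for a b
    by (auto intro!: continuous_intros continuous_on_subset[OF f])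
  have mono: "\<bar>F b - F a\<bar> \<le> ?I" if "0 \<le> a" "a \<le> b" "b \<le> 1" for a b
  proof -
    have "(f has_integral (F b - F a)) {a..b}"
      by (rule fundamental_theorem_of_calculus)
         (use F that in \<open>auto simp: has_real_derivative_iff_has_vector_derivative[symmetric] intro: has_field_derivative_at_within\<close>)
    then have "\<bar>F b - F a\<bar> = norm (integral {a..b} f)" by (simp add: integral_unique)
    also have "\<dots> \<le> integral {a..b} (\<lambda>y. \<bar>f y\<bar>)"
      by (rule integral_norm_bound_integral) (auto intro!: integrable_continuous_real cf)
    also have "\<dots> \<le> ?I"
      by (rule integral_subset_le) (use that in \<open>auto intro!: integrable_continuous_real cf\<close>)
    finally show ?thesis .
  qed
  have osc: "\<bar>F b - F a\<bar> \<le> ?I" if "a \<in> {0..1}" "b \<in> {0..1}" for a b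
    using mono[of a b] mono[of b a] that by (cases "a \<le> b") auto
  define x' where "x' = x - of_int \<lfloor>x\<rfloor>"
  have x': "x' \<in> {0..1}" unfolding x'_def atLeastAtMost_iff by linarith
  have cF: "continuous_on A F" for A by (rule continuous_on_of_derivative[OF F(1)])
  have "F x' = integral {0..1} (\<lambda>y. F x' - F y)"
    using F(3) tmean_eq_integral[OF cF] by (subst integral_diff) (auto intro!: integrable_continuous_real cF)
  also have "norm \<dots> \<le> integral {0..1} (\<lambda>y::real. ?I)"
    by (rule integral_norm_bound_integral) (use osc x' in \<open>auto intro!: integrable_continuous_real continuous_intros cF\<close>)
  finally have "\<bar>F x'\<bar> \<le> ?I" by simp
  then show ?thesis using periodic1_of_int[OF F(2), of x' "\<lfloor>x\<rfloor>"] by (simp add: x'_def)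
qed

text \<open>Because \<open>rho\<close> is a definite description, both existence and uniqueness of
  the potential have to be shown. Uniqueness works on two levels: the derivative of a periodic
  function has mean zero, which pins down the first antiderivative, and the mean-zero condition pins
  down the second.\<close>

lemma drho_eqI:
  assumes u: "continuous_on UNIV u" "periodic1 u"
    and R: "\<And>x. (R has_real_derivative (tmean u - u x)) (at x)" "periodic1 R" "tmean R = 0"
  shows "drho u = R"
proof -
  have cR: "continuous_on UNIV R" by (rule continuous_on_of_derivative[OF R(1)])
  obtain r where r: "\<And>x. (r has_real_derivative R x) (at x)" "periodic1 r" "tmean r = 0"
    using periodic_antiderivative[OF cR R(2,3)] by auto
  have "rho u = r" unfolding rho_def
  proof (rule the_equality)
    show "periodic1 r \<and> tmean r = 0 \<and> (\<exists>r'. \<forall>x. (r has_real_derivative r' x) (at x) \<and>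
              (r' has_real_derivative (tmean u - u x)) (at x))"
      using r R(1) by blast
    fix s assume "periodic1 s \<and> tmean s = 0 \<and> (\<exists>r'. \<forall>x. (s has_real_derivative r' x) (at x) \<and>
              (r' has_real_derivative (tmean u - u x)) (at x))"
    then obtain s' where s: "periodic1 s" "tmean s = 0" "\<And>x. (s has_real_derivative s' x) (at x)"
      "\<And>x. (s' has_real_derivative (tmean u - u x)) (at x)" by auto
    have "tmean s' = 0"
      using integral_unique[OF periodic_integral_derivative[OF s(3,1)]]
        tmean_eq_integral[OF continuous_on_of_derivative[OF s(4)]] by simp
    then have "s' = R"
      using periodic_antiderivative_unique[OF s(4) R(1)] R(3) by simp
    then show "s = r"
      using periodic_antiderivative_unique[OF s(3), of r] r s(2) by simp
  qed
  then show ?thesis unfolding drho_def using r(1) by (auto intro!: ext DERIV_imp_deriv)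
qed

text \<open>The sup bound by an L^1 norm makes the drift a nonlocal quantity of first degree in u;
  the factor 2 pays for subtracting the mean.\<close>

lemma drho:
  assumes u: "continuous_on UNIV u" "periodic1 u"
  shows drho_derivative: "(drho u has_real_derivative (tmean u - u x)) (at x)"
    and drho_periodic: "periodic1 (drho u)" and drho_mean: "tmean (drho u) = 0"
    and drho_bound: "\<bar>drho u x\<bar> \<le> 2 * integral {0..1} (\<lambda>y. \<bar>u y\<bar>)"
    and drho_continuous: "continuous_on A (drho u)"
proof -
  let ?f = "\<lambda>x. tmean u - u x"
  have c: "continuous_on UNIV ?f" using u by (auto intro!: continuous_intros)
  have "tmean ?f = 0" using tmean_diff[of "\<lambda>_. tmean u" u] u(1) by (simp add: tmean_const)
  moreover have "periodic1 ?f" using u(2) by (simp add: periodic1_def)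
  ultimately obtain R where R: "\<And>x. (R has_real_derivative (tmean u - u x)) (at x)" "periodic1 R" "tmean R = 0"
    using periodic_antiderivative[OF c] by auto
  have e: "drho u = R" by (rule drho_eqI[OF u R])
  show "(drho u has_real_derivative (tmean u - u x)) (at x)" "periodic1 (drho u)" "tmean (drho u) = 0"
    using R by (simp_all add: e)
  show "continuous_on A (drho u)" unfolding e by (rule continuous_on_of_derivative[OF R(1)])
  have cu: "continuous_on {0..1} u" by (rule continuous_on_subset[OF u(1)]) simp
  have i: "(\<lambda>y. \<bar>u y\<bar>) integrable_on {0..1}" by (intro integrable_continuous_real continuous_intros cu)
  have m: "\<bar>tmean u\<bar> \<le> integral {0..1} (\<lambda>y. \<bar>u y\<bar>)"
    unfolding tmean_eq_integral[OF u(1)] real_norm_def[symmetric]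
    by (rule integral_norm_bound_integral) (use i in \<open>auto intro!: integrable_continuous_real cu\<close>)
  have "\<bar>drho u x\<bar> \<le> integral {0..1} (\<lambda>y. \<bar>tmean u - u y\<bar>)"
    unfolding e by (rule periodic_antiderivative_bound[OF R c])
  also have "\<dots> \<le> integral {0..1} (\<lambda>y. \<bar>tmean u\<bar> + \<bar>u y\<bar>)"
    by (rule integral_le) (auto intro!: integrable_continuous_real continuous_intros cu)
  also have "\<dots> = \<bar>tmean u\<bar> + integral {0..1} (\<lambda>y. \<bar>u y\<bar>)"
    by (subst integral_add) (use i in auto)
  finally show "\<bar>drho u x\<bar> \<le> 2 * integral {0..1} (\<lambda>y. \<bar>u y\<bar>)" using m by linarith
qed

lemma drho_diff:
  assumes u: "continuous_on UNIV u" "periodic1 u" and u': "continuous_on UNIV u'" "periodic1 u'"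
  shows "drho (\<lambda>x. u x - u' x) = (\<lambda>x. drho u x - drho u' x)"
proof (rule drho_eqI)
  show "((\<lambda>x. drho u x - drho u' x) has_real_derivative tmean (\<lambda>x. u x - u' x) - (u x - u' x)) (at x)" for x
    by (rule DERIV_cong[OF DERIV_diff[OF drho_derivative[OF u, of x] drho_derivative[OF u', of x]]])
       (simp add: tmean_diff[OF u(1) u'(1)])
  show "tmean (\<lambda>x. drho u x - drho u' x) = 0"
    using tmean_diff[OF drho_continuous[OF u] drho_continuous[OF u']] drho_mean[OF u] drho_mean[OF u'] by simp
qed (use u u' drho_periodic[OF u] drho_periodic[OF u'] in \<open>auto intro!: continuous_intros simp: periodic1_def\<close>)

lemma drho_diff_bound:
  assumes u: "continuous_on UNIV u" "periodic1 u" and u': "continuous_on UNIV u'" "periodic1 u'"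
    and "\<And>x. \<bar>u x - u' x\<bar> \<le> e"
  shows "\<bar>drho u x - drho u' x\<bar> \<le> 2 * e"
proof -
  have c: "continuous_on A (\<lambda>x. u x - u' x)" for A
    using u u' by (auto intro!: continuous_intros intro: continuous_on_subset)
  have "\<bar>drho (\<lambda>x. u x - u' x) x\<bar> \<le> 2 * integral {0..1} (\<lambda>y. \<bar>u y - u' y\<bar>)"
    by (rule drho_bound) (use c u u' in \<open>auto simp: periodic1_def\<close>)
  also have "integral {0..1} (\<lambda>y. \<bar>u y - u' y\<bar>) \<le> integral {0..1} (\<lambda>y::real. e)"
    by (rule integral_le) (use assms(5) in \<open>auto intro!: integrable_continuous_real continuous_intros c\<close>)
  finally show ?thesis by (simp add: drho_diff[OF u u'])
qed

text \<open>Changes in time are controlled uniformly in x by \<open>drho_diff_bound\<close>, changes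
  in x by differentiability at the fixed time.\<close>

lemma drho_family_continuous:
  fixes F :: "real \<Rightarrow> real \<Rightarrow> real"
  assumes cont: "continuous_on ({a..b} \<times> UNIV) (\<lambda>(s, x). F s x)"
    and per: "\<And>s. s \<in> {a..b} \<Longrightarrow> periodic1 (F s)"
  shows "continuous_on ({a..b} \<times> UNIV) (\<lambda>(s, x). drho (F s) x)"
  unfolding continuous_on_iff
proof (intro ballI allI impI)
  fix p :: "real \<times> real" and e :: real assume p: "p \<in> {a..b} \<times> UNIV" and "0 < e"
  obtain t x where tx: "p = (t, x)" by (cases p)
  have t: "t \<in> {a..b}" using p tx by simp
  have c: "continuous_on UNIV (F s)" if "s \<in> {a..b}" for s by (rule continuous_on_slice[OF cont that])
  obtain d where d: "d > 0" "\<forall>s\<in>{a..b}. \<forall>t\<in>{a..b}. \<forall>x y. \<bar>s - t\<bar> < d \<longrightarrow> \<bar>x - y\<bar> < d \<longrightarrow> \<bar>F s x - F t y\<bar> < e/4"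
    using periodic_family_uniform(2)[OF cont per, of "e/4"] \<open>0 < e\<close> by auto
  have "isCont (drho (F t)) x" using drho_derivative[OF c[OF t] per[OF t], of x] by (rule DERIV_isCont)
  then obtain d' where d': "d' > 0" "\<And>y. \<bar>y - x\<bar> < d' \<Longrightarrow> \<bar>drho (F t) y - drho (F t) x\<bar> < e/2"
    unfolding continuous_at_eps_delta dist_real_def using \<open>0 < e\<close> by (metis half_gt_zero)
  show "\<exists>d>0. \<forall>q\<in>{a..b} \<times> UNIV. dist q p < d \<longrightarrow> dist (case q of (s, x) \<Rightarrow> drho (F s) x) (case p of (s, x) \<Rightarrow> drho (F s) x) < e"
  proof (intro exI[of _ "min d d'"] conjI ballI impI)
    fix q :: "real \<times> real" assume q: "q \<in> {a..b} \<times> UNIV" "dist q p < min d d'"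
    obtain s y where sy: "q = (s, y)" by (cases q)
    have s: "s \<in> {a..b}" using q sy by simp
    have dd: "\<bar>s - t\<bar> < d" "\<bar>y - x\<bar> < d'"
      using q(2) sy tx dist_fst_le[of q p] dist_snd_le[of q p] by (auto simp: dist_real_def)
    have "\<bar>drho (F s) y - drho (F t) y\<bar> \<le> 2 * (e/4)"
      by (rule drho_diff_bound[OF c[OF s] per[OF s] c[OF t] per[OF t]])
         (use d dd(1) s t in \<open>auto intro!: less_imp_le\<close>)
    then show "dist (case q of (s, x) \<Rightarrow> drho (F s) x) (case p of (s, x) \<Rightarrow> drho (F s) x) < e"
      using d'(2)[OF dd(2)] unfolding sy tx dist_real_def by (simp, linarith)
  qed (use d d' in auto)
qed

lemma nonlin_drho: "nonlin u x = (u x)\<^sup>2 * drho u x"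
  by (simp add: nonlin_def drho_def)

lemma nonlin_family_continuous:
  fixes F :: "real \<Rightarrow> real \<Rightarrow> real"
  assumes cont: "continuous_on ({a..b} \<times> UNIV) (\<lambda>(s, x). F s x)"
    and per: "\<And>s. s \<in> {a..b} \<Longrightarrow> periodic1 (F s)"
  shows "continuous_on ({a..b} \<times> UNIV) (\<lambda>(s, x). nonlin (F s) x)"
  using cont drho_family_continuous[OF assms] unfolding nonlin_drho split_beta
  by (intro continuous_intros)

lemma nonlin_periodic:
  assumes "continuous_on UNIV u" "periodic1 u"
  shows "periodic1 (nonlin u)"
  using assms(2) drho_periodic[OF assms] unfolding periodic1_def nonlin_drho by simp

lemma fcoef_family_continuous:
  fixes F :: "real \<Rightarrow> real \<Rightarrow> real"
  assumes cont: "continuous_on ({a..b} \<times> UNIV) (\<lambda>(s, x). F s x)"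
  shows "continuous_on {a..b} (\<lambda>s. fcoef (F s) k)"
proof -
  have "continuous_on {a..b} (\<lambda>s. integral (cbox 0 1) (\<lambda>x. complex_of_real (F s x) * cis (- 2 * pi * real_of_int k * x)))"
  proof (rule integral_continuous_on_param)
    have "continuous_on ({a..b} \<times> cbox 0 1) (\<lambda>p. case p of (s, x) \<Rightarrow> F s x)"
      by (rule continuous_on_subset[OF cont]) auto
    then show "continuous_on ({a..b} \<times> cbox 0 1) (\<lambda>(s, x). complex_of_real (F s x) * cis (- 2 * pi * real_of_int k * x))"
      unfolding split_beta by (intro continuous_intros)
  qed
  moreover have "fcoef (F s) k = integral (cbox 0 1) (\<lambda>x. complex_of_real (F s x) * cis (- 2 * pi * real_of_int k * x))"
    if "s \<in> {a..b}" for s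
    using fcoef_eq_ccoef[OF continuous_on_slice[OF cont that]] by (simp add: ccoef_def cbox_interval)
  ultimately show ?thesis by (elim continuous_on_eq) simp
qed

section \<open>Evolution of the Fourier coefficients\<close>

definition fourier_deriv :: "(int \<Rightarrow> complex) \<Rightarrow> int \<Rightarrow> complex" where
  "fourier_deriv c k = (2 * pi * \<i> * of_int k) * c k"

lemma fejer_mean_has_vector_derivative:
  "(fejer_mean N c has_vector_derivative fejer_mean N (fourier_deriv c) x) (at x within S)"
proof -
  have "((\<lambda>x. c k * cis (2 * pi * real_of_int k * x)) has_vector_derivative
     fourier_deriv c k * cis (2 * pi * real_of_int k * x)) (at x within S)" for k
    using has_vector_derivative_mult_right[OF has_vector_derivative_cis[of "2 * pi * real_of_int k" x S], of "c k"]
    by (simp add: fourier_deriv_def algebra_simps)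
  then show ?thesis
    unfolding fejer_mean_def[abs_def]
    by (intro has_vector_derivative_divide has_vector_derivative_sum)
qed

lemma fejer_mean_time_derivative:
  assumes "\<And>k. ((\<lambda>t. c t k) has_vector_derivative d k) (at t within S)"
  shows "((\<lambda>t. fejer_mean N (c t) x) has_vector_derivative fejer_mean N d x) (at t within S)"
  unfolding fejer_mean_def
  by (intro has_vector_derivative_divide has_vector_derivative_sum has_vector_derivative_mult_left assms)

lemma fejer_mean_continuous:
  assumes "\<And>k. continuous_on A (\<lambda>t. c t k)"
  shows "continuous_on (A \<times> UNIV) (\<lambda>(t, x). fejer_mean N (c t) x)"
  unfolding fejer_mean_def split_beta
  by (intro continuous_intros continuous_on_compose2[OF assms]) (auto simp: of_nat_neq_0 simp del: of_nat_Suc)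

lemma fejer_mean_periodic: "fejer_mean N c (x + 1) = fejer_mean N c x"
proof -
  have "cis (2 * pi * real_of_int k * (x + 1)) = cis (2 * pi * real_of_int k * x)" for k
  proof -
    have "cis (2 * pi * real_of_int k * (x + 1)) = cis (2 * pi * real_of_int k * x) * cis (2 * pi * real_of_int k)"
      by (simp add: cis_mult algebra_simps)
    then show ?thesis using cis_multiple_2pi[of "real_of_int k"] by simp
  qed
  then show ?thesis by (simp only: fejer_mean_def)
qed

text \<open>Coefficientwise the mild formula solves a scalar linear equation: with the factor exp(4
  pi^2 k^2 s) kept inside the integral and exp(-4 pi^2 k^2 t) taken out, the Duhamel term is an
  ordinary antiderivative in t.\<close>

lemma fcoef_mild_derivative:
  assumes w: "mild_solution \<alpha> \<eta> \<zeta> v w" and "0 < \<alpha>"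
    and v: "continuous_on ({0..} \<times> UNIV) (\<lambda>(t, x). v t x)" "\<And>t. periodic1 (v t)"
    and t0: "0 < t0"
  shows "((\<lambda>t. fcoef (w t) k) has_vector_derivative
     fourier_deriv (fourier_deriv (fcoef (w t0))) k
     + fourier_deriv (fcoef (nonlin (\<lambda>x. w t0 x + v t0 x))) k) (at t0)"
proof -
  let ?l = "4 * pi\<^sup>2 * (real_of_int k)\<^sup>2"
  let ?c = "2 * pi * \<i> * of_int k :: complex"
  define u where "u = (\<lambda>s x. w s x + v s x)"
  define h where "h = (\<lambda>s. complex_of_real (exp (?l * s)) * ?c * fcoef (nonlin (u s)) k)"
  define a where "a = t0 / 2"
  define b where "b = t0 + 1"
  have ab: "0 < a" "a < t0" "t0 < b" using t0 by (auto simp: a_def b_def)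
  have cw: "continuous_on ({a..b} \<times> UNIV) (\<lambda>(t, x). w t x)"
    by (rule continuous_on_subset[OF mild_solution_continuous[OF w \<open>0 < \<alpha>\<close>]]) (use ab in auto)
  have cv: "continuous_on ({a..b} \<times> UNIV) (\<lambda>(t, x). v t x)"
    by (rule continuous_on_subset[OF v(1)]) (use ab in auto)
  have cu: "continuous_on ({a..b} \<times> UNIV) (\<lambda>(t, x). u t x)"
    using continuous_on_add[OF cw cv] by (simp add: u_def split_beta)
  have pu: "periodic1 (u t)" if "t \<in> {a..b}" for t
    using w v(2)[of t] that ab by (auto simp: mild_solution_def u_def periodic1_def)
  have ch: "continuous_on {a..b} h" unfolding h_def
    by (intro continuous_intros fcoef_family_continuous nonlin_family_continuous cu pu)
  have int: "set_integrable lborel {0..t} h" and eq: "fcoef (w t) k = complex_of_real (exp (- ?l * t)) * (\<zeta> k + (LINT s:{0..t}|lborel. h s))"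
    if "t > 0" for t
  proof -
    have g: "complex_of_real (exp (- 4 * pi\<^sup>2 * (real_of_int k)\<^sup>2 * (t - s))) * ?c * fcoef (nonlin (u s)) k
       = complex_of_real (exp (- ?l * t)) * h s" for s
      by (simp add: h_def algebra_simps exp_add[symmetric] flip: of_real_mult)
    have "set_integrable lborel {0..t} (\<lambda>s. complex_of_real (exp (- ?l * t)) * h s)"
      using w that unfolding mild_solution_def g[symmetric] u_def by blast
    then have "set_integrable lborel {0..t} (\<lambda>s. complex_of_real (exp (?l * t)) * (complex_of_real (exp (- ?l * t)) * h s))"
      by (rule set_integrable_mult_right) 
    then show "set_integrable lborel {0..t} h"
      by (simp add: mult.assoc[symmetric] exp_add[symmetric] flip: of_real_mult)
    have "fcoef (w t) k = complex_of_real (exp (- 4 * pi\<^sup>2 * (real_of_int k)\<^sup>2 * t)) * \<zeta> k +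
       (LINT s:{0..t}|lborel. complex_of_real (exp (- ?l * t)) * h s)"
      using w that unfolding mild_solution_def g[symmetric] u_def by blast
    then show "fcoef (w t) k = complex_of_real (exp (- ?l * t)) * (\<zeta> k + (LINT s:{0..t}|lborel. h s))"
      by (simp add: distrib_left)
  qed
  \<comment> \<open>On [0, a] the integrand is only known to be integrable, on [a, b] it is
    continuous. The first part is frozen into a constant so that the fundamental theorem applies to
    the second.\<close>
  define C where "C = \<zeta> k + integral {0..a} h"
  have eq': "fcoef (w t) k = complex_of_real (exp (- ?l * t)) * (C + integral {a..t} h)" if "t \<in> {a..b}" for t
  proof -
    have "t > 0" using that ab by simp
    have "integral {0..a} h + integral {a..t} h = integral {0..t} h"
      by (rule Henstock_Kurzweil_Integration.integral_combine)
         (use that ab set_borel_integral_eq_integral(1)[OF int[OF \<open>t > 0\<close>]] in auto)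
    then show ?thesis
      using eq[OF \<open>t > 0\<close>] set_borel_integral_eq_integral(2)[OF int[OF \<open>t > 0\<close>]] by (simp add: C_def algebra_simps)
  qed
  have dI: "((\<lambda>t. integral {a..t} h) has_vector_derivative h t0) (at t0 within {a..b})"
    by (rule integral_has_vector_derivative[OF ch]) (use ab in auto)
  have dE: "((\<lambda>t. complex_of_real (exp (- ?l * t))) has_vector_derivative complex_of_real (exp (- ?l * t0) * - ?l)) (at t0 within {a..b})"
    by (rule has_vector_derivative_of_real) (auto intro!: derivative_eq_intros simp flip: has_real_derivative_iff_has_vector_derivative)
  have "((\<lambda>t. complex_of_real (exp (- ?l * t)) * (C + integral {a..t} h)) has_vector_derivative
     (complex_of_real (exp (- ?l * t0)) * (0 + h t0) + complex_of_real (exp (- ?l * t0) * - ?l) * (C + integral {a..t0} h))) (at t0 within {a..b})"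
    by (intro has_vector_derivative_mult dE has_vector_derivative_add has_vector_derivative_const dI)
  then have "((\<lambda>t. fcoef (w t) k) has_vector_derivative
     (complex_of_real (exp (- ?l * t0)) * (0 + h t0) + complex_of_real (exp (- ?l * t0) * - ?l) * (C + integral {a..t0} h))) (at t0 within {a..b})"
    by (rule has_vector_derivative_transform[rotated 2]) (use ab eq' in auto)
  moreover have "complex_of_real (exp (- ?l * t0)) * (0 + h t0) + complex_of_real (exp (- ?l * t0) * - ?l) * (C + integral {a..t0} h)
     = fourier_deriv (fourier_deriv (fcoef (w t0))) k + fourier_deriv (fcoef (nonlin (u t0))) k"
  proof -
    have "complex_of_real (exp (- ?l * t0)) * h t0 = ?c * fcoef (nonlin (u t0)) k"
      by (simp add: h_def mult.assoc[symmetric] exp_add[symmetric] flip: of_real_mult)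
    moreover have "complex_of_real (exp (- ?l * t0) * - ?l) * (C + integral {a..t0} h) = (?c * ?c) * fcoef (w t0) k"
    proof -
      have "complex_of_real (exp (- ?l * t0) * - ?l) * (C + integral {a..t0} h) = - complex_of_real ?l * fcoef (w t0) k"
        using eq'[of t0] ab by simp
      also have "- complex_of_real ?l = ?c * ?c"
        by (simp add: complex_eq_iff power2_eq_square)
      finally show ?thesis .
    qed
    ultimately show ?thesis by (simp only: fourier_deriv_def mult.assoc add_0 add.commute)
  qed
  ultimately show ?thesis using ab
    by (simp add: u_def at_within_interior[of t0 "{a..b}"])
qed

section \<open>Energy estimate at a fixed time\<close>

text \<open>Energy estimates see v only through such a splitting: the remainder of size \<open>\<epsilon>\<close> is absorbed by
  the dissipation and the damping, and H enters polynomially.\<close>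

definition smooth_approx :: "real \<Rightarrow> real \<Rightarrow> (real \<Rightarrow> real) \<Rightarrow> bool" where
  "smooth_approx \<epsilon> H v \<longleftrightarrow> (\<exists>a a'. periodic1 a \<and> continuous_on UNIV a' \<and>
     (\<forall>x. (a has_real_derivative a' x) (at x) \<and>
        \<bar>v x\<bar> \<le> H \<and> \<bar>a x\<bar> \<le> H \<and> \<bar>a' x\<bar> \<le> H \<and> \<bar>v x - a x\<bar> \<le> \<epsilon>))"

lemma power_le_one_plus_power:
  fixes s :: real
  assumes "0 \<le> s" "k \<le> l"
  shows "s ^ k \<le> 1 + s ^ l"
proof (cases "s \<le> 1")
  case True
  then have "s ^ k \<le> 1" using assms by (intro power_le_one)
  then show ?thesis using zero_le_power[OF \<open>0 \<le> s\<close>, of l] by linarith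
next
  case False
  then have "s ^ k \<le> s ^ l" using assms by (intro power_increasing) auto
  then show ?thesis by linarith
qed

text \<open>Compare a with h / \<kappa>: above it, one factor a times \<kappa> already exceeds h;
  below it, a^k is bounded by (h / \<kappa>)^k.\<close>

lemma young_power:
  fixes a h \<kappa> :: real
  assumes "0 \<le> a" "0 \<le> h" "0 < \<kappa>"
  shows "h * a ^ k \<le> \<kappa> * a ^ Suc k + h * (h / \<kappa>) ^ k"
proof (cases "h / \<kappa> \<le> a")
  case True
  then have "h \<le> \<kappa> * a" using assms by (simp add: field_simps)
  then have "h * a ^ k \<le> (\<kappa> * a) * a ^ k" using assms by (intro mult_right_mono) auto
  moreover have "0 \<le> h * (h / \<kappa>) ^ k" using assms by simp
  ultimately show ?thesis by (simp add: mult.assoc)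
next
  case False
  then have "a ^ k \<le> (h / \<kappa>) ^ k" using assms by (intro power_mono) auto
  then have "h * a ^ k \<le> h * (h / \<kappa>) ^ k" using assms by (intro mult_left_mono) auto
  moreover have "0 \<le> \<kappa> * a ^ Suc k" using assms by simp
  ultimately show ?thesis by linarith
qed

lemma add_power_le:
  fixes a b :: real
  assumes "0 \<le> a" "0 \<le> b"
  shows "(a + b) ^ k \<le> 2 ^ k * (a ^ k + b ^ k)"
proof -
  have "(a + b) ^ k \<le> (2 * max a b) ^ k" using assms by (intro power_mono) auto
  also have "\<dots> \<le> 2 ^ k * (a ^ k + b ^ k)"
    using assms by (auto simp: power_mult_distrib max_def)
  finally show ?thesis .
qed

lemma abs_young: "\<bar>x * y\<bar> \<le> x\<^sup>2 / 3 + (3/4) * y\<^sup>2" for x y :: real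
proof -
  have "0 \<le> (\<bar>x\<bar> / 3 - \<bar>y\<bar> / 2)\<^sup>2" by simp
  also have "\<dots> = x\<^sup>2 / 9 + y\<^sup>2 / 4 - \<bar>x * y\<bar> / 3"
    by (simp add: power2_diff power_divide abs_mult)
  finally show ?thesis by simp
qed

text \<open>The parenthesized expression on the right is the x-derivative of z^(q+3) R / (q+3) + 2
  z^(q+2) a R / (q+2) when R' = ub - (z + v), so it disappears after integration over a period, and
  z^(q+4) / (q+3) remains as damping. The errors are of two kinds: degree q + 4 with the small
  factor \<epsilon>^2, and degree q + 3 with a power of H.\<close>

lemma energy_pointwise:
  fixes z zx f v a a' R ub r H \<mu> \<epsilon> :: real
  assumes q: "even q" and H: "1 \<le> H" and \<mu>: "1 \<le> \<mu>"
    and v: "\<bar>v\<bar> \<le> H" and a: "\<bar>a\<bar> \<le> H" and a': "\<bar>a'\<bar> \<le> H" and va: "\<bar>v - a\<bar> \<le> \<epsilon>"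
    and R: "\<bar>R\<bar> \<le> r" and ub: "\<bar>ub\<bar> \<le> \<mu> * H" and f: "\<bar>f - (z + v)\<^sup>2 * R\<bar> \<le> H"
  shows "z ^ q * zx * (zx + f) \<ge>
     (z ^ (q + 2) * zx * R + z ^ (q + 3) * (ub - (z + v)) / real (q + 3)
       + 2 * (z ^ (q + 1) * zx * a * R) + 2 / real (q + 2) * (z ^ (q + 2) * (a' * R + a * (ub - (z + v)))))
     + z ^ (q + 4) / real (q + 3)
     - 3 * \<epsilon>\<^sup>2 * (\<bar>z\<bar> + r) ^ (q + 4) - (4 * \<mu> + 3) * H ^ 4 * (1 + (\<bar>z\<bar> + r) ^ (q + 3))"
proof -
  define X where "X = z ^ q"
  define b where "b = \<bar>z\<bar>"
  \<comment> \<open>Dominates both |z| and |R|, so every error becomes a power of one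
    quantity.\<close>
  define s where "s = b + r"
  have r: "0 \<le> r" using R by linarith
  have e: "0 \<le> \<epsilon>" using va by linarith
  have b: "0 \<le> b" "b \<le> s" "r \<le> s" "0 \<le> s" using r by (auto simp: b_def s_def)
  have X: "X = b ^ q" "0 \<le> X" using q by (auto simp: X_def b_def power_even_abs)
  have Xs: "X \<le> s ^ q" unfolding X(1) by (rule power_mono) (use b in auto)
  have z2: "z\<^sup>2 = b\<^sup>2" by (simp add: b_def)
  have sq: "s ^ q * s\<^sup>2 = s ^ (q + 2)" "s ^ q * s ^ 3 = s ^ (q + 3)" "s ^ q * s ^ 4 = s ^ (q + 4)" by (simp_all only: power_add)
  have H4: "H \<le> H ^ 4" "H\<^sup>2 \<le> H ^ 4" using H power_increasing[of 1 4 H] power_increasing[of 2 4 H] by auto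
  have H0: "0 \<le> H" using H by simp
  \<comment> \<open>The dissipation X zx^2 is cut into three thirds, spent in \<open>E1\<close>,
    \<open>E2\<close> and \<open>E3\<close> on the consistency error of f, on the small remainder v
    - a, and on the term v^2 R. Squaring the last one is what produces H^4.\<close>
  have E1: "X * (zx * (f - (z + v)\<^sup>2 * R)) \<ge> - (X * (zx\<^sup>2 / 3)) - H ^ 4 * s ^ q"
  proof -
    define d where "d = f - (z + v)\<^sup>2 * R"
    have "d\<^sup>2 \<le> H\<^sup>2" using f by (simp add: abs_le_square_iff[symmetric] d_def)
    moreover have "0 \<le> d\<^sup>2" by simp
    ultimately have "zx * d \<ge> - (zx\<^sup>2 / 3) - H ^ 4"
      using abs_young[of zx d] H4 by linarith
    then have "X * (zx * d) \<ge> X * (- (zx\<^sup>2 / 3) - H ^ 4)" using X by (intro mult_left_mono)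
    also have "X * (- (zx\<^sup>2 / 3) - H ^ 4) = - (X * (zx\<^sup>2 / 3)) - X * (H ^ 4)" by (simp only: right_diff_distrib mult_minus_right)
    finally have "X * (zx * d) \<ge> - (X * (zx\<^sup>2 / 3)) - X * (H ^ 4)" .
    moreover have "X * H ^ 4 \<le> s ^ q * H ^ 4" using Xs by (intro mult_right_mono) auto
    ultimately show ?thesis unfolding d_def[symmetric] mult.commute[of "H ^ 4" "s ^ q"] by linarith
  qed
  have E2: "X * (zx * (2 * z * (v - a) * R)) \<ge> - (X * (zx\<^sup>2 / 3)) - 3 * \<epsilon>\<^sup>2 * s ^ (q + 4)"
  proof -
    define d where "d = 2 * z * (v - a) * R"
    define e2 where "e2 = b\<^sup>2 * (v - a)\<^sup>2 * R\<^sup>2"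
    have d2: "d\<^sup>2 = 4 * e2" by (simp add: d_def e2_def power_mult_distrib z2)
    have "e2 \<le> s\<^sup>2 * \<epsilon>\<^sup>2 * s\<^sup>2" unfolding e2_def
      using b va R r e by (intro mult_mono) (auto simp: abs_le_square_iff[symmetric] intro: power_mono)
    also have "s\<^sup>2 * \<epsilon>\<^sup>2 * s\<^sup>2 = \<epsilon>\<^sup>2 * s ^ 4" by (simp add: power2_eq_square power4_eq_xxxx)
    finally have "zx * d \<ge> - (zx\<^sup>2 / 3) - 3 * (\<epsilon>\<^sup>2 * s ^ 4)"
      using abs_young[of zx d] d2 by linarith
    then have "X * (zx * d) \<ge> X * (- (zx\<^sup>2 / 3) - 3 * (\<epsilon>\<^sup>2 * s ^ 4))" using X by (intro mult_left_mono)
    also have "X * (- (zx\<^sup>2 / 3) - 3 * (\<epsilon>\<^sup>2 * s ^ 4)) = - (X * (zx\<^sup>2 / 3)) - X * (3 * (\<epsilon>\<^sup>2 * s ^ 4))" by (simp only: right_diff_distrib mult_minus_right)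
    finally have "X * (zx * d) \<ge> - (X * (zx\<^sup>2 / 3)) - X * (3 * (\<epsilon>\<^sup>2 * s ^ 4))" .
    moreover have "X * (3 * (\<epsilon>\<^sup>2 * s ^ 4)) \<le> s ^ q * (3 * (\<epsilon>\<^sup>2 * s ^ 4))" using Xs b by (intro mult_right_mono) auto
    moreover have "s ^ q * (3 * (\<epsilon>\<^sup>2 * s ^ 4)) = 3 * \<epsilon>\<^sup>2 * s ^ (q + 4)" by (simp add: power_add)
    ultimately show ?thesis unfolding d_def[symmetric] by linarith
  qed
  have E3: "X * (zx * (v\<^sup>2 * R)) \<ge> - (X * (zx\<^sup>2 / 3)) - H ^ 4 * s ^ (q + 2)"
  proof -
    have "(v\<^sup>2 * R)\<^sup>2 = (v\<^sup>2)\<^sup>2 * R\<^sup>2" by (simp add: power_mult_distrib)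
    also have "\<dots> \<le> (H\<^sup>2)\<^sup>2 * s\<^sup>2"
    proof (rule mult_mono)
      have "v\<^sup>2 \<le> H\<^sup>2" using v H0 by (simp add: abs_le_square_iff[symmetric])
      then show "(v\<^sup>2)\<^sup>2 \<le> (H\<^sup>2)\<^sup>2" by (rule power_mono) simp
      show "R\<^sup>2 \<le> s\<^sup>2" using R b by (simp add: abs_le_square_iff[symmetric])
    qed auto
    finally have "(v\<^sup>2 * R)\<^sup>2 \<le> H ^ 4 * s\<^sup>2" by simp
    moreover define d where "d = v\<^sup>2 * R"
    moreover have "0 \<le> d\<^sup>2" by simp
    ultimately have "zx * d \<ge> - (zx\<^sup>2 / 3) - H ^ 4 * s\<^sup>2"
      using abs_young[of zx d] unfolding d_def[symmetric] by linarith
    then have "X * (zx * d) \<ge> X * (- (zx\<^sup>2 / 3) - H ^ 4 * s\<^sup>2)" using X by (intro mult_left_mono)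
    also have "X * (- (zx\<^sup>2 / 3) - H ^ 4 * s\<^sup>2) = - (X * (zx\<^sup>2 / 3)) - X * (H ^ 4 * s\<^sup>2)" by (simp only: right_diff_distrib mult_minus_right)
    finally have "X * (zx * d) \<ge> - (X * (zx\<^sup>2 / 3)) - X * (H ^ 4 * s\<^sup>2)" .
    moreover have "X * (H ^ 4 * s\<^sup>2) \<le> s ^ q * (H ^ 4 * s\<^sup>2)" using Xs by (intro mult_right_mono) auto
    moreover have "s ^ q * (H ^ 4 * s\<^sup>2) = H ^ 4 * s ^ (q + 2)" by (simp only: power_add mult.left_commute)
    ultimately show ?thesis unfolding d_def[symmetric] by linarith
  qed
  have zq: "\<bar>z ^ (q + 3)\<bar> = b ^ (q + 3)" "z ^ (q + 2) = b ^ (q + 2)" using q by (auto simp: b_def power_abs power_even_abs)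
  have bs: "b ^ k \<le> s ^ k" for k using b by (intro power_mono)
  have vu: "\<bar>v - ub\<bar> \<le> 2 * \<mu> * H"
  proof -
    have "H \<le> \<mu> * H" using \<mu> H0 mult_right_mono[of 1 \<mu> H] by simp
    then show ?thesis using v ub by linarith
  qed
  \<comment> \<open>The derivative of R supplies z + v - ub instead of z; the excess v - ub is
    bounded and costs only degree q + 3.\<close>
  have E4: "z ^ (q + 3) * ((v - ub) / real (q + 3)) \<ge> - (2 * \<mu> * H ^ 4 * s ^ (q + 3))"
  proof -
    have "\<bar>(v - ub) / real (q + 3)\<bar> \<le> \<bar>v - ub\<bar>" by (simp add: abs_divide divide_le_eq mult_le_cancel_left1)
    also note vu
    also have "2 * \<mu> * H \<le> 2 * \<mu> * H ^ 4" using H4 \<mu> by (intro mult_left_mono) auto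
    finally have "\<bar>z ^ (q + 3)\<bar> * \<bar>(v - ub) / real (q + 3)\<bar> \<le> s ^ (q + 3) * (2 * \<mu> * H ^ 4)"
      using bs b unfolding zq by (intro mult_mono) auto
    then have "\<bar>z ^ (q + 3) * ((v - ub) / real (q + 3))\<bar> \<le> 2 * \<mu> * H ^ 4 * s ^ (q + 3)"
      unfolding abs_mult by (simp only: mult.commute[of "s ^ (q + 3)"])
    then show ?thesis by linarith
  qed
  have E5: "2 / real (q + 2) * (z ^ (q + 2) * (a' * R + a * (ub - (z + v)))) \<le> H ^ 4 * s ^ (q + 3) + 2 * \<mu> * H ^ 4 * s ^ (q + 2)"
  proof -
    have "\<bar>a' * R + a * (ub - (z + v))\<bar> \<le> \<bar>a'\<bar> * \<bar>R\<bar> + \<bar>a\<bar> * \<bar>ub - (z + v)\<bar>"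
      using abs_triangle_ineq[of "a' * R" "a * (ub - (z + v))"] by (simp add: abs_mult)
    also have "\<dots> \<le> H * r + H * (2 * \<mu> * H + b)"
    proof -
      have "\<bar>ub - (z + v)\<bar> \<le> 2 * \<mu> * H + b" using vu unfolding b_def by linarith
      then show ?thesis using a a' R H0 by (intro add_mono mult_mono) auto
    qed
    also have "\<dots> = H * s + 2 * \<mu> * H\<^sup>2" by (simp add: s_def power2_eq_square algebra_simps)
    also have "\<dots> \<le> H ^ 4 * s + 2 * \<mu> * H ^ 4"
      using H4 \<mu> b by (intro add_mono mult_right_mono mult_left_mono) auto
    finally have 1: "\<bar>a' * R + a * (ub - (z + v))\<bar> \<le> H ^ 4 * s + 2 * \<mu> * H ^ 4" .
    have 2: "\<bar>2 / real (q + 2)\<bar> \<le> 1" by simp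
    have "2 / real (q + 2) * (z ^ (q + 2) * (a' * R + a * (ub - (z + v)))) \<le>
       \<bar>2 / real (q + 2)\<bar> * (\<bar>z ^ (q + 2)\<bar> * \<bar>a' * R + a * (ub - (z + v))\<bar>)"
      unfolding abs_mult[symmetric] by (rule abs_ge_self)
    also have "\<dots> \<le> 1 * (s ^ (q + 2) * (H ^ 4 * s + 2 * \<mu> * H ^ 4))"
    proof (intro mult_mono 1 2)
      show "\<bar>z ^ (q + 2)\<bar> \<le> s ^ (q + 2)"
        using bs[of "q + 2"] b(1) unfolding zq(2) by (simp only: abs_of_nonneg zero_le_power)
    qed (use b in auto)
    also have "\<dots> = H ^ 4 * s ^ (q + 3) + 2 * \<mu> * H ^ 4 * s ^ (q + 2)"
      by (simp add: power_add power2_eq_square power3_eq_cube algebra_simps)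
    finally show ?thesis .
  qed
  have low: "H ^ 4 * s ^ q \<le> H ^ 4 * (1 + s ^ (q + 3))" "H ^ 4 * s ^ (q + 2) \<le> H ^ 4 * (1 + s ^ (q + 3))"
      "2 * \<mu> * H ^ 4 * s ^ (q + 2) \<le> 2 * \<mu> * H ^ 4 * (1 + s ^ (q + 3))"
      "2 * \<mu> * H ^ 4 * s ^ (q + 3) \<le> 2 * \<mu> * H ^ 4 * (1 + s ^ (q + 3))" "H ^ 4 * s ^ (q + 3) \<le> H ^ 4 * (1 + s ^ (q + 3))"
    using \<mu> by (intro mult_left_mono power_le_one_plus_power b(4); simp)+
  \<comment> \<open>Three errors with H^4, from \<open>E1\<close>, \<open>E3\<close> and
    \<open>E5\<close>, and two with 2 \<mu> H^4, from \<open>E4\<close> and \<open>E5\<close>, make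
    up the constant 4 \<mu> + 3.\<close>
  have m: "(4 * \<mu> + 3) * H ^ 4 * (1 + s ^ (q + 3)) =
     H ^ 4 * (1 + s ^ (q + 3)) + H ^ 4 * (1 + s ^ (q + 3)) + H ^ 4 * (1 + s ^ (q + 3)) +
     2 * \<mu> * H ^ 4 * (1 + s ^ (q + 3)) + 2 * \<mu> * H ^ 4 * (1 + s ^ (q + 3))"
    by (simp add: algebra_simps)
  have zz: "z ^ (q + 4) / real (q + 3) = z ^ (q + 3) * (z / real (q + 3))"
    by (simp add: power_add numeral_eq_Suc)
  have split: "z ^ q * zx * (zx + f) =
     X * (zx\<^sup>2 / 3) + X * (zx\<^sup>2 / 3) + X * (zx\<^sup>2 / 3) + X * (zx * (f - (z + v)\<^sup>2 * R))
      + X * (zx * (2 * z * (v - a) * R)) + X * (zx * (v\<^sup>2 * R))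
      + z ^ (q + 2) * zx * R + 2 * (z ^ (q + 1) * zx * a * R)"
    by (simp add: X_def power_add power2_eq_square algebra_simps)
  have split2: "z ^ (q + 3) * (ub - (z + v)) / real (q + 3) =
      - (z ^ (q + 3) * ((v - ub) / real (q + 3))) - z ^ (q + 4) / real (q + 3)"
    unfolding zz by (simp add: diff_divide_distrib add_divide_distrib algebra_simps)
  show ?thesis
    unfolding split split2 s_def[symmetric] b_def[symmetric] m
    using E1 E2 E3 E4 E5 low by linarith
qed

text \<open>A cheap form of Jensen's inequality. With c the integral, g (c/2)^(k-1) <= g^k + (c/2)^k
  pointwise, by comparing g with c/2; after integration the left side is 2 (c/2)^k.\<close>

lemma integral_power_mean:
  fixes g :: "real \<Rightarrow> real"
  assumes g: "continuous_on {0..1} g" "\<And>x. x \<in> {0..1} \<Longrightarrow> 0 \<le> g x"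
  shows "(integral {0..1} g) ^ k \<le> 2 ^ k * integral {0..1} (\<lambda>x. g x ^ k)"
proof (cases k)
  case (Suc l)
  define c where "c = integral {0..1} g"
  have c: "0 \<le> c" unfolding c_def using g by (intro integral_nonneg integrable_continuous_real) auto
  have "g x * (c / 2) ^ l \<le> g x ^ k + (c / 2) ^ k" if "x \<in> {0..1}" for x
  proof (cases "c / 2 \<le> g x")
    case True
    then have "g x * (c / 2) ^ l \<le> g x * g x ^ l" using c g(2)[OF that] by (intro mult_left_mono power_mono) auto
    then show ?thesis using c Suc by (simp add: add_increasing2)
  next
    case False
    then have "g x * (c / 2) ^ l \<le> (c/2) * (c / 2) ^ l" using c by (intro mult_right_mono) auto
    then show ?thesis using g(2)[OF that] Suc by (simp add: add_increasing)
  qed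
  then have "integral {0..1} (\<lambda>x. g x * (c / 2) ^ l) \<le> integral {0..1} (\<lambda>x. g x ^ k + (c / 2) ^ k)"
    by (intro integral_le integrable_continuous_real continuous_intros g) auto
  then have "c * (c / 2) ^ l \<le> integral {0..1} (\<lambda>x. g x ^ k) + (c / 2) ^ k"
    by (subst (asm) integral_add) (auto simp: c_def[symmetric] intro!: integrable_continuous_real continuous_intros g)
  then have "(c / 2) ^ k \<le> integral {0..1} (\<lambda>x. g x ^ k)" using Suc by simp
  then show ?thesis by (simp add: c_def[symmetric] power_divide field_simps)
qed simp

text \<open>All constants are fixed before the functions and before H, so the roughness of
  \<open>v\<close> enters only through H. The hypotheses on R and f leave room for the consistency
  errors of a Fejer mean.\<close>

lemma energy_static:
  fixes q :: nat and \<mu> :: real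
  assumes q: "even q" and \<mu>: "1 \<le> \<mu>"
  obtains \<epsilon> C K where "0 < \<epsilon>" "0 < C"
    "\<And>z zx f v R ub H. \<lbrakk>\<And>x. (z has_real_derivative zx x) (at x); periodic1 z; continuous_on {0..1} zx;
       continuous_on {0..1} f; continuous_on {0..1} v; 1 \<le> H; smooth_approx \<epsilon> H v;
       \<And>x. (R has_real_derivative (ub - (z x + v x))) (at x); periodic1 R;
       \<And>x. \<bar>R x\<bar> \<le> 2 * (integral {0..1} (\<lambda>x. \<bar>z x\<bar>) + H); \<bar>ub\<bar> \<le> \<mu> * H;
       \<And>x. x \<in> {0..1} \<Longrightarrow> \<bar>f x - (z x + v x)\<^sup>2 * R x\<bar> \<le> H\<rbrakk>
     \<Longrightarrow> integral {0..1} (\<lambda>x. z x ^ (q + 4)) / (2 * real (q + 3)) - C * H ^ K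
        \<le> integral {0..1} (\<lambda>x. z x ^ q * zx x * (zx x + f x))"
proof -
  \<comment> \<open>The terms of degree q + 4 cost at most \<theta> c0 (A + H^K) in total: 2^(q+4)
    comes from expanding (|z| + r)^(q+4), and 8^(q+4) from bounding r. The value of \<theta> makes
    this half of the damping, and it is shared equally between 3 \<epsilon>^2 and the Young
    parameter \<kappa>.\<close>
  define c0 where "c0 = (2::real) ^ (q + 4) * (1 + 8 ^ (q + 4))"
  define \<theta> where "\<theta> = 1 / (2 * real (q + 3) * c0)"
  define \<epsilon> where "\<epsilon> = sqrt (\<theta> / 6)"
  define \<kappa> where "\<kappa> = \<theta> / 2"
  define m where "m = 4 * \<mu> + 3"
  \<comment> \<open>Young's inequality with the factor m H^4 against the power q + 3 produces H^4
    (H^4)^(q+3).\<close>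
  define K where "K = 4 * (q + 4)"
  define C1 where "C1 = m * (1 + (m / \<kappa>) ^ (q + 3))"
  have c0: "0 < c0" by (simp add: c0_def add_pos_pos)
  then have \<theta>: "0 < \<theta>" by (simp add: \<theta>_def)
  then have pos: "0 < \<epsilon>" "0 < \<kappa>" "0 < m" using \<mu> by (auto simp: \<epsilon>_def \<kappa>_def m_def)
  have \<epsilon>2: "3 * \<epsilon>\<^sup>2 + \<kappa> = \<theta>" using \<theta> by (simp add: \<epsilon>_def \<kappa>_def)
  have C1: "0 < C1" using pos by (simp add: C1_def add_pos_pos)
  show thesis
  proof (rule that[of \<epsilon> "C1 + 1" K])
    show "0 < \<epsilon>" "0 < C1 + 1" using pos C1 by auto
    fix z zx f v R :: "real \<Rightarrow> real" and ub H :: real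
    assume z: "\<And>x. (z has_real_derivative zx x) (at x)" "periodic1 z" "continuous_on {0..1} zx"
      and f: "continuous_on {0..1} f" and v: "continuous_on {0..1} v" and H: "1 \<le> H" and sm: "smooth_approx \<epsilon> H v"
      and R: "\<And>x. (R has_real_derivative (ub - (z x + v x))) (at x)" "periodic1 R"
      and Rb: "\<And>x. \<bar>R x\<bar> \<le> 2 * (integral {0..1} (\<lambda>x. \<bar>z x\<bar>) + H)" and ub: "\<bar>ub\<bar> \<le> \<mu> * H"
      and err: "\<And>x. x \<in> {0..1} \<Longrightarrow> \<bar>f x - (z x + v x)\<^sup>2 * R x\<bar> \<le> H"
    obtain a a' where a: "periodic1 a" "continuous_on UNIV a'" "\<And>x. (a has_real_derivative a' x) (at x)"
      "\<And>x. \<bar>v x\<bar> \<le> H" "\<And>x. \<bar>a x\<bar> \<le> H" "\<And>x. \<bar>a' x\<bar> \<le> H" "\<And>x. \<bar>v x - a x\<bar> \<le> \<epsilon>"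
      using sm unfolding smooth_approx_def by blast
    define r where "r = 2 * (integral {0..1} (\<lambda>x. \<bar>z x\<bar>) + H)"
    define A where "A = integral {0..1} (\<lambda>x. z x ^ (q + 4))"
    have cz: "continuous_on S z" and cR: "continuous_on S R" and ca: "continuous_on S a" for S
      by (rule continuous_on_of_derivative[OF z(1)] continuous_on_of_derivative[OF R(1)] continuous_on_of_derivative[OF a(3)])+
    have ca': "continuous_on {0..1} a'" by (rule continuous_on_subset[OF a(2)]) simp
    note [continuous_intros] = cz cR ca ca' z(3) f v
    have ipos: "0 \<le> integral {0..1} (\<lambda>x. \<bar>z x\<bar>)"
      by (intro integral_nonneg integrable_continuous_real continuous_intros) auto
    have r0: "0 \<le> r" using ipos H by (simp add: r_def)
    have ev: "even (q + 4)" using q by simp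
    have A0: "0 \<le> A" unfolding A_def
      by (intro integral_nonneg integrable_continuous_real continuous_intros) (use ev in \<open>simp add: zero_le_even_power\<close>)
    define \<Phi>' where "\<Phi>' = (\<lambda>x. z x ^ (q + 2) * zx x * R x + z x ^ (q + 3) * (ub - (z x + v x)) / real (q + 3)
       + 2 * (z x ^ (q + 1) * zx x * a x * R x)
       + 2 / real (q + 2) * (z x ^ (q + 2) * (a' x * R x + a x * (ub - (z x + v x)))))"
    \<comment> \<open>The first summand of the antiderivative creates the damping through R' = ub -
      (z + v); the second moves the derivative from z onto a R in the critical term, which is why
      the approximation a has to be differentiable.\<close>
    have \<Phi>: "(\<Phi>' has_integral 0) {0..1}"
    proof (rule periodic_integral_derivative)
      show "((\<lambda>x. z x ^ (q + 3) * R x / real (q + 3) + 2 / real (q + 2) * (z x ^ (q + 2) * (a x * R x))) has_real_derivative \<Phi>' x) (at x)" for x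
      proof -
        have "((\<lambda>x. z x ^ (q + 3) * R x / real (q + 3) + 2 / real (q + 2) * (z x ^ (q + 2) * (a x * R x))) has_real_derivative
          ((real (q + 3) * (zx x * z x ^ (q + 3 - Suc 0))) * R x + (ub - (z x + v x)) * z x ^ (q + 3)) / real (q + 3)
           + 2 / real (q + 2) * ((real (q + 2) * (zx x * z x ^ (q + 2 - Suc 0))) * (a x * R x)
             + (a' x * R x + (ub - (z x + v x)) * a x) * z x ^ (q + 2))) (at x)"
          by (intro DERIV_add DERIV_cdivide DERIV_cmult DERIV_mult DERIV_power z(1) R(1) a(3))
        moreover have "((real (q + 3) * (zx x * z x ^ (q + 3 - Suc 0))) * R x + (ub - (z x + v x)) * z x ^ (q + 3)) / real (q + 3)
           + 2 / real (q + 2) * ((real (q + 2) * (zx x * z x ^ (q + 2 - Suc 0))) * (a x * R x)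
             + (a' x * R x + (ub - (z x + v x)) * a x) * z x ^ (q + 2)) = \<Phi>' x"
        proof -
          have n: "real (q + 3) \<noteq> 0" "real (q + 2) \<noteq> 0" by auto
          have 1: "q + 3 - Suc 0 = q + 2" "q + 2 - Suc 0 = q + 1" by auto
          have 2: "2 / real (q + 2) * (real (q + 2) * Y + W) = 2 * Y + 2 / real (q + 2) * W" for Y W
            using n(2) by (simp add: field_simps del: of_nat_add)
          have 3: "(real (q + 3) * Y + W) / real (q + 3) = Y + W / real (q + 3)" for Y W
            using n(1) by (simp add: add_divide_distrib del: of_nat_add)
          show ?thesis unfolding \<Phi>'_def 1 mult.assoc 2 3 by (simp only: ac_simps)
        qed
        ultimately show ?thesis by simp
      qed
      show "periodic1 (\<lambda>x. z x ^ (q + 3) * R x / real (q + 3) + 2 / real (q + 2) * (z x ^ (q + 2) * (a x * R x)))"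
        using z(2) R(2) a(1) by (simp add: periodic1_def)
    qed
    have c\<Phi>: "continuous_on {0..1} \<Phi>'" unfolding \<Phi>'_def
      by (intro continuous_intros) simp_all
    have pt: "z x ^ q * zx x * (zx x + f x) \<ge>
        \<Phi>' x + (z x ^ (q + 4) / real (q + 3) - \<theta> * (2 ^ (q + 4) * (z x ^ (q + 4) + r ^ (q + 4))) - C1 * H ^ K)"
      if x: "x \<in> {0..1}" for x
    proof -
      let ?s = "\<bar>z x\<bar> + r"
      have s0: "0 \<le> ?s" using r0 by simp
      have "z x ^ q * zx x * (zx x + f x) \<ge> \<Phi>' x + z x ^ (q + 4) / real (q + 3)
         - 3 * \<epsilon>\<^sup>2 * ?s ^ (q + 4) - m * H ^ 4 * (1 + ?s ^ (q + 3))"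
        unfolding \<Phi>'_def m_def
        by (rule energy_pointwise) (use q H \<mu> a Rb err[OF x] ub in \<open>auto simp: r_def\<close>)
      moreover have "m * H ^ 4 * (1 + ?s ^ (q + 3)) \<le> \<kappa> * ?s ^ (q + 4) + C1 * H ^ K"
      proof -
        have q4: "Suc (q + 3) = q + 4" by simp
        have "(m * H ^ 4) * ?s ^ (q + 3) \<le> \<kappa> * ?s ^ (q + 4) + (m * H ^ 4) * ((m * H ^ 4) / \<kappa>) ^ (q + 3)"
          by (rule young_power[of _ _ _ "q + 3", unfolded q4]) (use s0 pos H in auto)
        moreover have "(m * H ^ 4) * ((m * H ^ 4) / \<kappa>) ^ (q + 3) = m * (m / \<kappa>) ^ (q + 3) * H ^ K"
        proof -
          have "K = 4 + 4 * (q + 3)" by (simp add: K_def)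
          then have "H ^ K = H ^ 4 * (H ^ 4) ^ (q + 3)" by (simp only: power_add power_mult)
          then show ?thesis by (simp add: power_mult_distrib power_divide)
        qed
        moreover have "m * H ^ 4 \<le> m * H ^ K"
          using pos H by (intro mult_left_mono power_increasing) (auto simp: K_def)
        moreover have "m * H ^ 4 * (1 + ?s ^ (q + 3)) = m * H ^ 4 + m * H ^ 4 * ?s ^ (q + 3)"
          by (simp only: distrib_left mult_1_right)
        moreover have "C1 * H ^ K = m * H ^ K + m * (m / \<kappa>) ^ (q + 3) * H ^ K"
          unfolding C1_def by (simp only: distrib_left distrib_right mult_1_right)
        ultimately show ?thesis by linarith
      qed
      moreover have "\<theta> * ?s ^ (q + 4) \<le> \<theta> * (2 ^ (q + 4) * (z x ^ (q + 4) + r ^ (q + 4)))"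
        using add_power_le[of "\<bar>z x\<bar>" r "q + 4"] r0 \<theta> ev by (intro mult_left_mono) (auto simp: power_even_abs)
      moreover have "\<theta> * ?s ^ (q + 4) = 3 * \<epsilon>\<^sup>2 * ?s ^ (q + 4) + \<kappa> * ?s ^ (q + 4)"
        by (simp add: \<epsilon>2[symmetric] algebra_simps)
      ultimately show ?thesis by linarith
    qed
    have HK: "H ^ (q + 4) \<le> H ^ K" using H by (intro power_increasing) (auto simp: K_def)
    \<comment> \<open>The base 8 = 2 * 2 * 2 collects the factor in r, the expansion of the sum, and
      \<open>integral_power_mean\<close>.\<close>
    have rb: "r ^ (q + 4) \<le> 8 ^ (q + 4) * (A + H ^ K)"
    proof -
      let ?c = "integral {0..1} (\<lambda>x. \<bar>z x\<bar>)"
      have "?c ^ (q + 4) \<le> 2 ^ (q + 4) * integral {0..1} (\<lambda>x. \<bar>z x\<bar> ^ (q + 4))"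
        by (rule integral_power_mean) (auto intro!: continuous_intros)
      also have "integral {0..1} (\<lambda>x. \<bar>z x\<bar> ^ (q + 4)) = A"
        unfolding A_def using ev by (simp add: power_even_abs)
      finally have c: "?c ^ (q + 4) \<le> 2 ^ (q + 4) * A" .
      have "r ^ (q + 4) = 2 ^ (q + 4) * (?c + H) ^ (q + 4)" by (simp only: r_def power_mult_distrib)
      also have "\<dots> \<le> 2 ^ (q + 4) * (2 ^ (q + 4) * (?c ^ (q + 4) + H ^ (q + 4)))"
        using add_power_le[OF ipos, of H] H by (intro mult_left_mono) auto
      also have "\<dots> \<le> 2 ^ (q + 4) * (2 ^ (q + 4) * (2 ^ (q + 4) * A + 2 ^ (q + 4) * H ^ K))"
      proof -
        have "1 * H ^ (q + 4) \<le> 2 ^ (q + 4) * H ^ K" using HK H by (intro mult_mono) auto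
        then show ?thesis using c by (intro mult_left_mono add_mono) auto
      qed
      also have "\<dots> = (2 * 2 * 2) ^ (q + 4) * (A + H ^ K)" unfolding power_mult_distrib by (simp only: ring_distribs mult.assoc)
      finally show ?thesis by simp
    qed
    have "integral {0..1} (\<lambda>x. z x ^ q * zx x * (zx x + f x)) \<ge> integral {0..1} (\<lambda>x.
        \<Phi>' x + (z x ^ (q + 4) / real (q + 3) - \<theta> * (2 ^ (q + 4) * (z x ^ (q + 4) + r ^ (q + 4))) - C1 * H ^ K))"
      by (rule integral_le[OF _ _ pt]) (rule integrable_continuous_real, intro continuous_intros c\<Phi>, simp)+
    also have "integral {0..1} (\<lambda>x. \<Phi>' x + (z x ^ (q + 4) / real (q + 3) - \<theta> * (2 ^ (q + 4) * (z x ^ (q + 4) + r ^ (q + 4))) - C1 * H ^ K))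
       = 0 + (A / real (q + 3) - \<theta> * (2 ^ (q + 4) * (A + r ^ (q + 4))) - C1 * H ^ K)"
    proof (rule integral_unique, intro has_integral_add \<Phi> has_integral_diff has_integral_divide has_integral_mult_right)
      show "((\<lambda>x. z x ^ (q + 4)) has_integral A) {0..1}"
        unfolding A_def by (intro integrable_integral integrable_continuous_real continuous_intros)
      then show "((\<lambda>x. z x ^ (q + 4)) has_integral A) {0..1}" .
    qed (use has_integral_const_real[of _ 0 1] in auto)
    finally have main: "A / real (q + 3) - \<theta> * (2 ^ (q + 4) * (A + r ^ (q + 4))) - C1 * H ^ K \<le> integral {0..1} (\<lambda>x. z x ^ q * zx x * (zx x + f x))"
      by simp
    have "\<theta> * (2 ^ (q + 4) * (A + r ^ (q + 4))) \<le> \<theta> * (2 ^ (q + 4) * ((A + H ^ K) + 8 ^ (q + 4) * (A + H ^ K)))"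
      using rb \<theta> H by (intro mult_left_mono add_mono) auto
    also have "\<dots> = \<theta> * c0 * (A + H ^ K)" by (simp only: c0_def ring_distribs mult.assoc mult_1_left mult_1_right)
    also have "\<theta> * c0 = 1 / (2 * real (q + 3))" using c0 by (simp add: \<theta>_def)
    also have "1 / (2 * real (q + 3)) * (A + H ^ K) \<le> A / (2 * real (q + 3)) + H ^ K"
    proof -
      have "1 / (2 * real (q + 3)) * H ^ K \<le> 1 * H ^ K" using H by (intro mult_right_mono) auto
      then show ?thesis by (simp add: distrib_left)
    qed
    finally have "\<theta> * (2 ^ (q + 4) * (A + r ^ (q + 4))) \<le> A / (2 * real (q + 3)) + H ^ K" .
    \<comment> \<open>Linear arithmetic with the halving made explicit: the \<theta>-terms consume
      one half of the damping and leave the other.\<close>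
    moreover have "x' - (c + h) \<le> y" if "x - th - c \<le> y" "th \<le> x' + h" "x' = x / 2" for x th c y x' h :: real
      using that by linarith
    moreover have "A / (2 * real (q + 3)) = A / real (q + 3) / 2" by (simp only: divide_divide_eq_left mult.commute)
    ultimately show "integral {0..1} (\<lambda>x. z x ^ (q + 4)) / (2 * real (q + 3)) - (C1 + 1) * H ^ K
        \<le> integral {0..1} (\<lambda>x. z x ^ q * zx x * (zx x + f x))"
      using main unfolding A_def[symmetric] distrib_right mult_1_left by blast
  qed
qed

section \<open>Pathwise a priori bound\<close>

text \<open>In the nonnegative integral the negative part is cut off, and the integrand may be
  replaced by any larger function, possibly infinite and of unknown measurability.\<close>

lemma ennreal_set_lint_le_nn_integral:
  fixes f :: "real \<Rightarrow> real"
  assumes "continuous_on {a..b} f"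
  shows "ennreal (integral {a..b} f) \<le> (\<integral>\<^sup>+ s. ennreal (f s) * indicator {a..b} s \<partial>lborel)"
proof -
  have c: "continuous_on {a..b} (\<lambda>s. max 0 (f s))" using assms by (intro continuous_intros)
  have "integral {a..b} f \<le> integral {a..b} (\<lambda>s. max 0 (f s))"
    by (intro integral_le integrable_continuous_real assms c) auto
  also have "\<dots> = (LINT s|lborel. indicator {a..b} s * max 0 (f s))"
    using set_lint_continuous(2)[OF c] by (simp add: set_lebesgue_integral_def)
  finally have "ennreal (integral {a..b} f) \<le> ennreal (LINT s|lborel. indicator {a..b} s * max 0 (f s))"
    by (rule ennreal_leI)
  also have "\<dots> = (\<integral>\<^sup>+ s. ennreal (indicator {a..b} s * max 0 (f s)) \<partial>lborel)"
    using set_lint_continuous(1)[OF c]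
    by (subst nn_integral_eq_integral) (auto simp: set_integrable_def)
  also have "\<dots> = (\<integral>\<^sup>+ s. ennreal (f s) * indicator {a..b} s \<partial>lborel)"
    by (intro nn_integral_cong) (auto simp: indicator_def max_def ennreal_neg)
  finally show ?thesis .
qed

text \<open>For real functions the Fejer mean is already real; taking the real part replaces the
  proof of that fact.\<close>

definition re_fejer :: "nat \<Rightarrow> (int \<Rightarrow> complex) \<Rightarrow> real \<Rightarrow> real" where
  "re_fejer N c x = Re (fejer_mean N c x)"

lemma re_fejer_derivative:
  "(re_fejer N c has_real_derivative re_fejer N (fourier_deriv c) x) (at x within S)"
  using bounded_linear.has_vector_derivative[OF bounded_linear_Re fejer_mean_has_vector_derivative[of N c x S]]
  by (simp add: re_fejer_def[abs_def] has_real_derivative_iff_has_vector_derivative)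

lemma re_fejer_time_derivative:
  assumes "\<And>k. ((\<lambda>t. c t k) has_vector_derivative d k) (at t within S)"
  shows "((\<lambda>t. re_fejer N (c t) x) has_real_derivative re_fejer N d x) (at t within S)"
  using bounded_linear.has_vector_derivative[OF bounded_linear_Re fejer_mean_time_derivative[of c d t S N x, OF assms]]
  by (simp add: re_fejer_def[abs_def] has_real_derivative_iff_has_vector_derivative)

lemma re_fejer_add: "re_fejer N (\<lambda>k. c k + d k) x = re_fejer N c x + re_fejer N d x"
  by (simp add: re_fejer_def fejer_mean_add)

lemma re_fejer_periodic: "periodic1 (re_fejer N c)"
  by (simp add: periodic1_def re_fejer_def fejer_mean_periodic)

lemma re_fejer_continuous: "continuous_on A (re_fejer N c)"
  by (rule continuous_on_of_derivative[OF re_fejer_derivative])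

lemma re_fejer_family_continuous:
  assumes "\<And>k. continuous_on A (\<lambda>t. c t k)"
  shows "continuous_on (A \<times> UNIV) (\<lambda>(t, x). re_fejer N (c t) x)"
  using fejer_mean_continuous[of A c N, OF assms] unfolding re_fejer_def split_beta
  by (intro continuous_intros)

lemma re_fejer_uniform:
  fixes F :: "real \<Rightarrow> real \<Rightarrow> real"
  assumes "continuous_on ({a..b} \<times> UNIV) (\<lambda>(s, x). F s x)"
    and "\<And>s. s \<in> {a..b} \<Longrightarrow> periodic1 (F s)" "0 < \<epsilon>"
  shows "\<exists>N0. \<forall>N\<ge>N0. \<forall>s\<in>{a..b}. \<forall>x. \<bar>re_fejer N (fcoef (F s)) x - F s x\<bar> \<le> \<epsilon>"
proof -
  have "\<bar>re_fejer N c x - y\<bar> \<le> cmod (fejer_mean N c x - of_real y)" for N c x y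
    using abs_Re_le_cmod[of "fejer_mean N c x - of_real y"] by (simp add: re_fejer_def)
  then show ?thesis using fejer_uniform[OF assms] by (meson order_trans)
qed

text \<open>Local Lipschitz bound of the cubic flux in sup norm: changing u^2 costs 4 (M + 1)^2,
  changing the drift 2 (M + 1)^2.\<close>

lemma nonlin_diff_bound:
  assumes u: "continuous_on UNIV u" "periodic1 u" and u': "continuous_on UNIV u'" "periodic1 u'"
    and e: "\<And>x. \<bar>u x - u' x\<bar> \<le> e" "e \<le> 1" and M: "\<And>x. \<bar>u' x\<bar> \<le> M"
  shows "\<bar>nonlin u x - nonlin u' x\<bar> \<le> e * (6 * (M + 1)\<^sup>2)"
proof -
  have e0: "0 \<le> e" using e(1)[of 0] by linarith
  have M0: "0 \<le> M" using M[of 0] by linarith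
  have ub: "\<bar>u x\<bar> \<le> M + 1" for x using e(1)[of x] e(2) M[of x] by linarith
  have i: "integral {0..1} (\<lambda>y. \<bar>u y\<bar>) \<le> integral {0..1} (\<lambda>y::real. M + 1)"
    by (intro integral_le integrable_continuous_real continuous_intros continuous_on_subset[OF u(1)]) (use ub in auto)
  have d: "\<bar>drho u x\<bar> \<le> 2 * (M + 1)" using drho_bound[OF u, of x] i by simp
  have "nonlin u x - nonlin u' x = (u x - u' x) * (u x + u' x) * drho u x + (u' x)\<^sup>2 * (drho u x - drho u' x)"
    by (simp add: nonlin_drho power2_eq_square algebra_simps)
  also have "\<bar>\<dots>\<bar> \<le> \<bar>u x - u' x\<bar> * \<bar>u x + u' x\<bar> * \<bar>drho u x\<bar> + (u' x)\<^sup>2 * \<bar>drho u x - drho u' x\<bar>"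
    using abs_triangle_ineq[of "(u x - u' x) * (u x + u' x) * drho u x" "(u' x)\<^sup>2 * (drho u x - drho u' x)"]
    by (simp add: abs_mult)
  also have "\<dots> \<le> e * (2 * (M + 1)) * (2 * (M + 1)) + (M + 1)\<^sup>2 * (2 * e)"
  proof (intro add_mono mult_mono)
    show "\<bar>u x + u' x\<bar> \<le> 2 * (M + 1)" by (rule order_trans[OF abs_triangle_ineq]) (use add_mono[OF ub[of x] M[of x]] in simp)
    show "\<bar>drho u x - drho u' x\<bar> \<le> 2 * e" by (rule drho_diff_bound[OF u u' e(1)])
    show "(u' x)\<^sup>2 \<le> (M + 1)\<^sup>2" using M[of x] M0 by (simp add: abs_le_square_iff[symmetric])
  qed (use e e0 M0 d in auto)
  also have "\<dots> = e * (6 * (M + 1)\<^sup>2)" by (simp add: power2_eq_square algebra_simps)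
  finally show ?thesis .
qed

lemma tmean_bound:
  assumes "continuous_on UNIV f" "\<And>x. \<bar>f x\<bar> \<le> B"
  shows "\<bar>tmean f\<bar> \<le> B"
proof -
  have "norm (integral {0..1} f) \<le> integral {0..1} (\<lambda>x::real. B)"
    by (intro integral_norm_bound_integral integrable_continuous_real continuous_on_subset[OF assms(1)] continuous_intros)
       (use assms in auto)
  then show ?thesis by (simp add: tmean_eq_integral[OF assms(1)])
qed

text \<open>At k = 0 the semigroup is the identity and the divergence contributes the factor 0, so
  mass is conserved. The energy estimates see \<zeta> only through this number.\<close>

lemma mild_solution_mean:
  assumes w: "mild_solution \<alpha> \<eta> \<zeta> v w" and t: "0 < t"
  shows "complex_of_real (tmean (w t)) = \<zeta> 0"
proof -
  have "continuous_on UNIV (w t)" using w t by (simp add: mild_solution_def)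
  from tmean_fcoef[OF this] show ?thesis using w t by (simp add: mild_solution_def)
qed

text \<open>\<open>g\<close> is an arbitrary, possibly infinite majorant of a power of the roughness
  at single times, which leaves the probabilistic input to a later Tonelli argument. The constants
  are chosen before \<zeta>, \<open>w\<close>, \<open>s0\<close> and \<open>t\<close>; uniformity in
  the initial condition comes from here.\<close>

lemma pathwise_bound:
  fixes n :: nat and m :: real
  obtains \<epsilon> C :: real and K :: nat where "0 < \<epsilon>" "0 < C"
    "\<And>\<alpha> \<eta> \<zeta> v w s0 t g. \<lbrakk>0 < \<alpha>; mild_solution \<alpha> \<eta> \<zeta> v w; \<zeta> 0 = complex_of_real m;
       continuous_on ({0..} \<times> UNIV) (\<lambda>(t, x). v t x); \<And>t. periodic1 (v t); 0 < s0; s0 < t;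
       \<And>s. s \<in> {s0..t} \<Longrightarrow> g s < \<infinity> \<Longrightarrow> \<exists>H\<ge>1. smooth_approx \<epsilon> H (v s) \<and> ennreal (H ^ K) \<le> g s\<rbrakk>
     \<Longrightarrow> ennreal ((t - s0) ^ (n + 2) * integral {0..1} (\<lambda>x. w t x ^ (2 * n + 2)))
        \<le> (\<integral>\<^sup>+ s. (ennreal C * (1 + ennreal ((t - s0) ^ (n + 2)) * g s)) * indicator {s0..t} s \<partial>lborel)"
proof -
  let ?q = "2 * n" and ?p = "2 * n + 2"
  obtain \<epsilon> C0 K where st: "0 < \<epsilon>" "0 < C0"
    "\<And>z zx f v R ub H. \<lbrakk>\<And>x. (z has_real_derivative zx x) (at x); periodic1 z; continuous_on {0..1} zx;
       continuous_on {0..1} f; continuous_on {0..1} v; 1 \<le> H; smooth_approx \<epsilon> H v;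
       \<And>x. (R has_real_derivative (ub - (z x + v x))) (at x); periodic1 R;
       \<And>x. \<bar>R x\<bar> \<le> 2 * (integral {0..1} (\<lambda>x. \<bar>z x\<bar>) + H); \<bar>ub\<bar> \<le> (\<bar>m\<bar> + 2) * H;
       \<And>x. x \<in> {0..1} \<Longrightarrow> \<bar>f x - (z x + v x)\<^sup>2 * R x\<bar> \<le> H\<rbrakk>
     \<Longrightarrow> integral {0..1} (\<lambda>x. z x ^ (?q + 4)) / (2 * real (?q + 3)) - C0 * H ^ K
        \<le> integral {0..1} (\<lambda>x. z x ^ ?q * zx x * (zx x + f x))"
  proof -
    have e: "even ?q" "1 \<le> \<bar>m\<bar> + 2" by auto
    show thesis
    proof (rule energy_static[OF e], goal_cases)
      case (1 \<epsilon> C K)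
      show thesis by (rule that[OF 1(1) 1(2) 1(3)])
    qed
  qed
  \<comment> \<open>The factor P arises from differentiating the power \<open>?p\<close> in time and
    integrating by parts in space, b from differentiating the weight. \<open>C3\<close> is the Young
    constant that absorbs b y^(n+1) into c1 y^(n+2).\<close>
  define P where "P = real ?p * real (?p - 1)"
  define c1 where "c1 = P / (2 * real (?q + 3))"
  define b where "b = real (n + 2)"
  define C3 where "C3 = b * (b / c1) ^ (n + 1)"
  define C where "C = max C3 (P * C0)"
  have P: "0 < P" by (simp add: P_def)
  then have c1: "0 < c1" by (simp add: c1_def)
  have b: "0 < b" by (simp add: b_def)
  have C: "0 < C" "C3 \<le> C" "P * C0 \<le> C" using P st(2) by (auto simp: C_def less_max_iff_disj)
  show thesis
  proof (rule that[of \<epsilon> C K, OF st(1) C(1)])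
    fix \<alpha> \<eta> s0 t :: real and \<zeta> v w and g :: "real \<Rightarrow> ennreal"
    assume \<alpha>: "0 < \<alpha>" and w: "mild_solution \<alpha> \<eta> \<zeta> v w" and \<zeta>: "\<zeta> 0 = complex_of_real m"
      and v: "continuous_on ({0..} \<times> UNIV) (\<lambda>(t, x). v t x)" "\<And>t. periodic1 (v t)"
      and s0: "0 < s0" "s0 < t"
      and g: "\<And>s. s \<in> {s0..t} \<Longrightarrow> g s < \<infinity> \<Longrightarrow> \<exists>H\<ge>1. smooth_approx \<epsilon> H (v s) \<and> ennreal (H ^ K) \<le> g s"

    \<comment> \<open>Continuity and bounds on the time window\<close>
    define I where "I = {s0..t}"
    have I: "s > 0" if "s \<in> I" for s using that s0 by (simp add: I_def)
    define u where "u = (\<lambda>s x. w s x + v s x)"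
    have cw: "continuous_on (I \<times> UNIV) (\<lambda>(t, x). w t x)"
      by (rule continuous_on_subset[OF mild_solution_continuous[OF w \<alpha>]]) (use I in auto)
    have cv: "continuous_on (I \<times> UNIV) (\<lambda>(t, x). v t x)"
      by (rule continuous_on_subset[OF v(1)]) (use I in \<open>auto intro: less_imp_le\<close>)
    have cu: "continuous_on (I \<times> UNIV) (\<lambda>(t, x). u t x)"
      using continuous_on_add[OF cw cv] by (simp add: u_def split_beta)
    have pw: "periodic1 (w s)" if "s \<in> I" for s using w I[OF that] by (simp add: mild_solution_def)
    have pu: "periodic1 (u s)" if "s \<in> I" for s using pw[OF that] v(2)[of s] by (simp add: u_def periodic1_def)
    have cws: "continuous_on UNIV (w s)" and cvs: "continuous_on UNIV (v s)" and cus: "continuous_on UNIV (u s)"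
      if "s \<in> I" for s using continuous_on_slice[OF cw that] continuous_on_slice[OF cv that] continuous_on_slice[OF cu that] .
    have cF: "continuous_on (I \<times> UNIV) (\<lambda>(s, x). nonlin (u s) x)"
      unfolding I_def by (rule nonlin_family_continuous) (use cu pu in \<open>auto simp: I_def\<close>)
    have pF: "periodic1 (nonlin (u s))" if "s \<in> I" for s by (rule nonlin_periodic[OF cus[OF that] pu[OF that]])
    obtain M0 where M0: "\<And>s x. s \<in> I \<Longrightarrow> \<bar>u s x\<bar> \<le> M0"
      using periodic_family_uniform(1)[OF cu[unfolded I_def] pu[unfolded I_def]] unfolding I_def[symmetric] by blast
    have M00: "0 \<le> M0" using M0[of t 0] s0 by (simp add: I_def)
    \<comment> \<open>Replacing \<open>w\<close> by its Fejer mean in the flux then costs at most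
      1/2 by \<open>nonlin_diff_bound\<close>, and smoothing the flux itself another 1/2, so the
      total consistency error is at most 1 <= H.\<close>
    define e where "e = 1 / (12 * (M0 + 1)\<^sup>2)"
    have M1: "1 \<le> (M0 + 1)\<^sup>2" using M00 by simp
    have e: "0 < e" "e \<le> 1" "e * (6 * (M0 + 1)\<^sup>2) = 1/2" using M1 by (auto simp: e_def divide_le_eq)
    obtain N1 where N1: "\<And>N s x. N \<ge> N1 \<Longrightarrow> s \<in> I \<Longrightarrow> \<bar>re_fejer N (fcoef (w s)) x - w s x\<bar> \<le> e"
      using re_fejer_uniform[OF cw[unfolded I_def] pw[unfolded I_def] e(1)] unfolding I_def[symmetric] by blast
    obtain N2 where N2: "\<And>N s x. N \<ge> N2 \<Longrightarrow> s \<in> I \<Longrightarrow> \<bar>re_fejer N (fcoef (nonlin (u s))) x - nonlin (u s) x\<bar> \<le> 1/2"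
      using re_fejer_uniform[OF cF[unfolded I_def] pF[unfolded I_def], of "1/2"] unfolding I_def[symmetric] by auto
    define T where "T = (t - s0) ^ (n + 2)"
    have T: "0 \<le> T" using s0 by (simp add: T_def)
    let ?G = "\<integral>\<^sup>+ s. (ennreal C * (1 + ennreal T * g s)) * indicator {s0..t} s \<partial>lborel"

    \<comment> \<open>Energy balance for one Fejer mean\<close>
    have main: "ennreal (T * integral {0..1} (\<lambda>x. re_fejer N (fcoef (w t)) x ^ ?p)) \<le> ?G"
      if N: "N \<ge> N1" "N \<ge> N2" for N
    proof -
      define z where "z = (\<lambda>s. re_fejer N (fcoef (w s)))"
      define zx where "zx = (\<lambda>s. re_fejer N (fourier_deriv (fcoef (w s))))"
      define f where "f = (\<lambda>s. re_fejer N (fcoef (nonlin (u s))))"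
      define zt where "zt = (\<lambda>s. re_fejer N (\<lambda>k. fourier_deriv (fourier_deriv (fcoef (w s))) k
          + fourier_deriv (fcoef (nonlin (u s))) k))"
      have cw': "continuous_on I (\<lambda>s. fcoef (w s) k)" and cF': "continuous_on I (\<lambda>s. fcoef (nonlin (u s)) k)" for k
        using fcoef_family_continuous[OF cw[unfolded I_def]] fcoef_family_continuous[OF cF[unfolded I_def]] by (auto simp: I_def)
      have c2: "continuous_on (I \<times> UNIV) (\<lambda>(s, x). z s x)" "continuous_on (I \<times> UNIV) (\<lambda>(s, x). zt s x)"
        unfolding z_def zt_def fourier_deriv_def
        by (intro re_fejer_family_continuous continuous_intros cw' cF')+
      have dz: "(z s has_real_derivative zx s x) (at x)" for s x
        unfolding z_def zx_def by (rule re_fejer_derivative)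
      have dzf: "((\<lambda>x. zx s x + f s x) has_real_derivative zt s x) (at x)" for s x
        unfolding zx_def f_def zt_def re_fejer_add by (intro DERIV_add re_fejer_derivative)
      have dt: "((\<lambda>s. z s x) has_real_derivative zt s x) (at s within I)" if "s \<in> I" for s x
        unfolding z_def zt_def u_def
        by (rule re_fejer_time_derivative, rule has_vector_derivative_at_within,
            rule fcoef_mild_derivative[OF w \<alpha> v I[OF that]])
      have per: "periodic1 (z s)" "periodic1 (zx s)" "periodic1 (f s)" for s
        unfolding z_def zx_def f_def by (rule re_fejer_periodic)+
      have cts: "continuous_on A (z s)" "continuous_on A (zx s)" "continuous_on A (f s)" "continuous_on A (zt s)" for A s
        unfolding z_def zx_def f_def zt_def by (rule re_fejer_continuous)+
      define \<phi>' where "\<phi>' = (\<lambda>s. integral {0..1} (\<lambda>x. b * (s - s0) ^ (n + 1) * z s x ^ ?p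
          + (s - s0) ^ (n + 2) * (real ?p * (zt s x * z s x ^ (?p - 1)))))"
      have cint: "continuous_on (I \<times> cbox 0 1) (\<lambda>(s, x). b * (s - s0) ^ (n + 1) * z s x ^ ?p
          + (s - s0) ^ (n + 2) * (real ?p * (zt s x * z s x ^ (?p - 1))))"
      proof -
        have sub: "I \<times> cbox 0 1 \<subseteq> I \<times> (UNIV :: real set)" by auto
        note zc = continuous_on_subset[OF c2(1) sub, unfolded split_beta] continuous_on_subset[OF c2(2) sub, unfolded split_beta]
        show ?thesis unfolding split_beta by (intro continuous_intros zc)
      qed
      have d\<phi>: "((\<lambda>s. (s - s0) ^ (n + 2) * integral {0..1} (\<lambda>x. z s x ^ ?p)) has_real_derivative \<phi>' s) (at s within I)"
        if s: "s \<in> I" for s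
      proof -
        have "((\<lambda>s. integral (cbox 0 1) (\<lambda>x. (s - s0) ^ (n + 2) * z s x ^ ?p)) has_field_derivative
          integral (cbox 0 1) (\<lambda>x. b * (s - s0) ^ (n + 1) * z s x ^ ?p
            + (s - s0) ^ (n + 2) * (real ?p * (zt s x * z s x ^ (?p - 1))))) (at s within I)"
        proof (rule leibniz_rule_field_derivative)
          show "((\<lambda>s. (s - s0) ^ (n + 2) * z s x ^ ?p) has_field_derivative
             b * (s - s0) ^ (n + 1) * z s x ^ ?p + (s - s0) ^ (n + 2) * (real ?p * (zt s x * z s x ^ (?p - 1)))) (at s within I)"
            if "s \<in> I" for s x
          proof -
            have "((\<lambda>s. (s - s0) ^ (n + 2)) has_real_derivative real (n + 2) * ((1 - 0) * (s - s0) ^ (n + 2 - Suc 0))) (at s within I)"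
              by (intro DERIV_power DERIV_diff DERIV_ident DERIV_const)
            then have "((\<lambda>s. (s - s0) ^ (n + 2)) has_real_derivative b * (s - s0) ^ (n + 1)) (at s within I)"
              by (simp add: b_def)
            from DERIV_mult[OF this DERIV_power[OF dt[OF that, of x], of ?p]]
            show ?thesis by (simp add: mult.commute mult.left_commute)
          qed
          show "(\<lambda>x. (s - s0) ^ (n + 2) * z s x ^ ?p) integrable_on cbox 0 1" for s
            unfolding cbox_interval by (intro integrable_continuous_real continuous_intros cts)
          show "s \<in> I" by (rule s)
          show "convex I" by (simp add: I_def)
          show "continuous_on (I \<times> cbox 0 1) (\<lambda>(s, x). b * (s - s0) ^ (n + 1) * z s x ^ ?p
            + (s - s0) ^ (n + 2) * (real ?p * (zt s x * z s x ^ (?p - 1))))" by (rule cint)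
        qed
        then show ?thesis by (simp add: \<phi>'_def cbox_interval)
      qed
      have c\<phi>': "continuous_on I \<phi>'"
        using integral_continuous_on_param[OF cint] by (simp add: \<phi>'_def cbox_interval)
      have ineq: "\<phi>' s \<le> C3 + T * (P * C0 * H ^ K)"
        if s: "s \<in> I" and H: "1 \<le> H" "smooth_approx \<epsilon> H (v s)" for s H
      proof -
        define Y where "Y = integral {0..1} (\<lambda>x. z s x ^ ?q * zx s x * (zx s x + f s x))"
        define A where "A = integral {0..1} (\<lambda>x. z s x ^ (?q + 4))"
        define \<sigma> where "\<sigma> = s - s0"
        have \<sigma>: "0 \<le> \<sigma>" using s by (auto simp: \<sigma>_def I_def)
        have \<sigma>T: "\<sigma> ^ (n + 2) \<le> T" unfolding T_def by (rule power_mono) (use s \<sigma> in \<open>auto simp: \<sigma>_def I_def\<close>)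
        let ?u = "\<lambda>x. z s x + v s x"
        have vH: "\<bar>v s x\<bar> \<le> H" for x using H(2) by (auto simp: smooth_approx_def)
        have cu': "continuous_on UNIV ?u" using cts cvs[OF s] by (intro continuous_intros)
        have pu': "periodic1 ?u" using per(1)[of s] v(2)[of s] by (simp add: periodic1_def)
        have close: "\<bar>?u x - u s x\<bar> \<le> e" for x using N1[OF N(1) s, of x] by (simp add: u_def z_def)
        have iu: "integral {0..1} (\<lambda>y. \<bar>?u y\<bar>) \<le> integral {0..1} (\<lambda>y. \<bar>z s y\<bar>) + H"
        proof -
          have "integral {0..1} (\<lambda>y. \<bar>?u y\<bar>) \<le> integral {0..1} (\<lambda>y. \<bar>z s y\<bar> + H)"
          proof (intro integral_le integrable_continuous_real continuous_intros cts)
            show "continuous_on {0..1} (v s)" by (rule continuous_on_subset[OF cvs[OF s]]) simp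
            show "\<bar>?u x\<bar> \<le> \<bar>z s x\<bar> + H" for x using vH[of x] by linarith
          qed
          also have "\<dots> = integral {0..1} (\<lambda>y. \<bar>z s y\<bar>) + H"
            by (subst integral_add) (auto intro!: integrable_continuous_real continuous_intros cts)
          finally show ?thesis .
        qed
        have "A / (2 * real (?q + 3)) - C0 * H ^ K \<le> Y"
          unfolding A_def Y_def
        proof (rule st(3)[where v = "v s" and R = "drho ?u" and ub = "tmean ?u"])
          show "continuous_on {0..1} (v s)" by (rule continuous_on_subset[OF cvs[OF s]]) simp
          show "(drho ?u has_real_derivative tmean ?u - ?u x) (at x)" for x by (rule drho_derivative[OF cu' pu'])
          show "periodic1 (drho ?u)" by (rule drho_periodic[OF cu' pu'])
          show "\<bar>drho ?u x\<bar> \<le> 2 * (integral {0..1} (\<lambda>x. \<bar>z s x\<bar>) + H)" for x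
            by (rule order_trans[OF drho_bound[OF cu' pu']], rule mult_left_mono[OF iu]) simp
          \<comment> \<open>The mean of \<open>w s\<close> is m, the Fejer error is at most 1 and
            the noise at most H; with 1 <= H this explains the constant |m| + 2.\<close>
          show "\<bar>tmean ?u\<bar> \<le> (\<bar>m\<bar> + 2) * H"
          proof -
            have "tmean (w s) = m"
              using mild_solution_mean[OF w I[OF s]] \<zeta> by simp
            moreover have "\<bar>tmean (\<lambda>x. ?u x - w s x)\<bar> \<le> 1 + H"
            proof (rule tmean_bound)
              show "\<bar>?u x - w s x\<bar> \<le> 1 + H" for x using close[of x] e(2) vH[of x] by (simp add: u_def)
            qed (rule continuous_on_diff[OF cu' cws[OF s]])
            ultimately have "\<bar>tmean ?u\<bar> \<le> \<bar>m\<bar> + (1 + H)" using tmean_diff[OF cu' cws[OF s]] by linarith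
            also have "\<dots> \<le> (\<bar>m\<bar> + 2) * H"
              using H(1) mult_left_mono[OF H(1), of "\<bar>m\<bar>"] by (simp add: distrib_right)
            finally show ?thesis .
          qed
          show "\<bar>f s x - (z s x + v s x)\<^sup>2 * drho ?u x\<bar> \<le> H" for x
          proof -
            have "\<bar>nonlin ?u x - nonlin (u s) x\<bar> \<le> e * (6 * (M0 + 1)\<^sup>2)"
              by (rule nonlin_diff_bound[OF cu' pu' cus[OF s] pu[OF s] close e(2) M0[OF s]])
            moreover have "\<bar>f s x - nonlin (u s) x\<bar> \<le> 1/2" unfolding f_def by (rule N2[OF N(2) s])
            moreover have "nonlin ?u x = (z s x + v s x)\<^sup>2 * drho ?u x" by (simp add: nonlin_drho)
            ultimately show ?thesis using e(3) H(1) by linarith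
          qed
        qed (use dz per cts H in auto)
        then have "- P * Y \<le> - c1 * A + P * C0 * H ^ K"
          using mult_left_mono[of "A / (2 * real (?q + 3)) - C0 * H ^ K" Y P] P by (simp add: c1_def algebra_simps)
        have parts: "((\<lambda>x. zt s x * z s x ^ (?p - 1)) has_integral (- (real (?p - 1) * Y))) {0..1}"
        proof -
          let ?b = "\<lambda>x. real (?p - 1) * (zx s x * z s x ^ ?q) * (zx s x + f s x)"
          have p1: "?p - 1 - Suc 0 = ?q" by simp
          have "((\<lambda>x. (zx s x + f s x) * z s x ^ (?p - 1)) has_real_derivative zt s x * z s x ^ (?p - 1) + ?b x) (at x)" for x
            using DERIV_mult[OF dzf[of s x] DERIV_power[OF dz[of s x], of "?p - 1"]] unfolding p1 .
          then have "((\<lambda>x. zt s x * z s x ^ (?p - 1) + ?b x) has_integral 0) {0..1}"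
            by (rule periodic_integral_derivative) (use per[of s] in \<open>simp add: periodic1_def\<close>)
          moreover have "(?b has_integral (real (?p - 1) * Y)) {0..1}"
          proof -
            have "((\<lambda>x. z s x ^ ?q * zx s x * (zx s x + f s x)) has_integral Y) {0..1}"
              unfolding Y_def by (intro integrable_integral integrable_continuous_real continuous_intros cts)
            from has_integral_mult_right[OF this, of "real (?p - 1)"] show ?thesis
              by (simp only: mult.assoc mult.left_commute)
          qed
          ultimately have "((\<lambda>x. (zt s x * z s x ^ (?p - 1) + ?b x) - ?b x) has_integral (0 - real (?p - 1) * Y)) {0..1}"
            by (rule has_integral_diff)
          then show ?thesis by (simp only: add_diff_cancel_right' diff_0)
        qed
        have i1: "((\<lambda>x. z s x ^ ?p) has_integral (integral {0..1} (\<lambda>x. z s x ^ ?p))) {0..1}"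
          by (intro integrable_integral integrable_continuous_real continuous_intros cts)
        have "\<phi>' s = b * \<sigma> ^ (n + 1) * integral {0..1} (\<lambda>x. z s x ^ ?p) + \<sigma> ^ (n + 2) * (real ?p * - (real (?p - 1) * Y))"
          unfolding \<phi>'_def \<sigma>_def
          by (rule integral_unique) (intro has_integral_add has_integral_mult_right i1 parts)
        also have "\<dots> = b * \<sigma> ^ (n + 1) * integral {0..1} (\<lambda>x. z s x ^ ?p) + \<sigma> ^ (n + 2) * (- P * Y)"
          by (simp add: P_def)
        also have "\<dots> \<le> b * \<sigma> ^ (n + 1) * integral {0..1} (\<lambda>x. z s x ^ ?p) + \<sigma> ^ (n + 2) * (- c1 * A + P * C0 * H ^ K)"
          using \<open>- P * Y \<le> - c1 * A + P * C0 * H ^ K\<close> \<sigma> by (intro add_left_mono mult_left_mono) auto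
        also have "\<dots> = (b * \<sigma> ^ (n + 1) * integral {0..1} (\<lambda>x. z s x ^ ?p) - c1 * \<sigma> ^ (n + 2) * A) + \<sigma> ^ (n + 2) * (P * C0 * H ^ K)"
          by (simp add: algebra_simps)
        also have "\<dots> \<le> C3 + T * (P * C0 * H ^ K)"
        proof (rule add_mono)
          show "\<sigma> ^ (n + 2) * (P * C0 * H ^ K) \<le> T * (P * C0 * H ^ K)"
            using \<sigma>T P st(2) H(1) by (intro mult_right_mono) auto
          \<comment> \<open>In terms of y = \<sigma> z^2 the derivative of the weight contributes b
            y^(n+1) and the damping c1 y^(n+2); the exponent n + 2 of the weight is what matches the
            powers.\<close>
          have pt: "b * \<sigma> ^ (n + 1) * z s x ^ ?p - c1 * \<sigma> ^ (n + 2) * z s x ^ (?q + 4) \<le> C3" for x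
          proof -
            have x: "b * (\<sigma> * (z s x)\<^sup>2) ^ (n + 1) \<le> c1 * (\<sigma> * (z s x)\<^sup>2) ^ Suc (n + 1) + C3"
              unfolding C3_def by (rule young_power) (use \<sigma> c1 b in auto)
            have "?p = 2 * (n + 1)" "?q + 4 = 2 * (n + 2)" "Suc (n + 1) = n + 2" by auto
            then show ?thesis using x unfolding power_mult_distrib power_mult[symmetric] by (simp only: mult.assoc) 
          qed
          have "((\<lambda>x. b * \<sigma> ^ (n + 1) * z s x ^ ?p - c1 * \<sigma> ^ (n + 2) * z s x ^ (?q + 4)) has_integral
             (b * \<sigma> ^ (n + 1) * integral {0..1} (\<lambda>x. z s x ^ ?p) - c1 * \<sigma> ^ (n + 2) * A)) {0..1}"
            unfolding A_def
            by (intro has_integral_diff has_integral_mult_right integrable_integral integrable_continuous_real continuous_intros cts)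
          from has_integral_le[OF this has_integral_const_real[of C3 0 1] pt]
          show "b * \<sigma> ^ (n + 1) * integral {0..1} (\<lambda>x. z s x ^ ?p) - c1 * \<sigma> ^ (n + 2) * A \<le> C3" by simp
        qed
        finally show ?thesis .
      qed
      \<comment> \<open>The weight vanishes at s0, so the value of z there drops out.\<close>
      have "(\<phi>' has_integral ((t - s0) ^ (n + 2) * integral {0..1} (\<lambda>x. z t x ^ ?p) - (s0 - s0) ^ (n + 2) * integral {0..1} (\<lambda>x. z s0 x ^ ?p))) {s0..t}"
        by (rule fundamental_theorem_of_calculus)
           (use s0 d\<phi> in \<open>auto simp: I_def has_real_derivative_iff_has_vector_derivative\<close>)
      then have "integral {s0..t} \<phi>' = T * integral {0..1} (\<lambda>x. z t x ^ ?p)"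
        by (simp add: integral_unique T_def)
      then have "ennreal (T * integral {0..1} (\<lambda>x. z t x ^ ?p)) \<le> (\<integral>\<^sup>+ s. ennreal (\<phi>' s) * indicator {s0..t} s \<partial>lborel)"
        using ennreal_set_lint_le_nn_integral[OF c\<phi>'[unfolded I_def]] by simp
      also have "\<dots> \<le> ?G"
      proof (intro nn_integral_mono)
        fix s
        show "ennreal (\<phi>' s) * indicator {s0..t} s \<le> ennreal C * (1 + ennreal T * g s) * indicator {s0..t} s"
        proof (cases "s \<in> {s0..t}")
          case True
          have "ennreal (\<phi>' s) \<le> ennreal C * (1 + ennreal T * g s)"
          proof (cases "g s < \<infinity>")
            case fin: True
            obtain H where H: "1 \<le> H" "smooth_approx \<epsilon> H (v s)" "ennreal (H ^ K) \<le> g s" using g[OF True fin] by auto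
            have "\<phi>' s \<le> C3 + T * (P * C0 * H ^ K)" by (rule ineq) (use True H in \<open>auto simp: I_def\<close>)
            also have "\<dots> \<le> C + T * (C * H ^ K)" using C T H(1) by (intro add_mono mult_left_mono mult_right_mono) auto
            also have "\<dots> = C * (1 + T * H ^ K)" by (simp add: algebra_simps)
            finally have "ennreal (\<phi>' s) \<le> ennreal (C * (1 + T * H ^ K))" by (rule ennreal_leI)
            also have "\<dots> = ennreal C * (1 + ennreal T * ennreal (H ^ K))"
              using C T H(1) by (simp add: ennreal_mult ennreal_plus flip: ennreal_1)
            also have "\<dots> \<le> ennreal C * (1 + ennreal T * g s)" using H(3) by (intro mult_left_mono add_left_mono) auto
            finally show ?thesis .
          next
            \<comment> \<open>Where \<open>g s\<close> is infinite so is the right-hand side,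
              because T > 0.\<close>
            case False
            have "T > 0" using s0 by (simp add: T_def)
            then show ?thesis using False C(1) by (simp add: ennreal_mult_eq_top_iff less_top[symmetric] ennreal_mult_top)
          qed
          then show ?thesis using True by simp
        qed simp
      qed
      finally show ?thesis by (simp add: z_def)
    qed

    \<comment> \<open>Removal of the truncation\<close>
    have tI: "t \<in> I" using s0 by (simp add: I_def)
    have lim: "(\<lambda>N. re_fejer N (fcoef (w t)) x) \<longlonglongrightarrow> w t x" for x
      unfolding lim_sequentially dist_real_def
    proof (intro allI impI)
      fix r :: real assume "0 < r"
      then obtain N0 where N0: "\<forall>N\<ge>N0. \<forall>s\<in>{s0..t}. \<forall>x. \<bar>re_fejer N (fcoef (w s)) x - w s x\<bar> \<le> r/2"
        using re_fejer_uniform[OF cw[unfolded I_def] pw[unfolded I_def], of "r/2"] by auto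
      show "\<exists>no. \<forall>N\<ge>no. \<bar>re_fejer N (fcoef (w t)) x - w t x\<bar> < r"
      proof (intro exI[of _ N0] allI impI)
        fix N assume "N0 \<le> N"
        then have "\<bar>re_fejer N (fcoef (w t)) x - w t x\<bar> \<le> r/2" using N0 tI unfolding I_def by blast
        also have "\<dots> < r" using \<open>0 < r\<close> by simp
        finally show "\<bar>re_fejer N (fcoef (w t)) x - w t x\<bar> < r" .
      qed
    qed
    obtain W where W: "\<And>x. \<bar>w t x\<bar> \<le> W"
      using periodic_family_uniform(1)[OF cw[unfolded I_def] pw[unfolded I_def]] tI unfolding I_def[symmetric] by blast
    have "(\<lambda>N. integral {0..1} (\<lambda>x. re_fejer N (fcoef (w t)) x ^ ?p)) \<longlonglongrightarrow> integral {0..1} (\<lambda>x. w t x ^ ?p)"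
    proof (rule dominated_convergence(2))
      show "(\<lambda>x. re_fejer N (fcoef (w t)) x ^ ?p) integrable_on {0..1}" for N
        by (intro integrable_continuous_real continuous_intros re_fejer_continuous)
      show "(\<lambda>x::real. W ^ ?p) integrable_on {0..1}" by (rule integrable_const_ivl)
      \<comment> \<open>Fejer means inherit the sup bound of \<open>w t\<close>, so one constant
        dominates all N.\<close>
      show "norm (re_fejer N (fcoef (w t)) x ^ ?p) \<le> W ^ ?p" for N x
      proof -
        have "cmod (fejer_mean N (fcoef (w t)) x) \<le> W"
          unfolding fcoef_eq_ccoef[OF cws[OF tI], abs_def]
          by (rule fejer_mean_norm_le) (use W in \<open>auto intro!: continuous_intros continuous_on_subset[OF cws[OF tI]]\<close>)
        then have "\<bar>re_fejer N (fcoef (w t)) x\<bar> \<le> W" unfolding re_fejer_def using abs_Re_le_cmod order_trans by blast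
        then show ?thesis unfolding real_norm_def power_abs by (rule power_mono) simp
      qed
      show "(\<lambda>N. re_fejer N (fcoef (w t)) x ^ ?p) \<longlonglongrightarrow> w t x ^ ?p" for x
        by (intro tendsto_power lim)
    qed
    then have "(\<lambda>N. ennreal (T * integral {0..1} (\<lambda>x. re_fejer N (fcoef (w t)) x ^ ?p))) \<longlonglongrightarrow> ennreal (T * integral {0..1} (\<lambda>x. w t x ^ ?p))"
      by (intro tendsto_ennrealI tendsto_mult tendsto_const)
    then show "ennreal ((t - s0) ^ (n + 2) * integral {0..1} (\<lambda>x. w t x ^ (2 * n + 2)))
        \<le> (\<integral>\<^sup>+ s. (ennreal C * (1 + ennreal ((t - s0) ^ (n + 2)) * g s)) * indicator {s0..t} s \<partial>lborel)"
      unfolding T_def[symmetric]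
      by (rule LIMSEQ_le_const2) (use main in \<open>auto intro!: exI[of _ "max N1 N2"]\<close>)
  qed
qed

section \<open>Chaining along dyadic points\<close>

text \<open>Passing to the next level either keeps the dyadic point or moves it to its right
  neighbour, so a single increment suffices.\<close>

lemma dyadic_floor_step:
  fixes f :: "real \<Rightarrow> real" and x :: real
  assumes inc: "\<And>i::int. \<bar>f ((of_int i + 1) / 2 ^ Suc k) - f (of_int i / 2 ^ Suc k)\<bar> \<le> B" and "0 \<le> B"
  shows "\<bar>f (of_int \<lfloor>2 ^ Suc k * x\<rfloor> / 2 ^ Suc k) - f (of_int \<lfloor>2 ^ k * x\<rfloor> / 2 ^ k)\<bar> \<le> B"
proof -
  let ?j = "\<lfloor>2 ^ k * x\<rfloor>"
  have "2 ^ Suc k * x = 2 * (2 ^ k * x)" by simp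
  then have "\<lfloor>2 ^ Suc k * x\<rfloor> = 2 * ?j \<or> \<lfloor>2 ^ Suc k * x\<rfloor> = 2 * ?j + 1"
    by (simp only:) linarith
  moreover have e: "real_of_int ?j / 2 ^ k = of_int (2 * ?j) / 2 ^ Suc k" by simp
  ultimately show ?thesis using inc[of "2 * ?j"] \<open>0 \<le> B\<close> unfolding e by auto
qed

lemma dyadic_floor_tendsto: "(\<lambda>k. of_int \<lfloor>2 ^ k * x\<rfloor> / 2 ^ k) \<longlonglongrightarrow> (x::real)"
proof (rule tendsto_sandwich)
  have "(\<lambda>k. x - 1 / 2 ^ k) \<longlonglongrightarrow> x - 0"
    by (intro tendsto_diff tendsto_const LIMSEQ_divide_realpow_zero) simp
  then show "(\<lambda>k. x - 1 / 2 ^ k) \<longlonglongrightarrow> x" by simp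
  show "(\<lambda>k. x) \<longlonglongrightarrow> x" by simp
  have "2 ^ k * x - 1 \<le> of_int \<lfloor>2 ^ k * x\<rfloor>" for k by linarith
  then have "(2 ^ k * x - 1) / 2 ^ k \<le> of_int \<lfloor>2 ^ k * x\<rfloor> / 2 ^ k" for k by (rule divide_right_mono) simp
  then show "eventually (\<lambda>k. x - 1 / 2 ^ k \<le> of_int \<lfloor>2 ^ k * x\<rfloor> / 2 ^ k) sequentially"
    by (simp add: diff_divide_distrib)
  have "of_int \<lfloor>2 ^ k * x\<rfloor> / 2 ^ k \<le> (2 ^ k * x) / 2 ^ k" for k by (intro divide_right_mono) auto
  then show "eventually (\<lambda>k. of_int \<lfloor>2 ^ k * x\<rfloor> / 2 ^ k \<le> x) sequentially" by simp
qed

text \<open>Kolmogorov's chaining: x and y are approached along their dyadic roundings, whose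
  increments form a geometric series, and at level n the two roundings are equal or adjacent. The
  factor 3 counts the two tails and the link.\<close>

lemma chaining:
  fixes f :: "real \<Rightarrow> real"
  assumes cont: "continuous_on UNIV f" and \<theta>: "0 < \<theta>" "\<theta> < 1" and K: "0 \<le> K"
    and inc: "\<And>k (i::int). \<bar>f ((of_int i + 1) / 2 ^ k) - f (of_int i / 2 ^ k)\<bar> \<le> K * \<theta> ^ k"
    and xy: "\<bar>x - y\<bar> \<le> 1 / 2 ^ n"
  shows "\<bar>f x - f y\<bar> \<le> 3 * K * \<theta> ^ n / (1 - \<theta>)"
proof -
  define d where "d = (\<lambda>k (x::real). real_of_int \<lfloor>2 ^ k * x\<rfloor> / 2 ^ k)"
  define A where "A = K * \<theta> ^ n / (1 - \<theta>)"
  \<comment> \<open>\<open>A\<close> is the full geometric tail from level n; subtracting A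
    \<theta>^j makes the bound telescope in the induction.\<close>
  have partial: "\<bar>f (d (n + j) x) - f (d n x)\<bar> \<le> A - A * \<theta> ^ j" for j x
  proof (induction j)
    case (Suc j)
    have "\<bar>f (d (Suc (n + j)) x) - f (d (n + j) x)\<bar> \<le> K * \<theta> ^ Suc (n + j)"
      unfolding d_def by (rule dyadic_floor_step) (rule inc, use K \<theta> in simp)
    also have "\<dots> \<le> K * \<theta> ^ (n + j)" using K \<theta> by (intro mult_left_mono power_decreasing) auto
    also have "\<dots> = A * \<theta> ^ j - A * \<theta> ^ Suc j"
    proof -
      have "A * \<theta> ^ j - A * \<theta> ^ Suc j = A * (1 - \<theta>) * \<theta> ^ j" by (simp add: algebra_simps)
      then show ?thesis using \<theta> by (simp add: A_def power_add)
    qed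
    finally show ?case using Suc by simp
  qed simp
  have A: "0 \<le> A" using K \<theta> by (simp add: A_def)
  have near: "\<bar>f x - f (d n x)\<bar> \<le> A" for x
  proof -
    have "isCont f x" using cont by (simp add: continuous_on_eq_continuous_at)
    then have "(\<lambda>k. f (d k x)) \<longlonglongrightarrow> f x"
      using dyadic_floor_tendsto[of x] unfolding d_def by (rule isCont_tendsto_compose)
    then have "(\<lambda>j. f (d (j + n) x)) \<longlonglongrightarrow> f x" by (rule LIMSEQ_ignore_initial_segment)
    then have "(\<lambda>j. \<bar>f (d (n + j) x) - f (d n x)\<bar>) \<longlonglongrightarrow> \<bar>f x - f (d n x)\<bar>"
      by (intro tendsto_intros) (simp add: add.commute)
    then show ?thesis
    proof (rule LIMSEQ_le_const2)
      have "\<bar>f (d (n + j) x) - f (d n x)\<bar> \<le> A" for j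
      proof -
        have "0 \<le> A * \<theta> ^ j" using A \<theta> by simp
        then show ?thesis using partial[of j x] by linarith
      qed
      then show "\<exists>N. \<forall>j\<ge>N. \<bar>f (d (n + j) x) - f (d n x)\<bar> \<le> A" by blast
    qed
  qed
  have mid: "\<bar>f (d n x) - f (d n y)\<bar> \<le> K * \<theta> ^ n"
  proof -
    have "\<bar>2 ^ n * x - 2 ^ n * y\<bar> = 2 ^ n * \<bar>x - y\<bar>" by (simp add: abs_mult flip: right_diff_distrib)
    also have "\<dots> \<le> 2 ^ n * (1 / 2 ^ n)" using xy by (intro mult_left_mono) auto
    finally have "\<bar>2 ^ n * x - 2 ^ n * y\<bar> \<le> 1" by simp
    then have "\<lfloor>2 ^ n * x\<rfloor> = \<lfloor>2 ^ n * y\<rfloor> \<or> \<lfloor>2 ^ n * x\<rfloor> = \<lfloor>2 ^ n * y\<rfloor> + 1 \<or> \<lfloor>2 ^ n * y\<rfloor> = \<lfloor>2 ^ n * x\<rfloor> + 1"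
      by linarith
    then show ?thesis
      using inc[of "\<lfloor>2 ^ n * x\<rfloor>" n] inc[of "\<lfloor>2 ^ n * y\<rfloor>" n] K \<theta>
      by (auto simp: d_def abs_minus_commute)
  qed
  have "K * \<theta> ^ n \<le> A"
  proof -
    have "K * \<theta> ^ n / 1 \<le> K * \<theta> ^ n / (1 - \<theta>)" using K \<theta> by (intro divide_left_mono) auto
    then show ?thesis by (simp add: A_def)
  qed
  then have "\<bar>f x - f y\<bar> \<le> 3 * A" using near[of x] near[of y] mid by linarith
  then show ?thesis by (simp add: A_def)
qed

lemma two_powr_eighth: "((2::real) powr (-1/8)) ^ 8 = 1/2"
proof -
  have "((2::real) powr (-1/8)) ^ 8 = (2 powr (-1/8)) powr real 8" by (subst powr_realpow) simp_all
  also have "\<dots> = 2 powr ((-1/8) * real 8)" by (rule powr_powr)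
  also have "(-1/8) * real 8 = - 1" by simp
  finally show ?thesis by (simp add: powr_minus)
qed

text \<open>The moments of order 8 L of the noise increments at scale 2^(-k) are of order 2^(-2 k L), so the
  weight 2^(k L) leaves the sum over k and over the 2^k intervals convergent in expectation, while its
  finiteness still forces Hoelder continuity of exponent 1/8.\<close>

definition dyadic_energy :: "nat \<Rightarrow> (real \<Rightarrow> real) \<Rightarrow> ennreal" where
  "dyadic_energy L f = (\<Sum>k. ennreal (2 ^ (k * L)) *
     (\<Sum>i<2 ^ k. ennreal ((f ((real i + 1) / 2 ^ k) - f (real i / 2 ^ k)) ^ (8 * L))))"

text \<open>A single summand is below the whole energy, and periodicity brings any integer i into
  the range of the sum. Since (2^(-1/8))^8 = 1/2, the weight 2^(k L) becomes the decay 2^(-k/8)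
  after taking the root of order 8 L.\<close>

lemma dyadic_increment_le:
  assumes per: "periodic1 f" and fin: "dyadic_energy L f < \<infinity>" and L: "1 \<le> L"
  shows "\<bar>f ((of_int i + 1) / 2 ^ k) - f (of_int i / 2 ^ k)\<bar> \<le> root (8 * L) (enn2real (dyadic_energy L f)) * (2 powr (-1/8)) ^ k"
proof -
  define S where "S = enn2real (dyadic_energy L f)"
  have S: "dyadic_energy L f = ennreal S" "0 \<le> S" using fin by (auto simp: S_def less_top)
  define j where "j = nat (i mod 2 ^ k)"
  have j: "j < 2 ^ k" "int j = i mod 2 ^ k"
    unfolding j_def by (simp_all add: nat_less_iff)
  define D where "D = f ((real j + 1) / 2 ^ k) - f (real j / 2 ^ k)"
  have "i = int j + 2 ^ k * (i div 2 ^ k)" unfolding j(2) by simp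
  then have "real_of_int i = real_of_int (int j + 2 ^ k * (i div 2 ^ k))" by (rule arg_cong)
  then have ri: "real_of_int i = real j + 2 ^ k * of_int (i div 2 ^ k)"
    by (simp only: of_int_add of_int_mult of_int_of_nat_eq of_int_power of_int_numeral)
  have D: "f ((of_int i + 1) / 2 ^ k) - f (of_int i / 2 ^ k) = D"
  proof -
    have "(of_int i + 1) / 2 ^ k = (real j + 1) / 2 ^ k + of_int (i div 2 ^ k)" "of_int i / 2 ^ k = real j / 2 ^ k + of_int (i div 2 ^ k)"
      unfolding ri by (simp_all add: add_divide_distrib)
    then show ?thesis using periodic1_of_int[OF per] by (simp add: D_def)
  qed
  have "ennreal (2 ^ (k * L)) * ennreal (D ^ (8 * L)) \<le> ennreal (2 ^ (k * L)) *
     (\<Sum>i<2 ^ k. ennreal ((f ((real i + 1) / 2 ^ k) - f (real i / 2 ^ k)) ^ (8 * L)))"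
    unfolding D_def by (intro mult_left_mono member_le_sum) (use j in auto)
  also have "\<dots> \<le> dyadic_energy L f" unfolding dyadic_energy_def
    using sum_le_suminf[OF summableI, of "{k}" "\<lambda>k. ennreal (2 ^ (k * L)) *
     (\<Sum>i<2 ^ k. ennreal ((f ((real i + 1) / 2 ^ k) - f (real i / 2 ^ k)) ^ (8 * L)))"] by simp
  finally have "ennreal (2 ^ (k * L) * D ^ (8 * L)) \<le> ennreal S"
    unfolding S(1) by (subst ennreal_mult) (auto simp: zero_le_even_power)
  then have "2 ^ (k * L) * \<bar>D\<bar> ^ (8 * L) \<le> S" using S(2) by (simp add: power_even_abs)
  moreover define \<theta> where "\<theta> = (2::real) powr (-1/8)"
  have \<theta>: "0 < \<theta>" "\<theta> ^ 8 = 1/2" unfolding \<theta>_def by (simp, rule two_powr_eighth)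
  have "(root (8 * L) S * \<theta> ^ k) ^ (8 * L) * 2 ^ (k * L) = S"
  proof -
    have "(root (8 * L) S) ^ (8 * L) = S" using S(2) L by (intro real_root_pow_pos2) auto
    moreover have "(\<theta> ^ k) ^ (8 * L) = (\<theta> ^ 8) ^ (k * L)"
      by (simp only: power_mult[symmetric] ac_simps)
    ultimately show ?thesis by (simp add: power_mult_distrib \<theta>(2) power_one_over)
  qed
  ultimately have "2 ^ (k * L) * \<bar>D\<bar> ^ (8 * L) \<le> 2 ^ (k * L) * (root (8 * L) S * \<theta> ^ k) ^ (8 * L)"
    by (simp add: mult.commute)
  then have "\<bar>D\<bar> ^ (8 * L) \<le> (root (8 * L) S * \<theta> ^ k) ^ (8 * L)" by simp
  then have "\<bar>D\<bar> \<le> root (8 * L) S * \<theta> ^ k"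
    using L S(2) \<theta>(1) by (subst (asm) power_mono_iff) auto
  then show ?thesis unfolding D S_def \<theta>_def .
qed

text \<open>The smooth part is the moving average over length h. By the mean value theorem it takes
  values of f at distance below h, and its derivative is a difference quotient, at most \<epsilon> /
  h.\<close>

lemma smooth_approx_average:
  fixes f :: "real \<Rightarrow> real"
  assumes cont: "continuous_on UNIV f" and per: "periodic1 f" and h: "0 < h"
    and osc: "\<And>x y. \<bar>x - y\<bar> \<le> h \<Longrightarrow> \<bar>f x - f y\<bar> \<le> \<epsilon>"
    and V: "\<And>x. \<bar>f x\<bar> \<le> V" and H: "V \<le> H" "\<epsilon> / h \<le> H"
  shows "smooth_approx \<epsilon> H f"
proof -
  obtain F where F: "\<And>x. (F has_real_derivative f x) (at x)" using antiderivative_exists[OF cont] by auto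
  define a where "a = (\<lambda>x. (F (x + h) - F x) / h)"
  define a' where "a' = (\<lambda>x. (f (x + h) - f x) / h)"
  have mv: "\<exists>y. x < y \<and> y < x + h \<and> a x = f y" for x
  proof -
    have "\<exists>y. x < y \<and> y < x + h \<and> F (x + h) - F x = (x + h - x) * f y"
      by (rule MVT2) (use h F in auto)
    then show ?thesis using h by (auto simp: a_def)
  qed
  have da: "(a has_real_derivative a' x) (at x)" for x
  proof -
    have "((\<lambda>x. F (x + h)) has_real_derivative f (x + h)) (at x)"
      using F[of "x + h"] by (simp add: DERIV_shift)
    then show ?thesis unfolding a_def a'_def by (intro DERIV_cdivide DERIV_diff F)
  qed
  \<comment> \<open>The antiderivative F is not periodic in general. The increment of a over one
    period is constant in x, and it must vanish because a is bounded.\<close>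
  have pa: "periodic1 a"
  proof -
    have "a (x + 1) = a x" for x
    proof -
      have "((\<lambda>x. a (x + 1) - a x) has_real_derivative 0) (at x)" for x
      proof -
        have "((\<lambda>x. a (x + 1)) has_real_derivative a' (x + 1)) (at x)" using da[of "x + 1"] by (simp add: DERIV_shift)
        moreover have "a' (x + 1) = a' x" using per unfolding a'_def periodic1_def by (metis add.commute add.left_commute)
        ultimately show ?thesis using DERIV_diff[OF _ da[of x], of "\<lambda>x. a (x + 1)" "a' x"] by simp
      qed
      then have c: "a (x + 1) - a x = a (y + 1) - a y" for x y by (rule has_real_derivative_zero_periodic)
      define c where "c = a (0 + 1) - a 0"
      have step: "a (real n) = a 0 + real n * c" for n
      proof (induction n)
        case (Suc n)
        have "a (real n + 1) - a (real n) = c" using c[of "real n" 0] by (simp add: c_def)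
        then show ?case using Suc by (simp add: algebra_simps)
      qed simp
      have bd: "\<bar>a x\<bar> \<le> V" for x using mv[of x] V by metis
      have "c = 0"
      proof (rule ccontr)
        assume "c \<noteq> 0"
        obtain n :: nat where "2 * V / \<bar>c\<bar> < real n" using reals_Archimedean2 by blast
        then have "2 * V < real n * \<bar>c\<bar>" using \<open>c \<noteq> 0\<close> by (simp add: pos_divide_less_eq)
        also have "\<dots> = \<bar>a (real n) - a 0\<bar>" using step[of n] by (simp add: abs_mult)
        also have "\<dots> \<le> 2 * V" using bd[of "real n"] bd[of 0] by linarith
        finally show False by simp
      qed
      then show ?thesis using c[of x 0] by (simp add: c_def)
    qed
    then show ?thesis by (simp add: periodic1_def)
  qed
  have ca': "continuous_on UNIV a'" unfolding a'_def
    by (intro continuous_intros continuous_on_compose2[OF cont] cont) (use h in auto)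
  show ?thesis unfolding smooth_approx_def
  proof (rule exI[of _ a], rule exI[of _ a'], intro conjI allI pa ca' da)
    fix x
    obtain y where y: "x < y" "y < x + h" "a x = f y" using mv by blast
    show "\<bar>f x\<bar> \<le> H" "\<bar>a x\<bar> \<le> H" using V[of x] V[of y] H y by auto
    show "\<bar>f x - a x\<bar> \<le> \<epsilon>" unfolding y(3) by (rule osc) (use y in auto)
    have "\<bar>a' x\<bar> = \<bar>f (x + h) - f x\<bar> / h" using h by (simp add: a'_def)
    also have "\<dots> \<le> \<epsilon> / h" using osc[of "x + h" x] h by (intro divide_right_mono) auto
    finally show "\<bar>a' x\<bar> \<le> H" using H by linarith
  qed
qed

text \<open>Hoelder regularity of exponent 1/8 with constant c K allows an averaging length 2^(-n)
  with 2^n at most of order 1 + (c K / \<epsilon>)^8. The derivative bound is then linear in K^8,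
  and (K^8)^L is exactly the energy, so H^L is controlled by the first power of the energy.\<close>

lemma smooth_approx_of_energy:
  fixes \<epsilon> :: real and L :: nat
  assumes "0 < \<epsilon>" and L: "1 \<le> L"
  shows "\<exists>C>0. \<forall>f. continuous_on UNIV f \<longrightarrow> periodic1 f \<longrightarrow> dyadic_energy L f < \<infinity> \<longrightarrow>
     (\<exists>H\<ge>1. smooth_approx \<epsilon> H f \<and>
        ennreal (H ^ L) \<le> ennreal C * (1 + ennreal (f 0 ^ (2 * L)) + dyadic_energy L f))"
proof -
  define \<theta> where "\<theta> = (2::real) powr (-1/8)"
  have \<theta>: "0 < \<theta>" "\<theta> < 1" by (auto simp: \<theta>_def powr_less_one)
  have \<theta>8: "\<theta> ^ 8 = 1/2" unfolding \<theta>_def by (rule two_powr_eighth)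
  define c where "c = 3 / (1 - \<theta>)"
  have c: "0 < c" using \<theta> by (simp add: c_def)
  \<comment> \<open>The summands cover in turn |f 0|, the oscillation c K, and the two parts of the
    bound for \<epsilon> 2^n.\<close>
  define B where "B = 1 + c + \<epsilon> + \<epsilon> * (2 * (c / \<epsilon>) ^ 8)"
  have Bpos: "0 < B" using c \<open>0 < \<epsilon>\<close> unfolding B_def by (intro add_pos_pos) auto
  \<comment> \<open>3^L comes from the three summands of \<open>y\<close>, and 2 from |f 0|^L <= 1 +
    f 0 ^ (2 L), which leaves an even power for the Gaussian moments.\<close>
  define C where "C = B ^ L * 3 ^ L * 2"
  show ?thesis
  proof (rule exI[of _ C], intro conjI allI impI)
    show "0 < C" using Bpos by (simp add: C_def)
    fix f assume f: "continuous_on UNIV f" "periodic1 f" "dyadic_energy L f < \<infinity>"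
    define S where "S = enn2real (dyadic_energy L f)"
    have S: "dyadic_energy L f = ennreal S" "0 \<le> S" using f(3) by (auto simp: S_def less_top)
    define K where "K = root (8 * L) S"
    have K: "0 \<le> K" using S L by (simp add: K_def real_root_ge_zero)
    have KS: "K ^ (8 * L) = S" unfolding K_def using S(2) L by (intro real_root_pow_pos2) auto
    have osc: "\<bar>f x - f y\<bar> \<le> c * K * \<theta> ^ n" if "\<bar>x - y\<bar> \<le> 1 / 2 ^ n" for x y n
      using chaining[OF f(1) \<theta> K _ that] dyadic_increment_le[OF f(2,3) L]
      unfolding K_def S_def \<theta>_def c_def by simp
    have V: "\<bar>f x\<bar> \<le> \<bar>f 0\<bar> + c * K" for x
    proof -
      have "\<bar>f (x - of_int \<lfloor>x\<rfloor>) - f 0\<bar> \<le> c * K * \<theta> ^ 0"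
        by (rule osc) (simp, linarith)
      then show ?thesis using periodic1_of_int[OF f(2), of "x - of_int \<lfloor>x\<rfloor>" "\<lfloor>x\<rfloor>"] by simp
    qed
    have "\<exists>n. c * K * \<theta> ^ n \<le> \<epsilon>"
    proof -
      have "(\<lambda>n. c * K * \<theta> ^ n) \<longlonglongrightarrow> c * K * 0" using \<theta> by (intro tendsto_mult tendsto_const LIMSEQ_power_zero) auto
      then have "eventually (\<lambda>n. c * K * \<theta> ^ n < \<epsilon>) sequentially" by (rule order_tendstoD) (use \<open>0 < \<epsilon>\<close> in simp)
      then show ?thesis by (auto simp: eventually_sequentially intro: less_imp_le)
    qed
    \<comment> \<open>Minimality bounds 2^n from above: at n - 1 the quantity c K \<theta>^(n-1)
      still exceeds \<epsilon>, and its eighth power contains 2^(-(n-1)).\<close>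
    define n where "n = (LEAST n. c * K * \<theta> ^ n \<le> \<epsilon>)"
    have n: "c * K * \<theta> ^ n \<le> \<epsilon>" unfolding n_def by (rule LeastI_ex) fact
    have n2: "2 ^ n \<le> 1 + 2 * (c / \<epsilon>) ^ 8 * K ^ 8"
    proof (cases n)
      case 0
      then show ?thesis using c K \<open>0 < \<epsilon>\<close> by simp
    next
      case (Suc l)
      have "\<not> c * K * \<theta> ^ l \<le> \<epsilon>" using not_less_Least[of l "\<lambda>n. c * K * \<theta> ^ n \<le> \<epsilon>"] Suc by (simp add: n_def)
      then have "\<epsilon> ^ 8 \<le> (c * K * \<theta> ^ l) ^ 8" using \<open>0 < \<epsilon>\<close> by (intro power_mono) auto
      also have "\<dots> = c ^ 8 * K ^ 8 * (\<theta> ^ 8) ^ l" by (simp add: power_mult_distrib power_mult[symmetric] mult.commute)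
      also have "\<dots> = c ^ 8 * K ^ 8 / 2 ^ l" unfolding \<theta>8 by (simp add: power_one_over)
      finally have "2 ^ l \<le> c ^ 8 * K ^ 8 / \<epsilon> ^ 8" using \<open>0 < \<epsilon>\<close> by (simp add: field_simps)
      then show ?thesis using Suc by (simp add: power_divide)
    qed
    define y where "y = 1 + \<bar>f 0\<bar> + K ^ 8"
    define H where "H = B * y"
    have y: "1 \<le> y" using K by (simp add: y_def)
    have B1: "1 \<le> B" using c \<open>0 < \<epsilon>\<close> unfolding B_def by (simp add: add_increasing2)
    have K8: "K \<le> 1 + K ^ 8" using power_le_one_plus_power[OF K, of 1 8] by simp
    show "\<exists>H\<ge>1. smooth_approx \<epsilon> H f \<and> ennreal (H ^ L) \<le> ennreal C * (1 + ennreal (f 0 ^ (2 * L)) + dyadic_energy L f)"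
    proof (intro exI[of _ H] conjI)
      show "1 \<le> H" unfolding H_def using mult_mono[OF B1 y] Bpos by simp
      show "smooth_approx \<epsilon> H f"
      proof (rule smooth_approx_average[OF f(1,2), of "1 / 2 ^ n"])
        show "\<bar>f x - f y\<bar> \<le> \<epsilon>" if "\<bar>x - y\<bar> \<le> 1 / 2 ^ n" for x y using osc[OF that] n by linarith
        show "\<bar>f x\<bar> \<le> \<bar>f 0\<bar> + c * K" for x by (rule V)
        have cy: "c * K \<le> c * y" using K8 c by (intro mult_left_mono) (auto simp: y_def)
        have fy: "\<bar>f 0\<bar> \<le> y" using K by (simp add: y_def)
        have e2: "0 \<le> \<epsilon> * (2 * (c / \<epsilon>) ^ 8) * y" "0 \<le> \<epsilon> * y" using y c \<open>0 < \<epsilon>\<close> by auto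
        have By: "B * y = y + c * y + \<epsilon> * y + \<epsilon> * (2 * (c / \<epsilon>) ^ 8) * y" by (simp only: B_def distrib_right mult_1_left)
        show "\<bar>f 0\<bar> + c * K \<le> H" unfolding H_def By using cy fy e2 by linarith
        have "\<epsilon> * 2 ^ n \<le> \<epsilon> * (1 + 2 * (c / \<epsilon>) ^ 8 * K ^ 8)" using n2 \<open>0 < \<epsilon>\<close> by (intro mult_left_mono) auto
        also have "\<dots> \<le> \<epsilon> * (y + 2 * (c / \<epsilon>) ^ 8 * y)"
          using y c \<open>0 < \<epsilon>\<close> by (intro mult_left_mono add_mono) (auto simp: y_def)
        also have "\<dots> = \<epsilon> * y + \<epsilon> * (2 * (c / \<epsilon>) ^ 8) * y" by (simp add: algebra_simps)
        finally have "\<epsilon> * 2 ^ n \<le> \<epsilon> * y + \<epsilon> * (2 * (c / \<epsilon>) ^ 8) * y" .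
        moreover have "0 < c * y" using y c by simp
        moreover have "\<epsilon> / (1 / 2 ^ n) = \<epsilon> * 2 ^ n" by simp
        ultimately show "\<epsilon> / (1 / 2 ^ n) \<le> H" unfolding H_def By using y by linarith
      qed simp
      have "y ^ L \<le> 3 ^ L * (1 + \<bar>f 0\<bar> ^ L + (K ^ 8) ^ L)"
      proof -
        define M where "M = max 1 (max \<bar>f 0\<bar> (K ^ 8))"
        have "y ^ L \<le> (3 * M) ^ L" using y by (intro power_mono) (auto simp: y_def M_def)
        also have "\<dots> = 3 ^ L * M ^ L" by (simp add: power_mult_distrib)
        also have "M ^ L \<le> 1 + \<bar>f 0\<bar> ^ L + (K ^ 8) ^ L"
          using K by (auto simp: M_def max_def)
        finally show ?thesis by simp
      qed
      also have "\<dots> \<le> 3 ^ L * (2 * (1 + f 0 ^ (2 * L) + S))"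
      proof (rule mult_left_mono)
        have "\<bar>f 0\<bar> ^ L \<le> 1 + \<bar>f 0\<bar> ^ (2 * L)" by (rule power_le_one_plus_power) auto
        moreover have "\<bar>f 0\<bar> ^ (2 * L) = f 0 ^ (2 * L)" by (simp add: power_even_abs)
        moreover have "0 \<le> f 0 ^ (2 * L)" by (simp add: zero_le_even_power)
        moreover have "(K ^ 8) ^ L = S" using KS by (simp only: power_mult)
        ultimately have "1 + \<bar>f 0\<bar> ^ L + (K ^ 8) ^ L \<le> 2 + 2 * f 0 ^ (2 * L) + 2 * S"
          using S(2) by linarith
        then show "1 + \<bar>f 0\<bar> ^ L + (K ^ 8) ^ L \<le> 2 * (1 + f 0 ^ (2 * L) + S)"
          by (simp only: distrib_left mult_1_right)
      qed simp
      finally have "H ^ L \<le> B ^ L * (3 ^ L * (2 * (1 + f 0 ^ (2 * L) + S)))"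
        unfolding H_def power_mult_distrib using Bpos by (intro mult_left_mono) auto
      also have "\<dots> = C * (1 + f 0 ^ (2 * L) + S)" by (simp add: C_def)
      finally have "ennreal (H ^ L) \<le> ennreal (C * (1 + f 0 ^ (2 * L) + S))" by (rule ennreal_leI)
      also have "\<dots> = ennreal C * (1 + ennreal (f 0 ^ (2 * L)) + dyadic_energy L f)"
        using S(2) \<open>0 < C\<close> by (simp add: S(1) ennreal_mult ennreal_plus zero_le_even_power flip: ennreal_1)
      finally show "ennreal (H ^ L) \<le> ennreal C * (1 + ennreal (f 0 ^ (2 * L)) + dyadic_energy L f)" .
    qed
  qed
qed

section \<open>Variance of the stochastic heat field\<close>

text \<open>For v = 0 the variable is only known to vanish almost surely and has no density, so that
  case is separate; otherwise the moments come from the normal density.\<close>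

lemma gaussian_even_moment:
  assumes M: "prob_space M" and X: "centered_gaussian M X v" and "0 \<le> v"
  shows "(\<integral>\<^sup>+ \<omega>. ennreal (X \<omega> ^ (2 * k)) \<partial>M) \<le> ennreal (fact (2 * k) / (2 ^ k * fact k) * v ^ k)"
proof (cases "v = 0")
  case True
  interpret prob_space M by fact
  have "AE \<omega> in M. X \<omega> = 0" using X True by (simp add: centered_gaussian_def)
  then have "(\<integral>\<^sup>+ \<omega>. ennreal (X \<omega> ^ (2 * k)) \<partial>M) = (\<integral>\<^sup>+ \<omega>. ennreal (0 ^ (2 * k)) \<partial>M)"
    by (intro nn_integral_cong_AE) auto
  also have "\<dots> \<le> ennreal (fact (2 * k) / (2 ^ k * fact k) * v ^ k)"
    using True by (cases "k = 0") (auto simp: emeasure_space_1 power_0_left)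
  finally show ?thesis .
next
  case False
  then have v: "0 < v" using \<open>0 \<le> v\<close> by simp
  then have D: "distributed M lborel X (\<lambda>x. ennreal (normal_density 0 (sqrt v) x))"
    using X by (simp add: centered_gaussian_def)
  have "(\<integral>\<^sup>+ \<omega>. ennreal (X \<omega> ^ (2 * k)) \<partial>M) =
     (\<integral>\<^sup>+ x. ennreal (normal_density 0 (sqrt v) x) * ennreal (x ^ (2 * k)) \<partial>lborel)"
    by (rule distributed_nn_integral[OF D, symmetric]) simp
  also have "\<dots> = (\<integral>\<^sup>+ x. ennreal (normal_density 0 (sqrt v) x * (x - 0) ^ (2 * k)) \<partial>lborel)"
    by (intro nn_integral_cong) (simp add: ennreal_mult zero_le_even_power)
  also have "\<dots> = ennreal (fact (2 * k) / ((2 / (sqrt v)\<^sup>2) ^ k * fact k))"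
  proof -
    have "has_bochner_integral lborel (\<lambda>x. normal_density 0 (sqrt v) x * (x - 0) ^ (2 * k)) (fact (2 * k) / ((2 / (sqrt v)\<^sup>2) ^ k * fact k))"
      by (rule normal_moment_even) (use v in simp)
    then show ?thesis
      by (subst nn_integral_eq_integral) (auto simp: has_bochner_integral_iff zero_le_even_power)
  qed
  also have "fact (2 * k) / ((2 / (sqrt v)\<^sup>2) ^ k * fact k) = fact (2 * k) / (2 ^ k * fact k) * v ^ k"
    using v by (simp add: power_divide)
  finally show ?thesis by simp
qed

text \<open>Index k stands for the frequency k + 1, paired with its negative through the real part.
  The coefficients Z encode the evaluation point: \<open>cis (2 * pi * real (Suc k) * x)\<close>
  gives the cosine at x - y, and differences of two such sequences describe increments of the field
  in x.\<close>

definition fourier_mode :: "(nat \<Rightarrow> complex) \<Rightarrow> nat \<Rightarrow> real \<Rightarrow> real" where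
  "fourier_mode Z k y = Re (Z k * cis (- 2 * pi * real (Suc k) * y))"

lemma fourier_mode_continuous: "continuous_on A (fourier_mode Z k)"
  unfolding fourier_mode_def[abs_def] by (intro continuous_intros)

lemma fourier_mode_bound: "\<bar>fourier_mode Z k y\<bar> \<le> cmod (Z k)"
  unfolding fourier_mode_def using abs_Re_le_cmod[of "Z k * cis (- 2 * pi * real (Suc k) * y)"] by (simp add: norm_mult)

lemma integral_Re_cis:
  "((\<lambda>y. Re (W * cis (2 * pi * real_of_int n * y))) has_integral (if n = 0 then Re W else 0)) {0..1}"
proof -
  have "((\<lambda>y. cis (2 * pi * real_of_int n * y)) has_integral (if n = 0 then 1 else 0)) {0..1}"
    unfolding integral_cis[symmetric] by (intro integrable_integral integrable_continuous_real continuous_intros)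
  from has_integral_Re[OF has_integral_mult_right[OF this, of W]] show ?thesis by (simp split: if_splits)
qed

lemma fourier_mode_integral: "(fourier_mode Z k has_integral 0) {0..1}"
  using integral_Re_cis[of "Z k" "- int (Suc k)"] by (simp add: fourier_mode_def[abs_def] del: of_nat_Suc)

text \<open>A product of real parts is half the sum of the real parts of two complex products. The
  sum of two frequencies is never 0, as both are at least 1, so only their difference can
  contribute.\<close>

lemma fourier_mode_orthogonal:
  "((\<lambda>y. fourier_mode Z j y * fourier_mode Z k y) has_integral (if j = k then (cmod (Z k))\<^sup>2 / 2 else 0)) {0..1}"
proof -
  have split: "Re a * Re b = (1/2) * (Re (a * b) + Re (a * cnj b))" for a b by simp
  have "fourier_mode Z j y * fourier_mode Z k y = (1/2) * (Re (Z j * Z k * cis (2 * pi * real_of_int (- int (Suc j) - int (Suc k)) * y))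
     + Re (Z j * cnj (Z k) * cis (2 * pi * real_of_int (int (Suc k) - int (Suc j)) * y)))" for y
  proof -
    have 1: "(Z j * cis (- 2 * pi * real (Suc j) * y)) * (Z k * cis (- 2 * pi * real (Suc k) * y))
      = Z j * Z k * cis (2 * pi * real_of_int (- int (Suc j) - int (Suc k)) * y)"
    proof -
      have "cis (- 2 * pi * real (Suc j) * y) * cis (- 2 * pi * real (Suc k) * y) = cis (2 * pi * real_of_int (- int (Suc j) - int (Suc k)) * y)"
        by (simp only: cis_mult, rule arg_cong[where f=cis], simp add: algebra_simps)
      then show ?thesis by (simp only: mult.assoc mult.left_commute[of "cis _" "Z k"])
    qed
    have 2: "(Z j * cis (- 2 * pi * real (Suc j) * y)) * cnj (Z k * cis (- 2 * pi * real (Suc k) * y))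
      = Z j * cnj (Z k) * cis (2 * pi * real_of_int (int (Suc k) - int (Suc j)) * y)"
    proof -
      have "cis (- 2 * pi * real (Suc j) * y) * cnj (cis (- 2 * pi * real (Suc k) * y)) = cis (2 * pi * real_of_int (int (Suc k) - int (Suc j)) * y)"
        by (simp only: cis_cnj cis_mult, rule arg_cong[where f=cis], simp add: algebra_simps)
      then show ?thesis by (simp only: complex_cnj_mult mult.assoc mult.left_commute[of "cis _" "cnj (Z k)"])
    qed
    show ?thesis unfolding fourier_mode_def split 1 2 ..
  qed
  moreover have "((\<lambda>y. (1/2) * (Re (Z j * Z k * cis (2 * pi * real_of_int (- int (Suc j) - int (Suc k)) * y))
     + Re (Z j * cnj (Z k) * cis (2 * pi * real_of_int (int (Suc k) - int (Suc j)) * y)))) has_integral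
     (1/2) * ((if - int (Suc j) - int (Suc k) = 0 then Re (Z j * Z k) else 0) + (if int (Suc k) - int (Suc j) = 0 then Re (Z j * cnj (Z k)) else 0))) {0..1}"
    by (intro has_integral_mult_right has_integral_add integral_Re_cis)
  moreover have "(1/2) * ((if - int (Suc j) - int (Suc k) = 0 then Re (Z j * Z k) else 0) + (if int (Suc k) - int (Suc j) = 0 then Re (Z j * cnj (Z k)) else 0))
     = (if j = k then (cmod (Z k))\<^sup>2 / 2 else 0)"
  proof -
    have "Re (Z k * cnj (Z k)) = (cmod (Z k))\<^sup>2" by (simp only: complex_norm_square[symmetric] Re_complex_of_real)
    then show ?thesis by (cases "j = k") simp_all
  qed
  ultimately show ?thesis by (simp only:)
qed

text \<open>Orthogonality for the partial sums, then Fatou. The factor 1/2 from the norm of the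
  cosine is discarded.\<close>

lemma nn_integral_square_series:
  fixes a :: "nat \<Rightarrow> real"
  assumes sum: "\<And>y. summable (\<lambda>k. a k * fourier_mode Z k y)"
  shows "(\<integral>\<^sup>+ y. ennreal ((\<Sum>k. a k * fourier_mode Z k y)\<^sup>2) * indicator {0..1} y \<partial>lborel)
     \<le> (\<Sum>k. ennreal ((a k)\<^sup>2 * (cmod (Z k))\<^sup>2))"
proof -
  let ?B = "\<Sum>k. ennreal ((a k)\<^sup>2 * (cmod (Z k))\<^sup>2)"
  define P where "P = (\<lambda>n y. \<Sum>k<n. a k * fourier_mode Z k y)"
  have cP: "continuous_on A (P n)" for A n
    unfolding P_def by (intro continuous_intros fourier_mode_continuous)
  have mP [measurable]: "P n \<in> borel_measurable borel" for n
    by (rule borel_measurable_continuous_onI) (rule cP)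
  have Pn: "(\<integral>\<^sup>+ y. ennreal ((P n y)\<^sup>2) * indicator {0..1} y \<partial>lborel) \<le> ?B" for n
  proof -
    have "((\<lambda>y. \<Sum>j<n. \<Sum>k<n. (a j * a k) * (fourier_mode Z j y * fourier_mode Z k y)) has_integral
       (\<Sum>j<n. \<Sum>k<n. (a j * a k) * (if j = k then (cmod (Z k))\<^sup>2 / 2 else 0))) {0..1}"
      by (intro has_integral_sum finite_lessThan has_integral_mult_right fourier_mode_orthogonal)
    also have "(\<lambda>y. \<Sum>j<n. \<Sum>k<n. (a j * a k) * (fourier_mode Z j y * fourier_mode Z k y)) = (\<lambda>y. (P n y)\<^sup>2)"
      by (simp add: P_def power2_eq_square sum_product algebra_simps)
    also have "(\<Sum>j<n. \<Sum>k<n. (a j * a k) * (if j = k then (cmod (Z k))\<^sup>2 / 2 else 0)) = (\<Sum>j<n. (a j)\<^sup>2 * (cmod (Z j))\<^sup>2 / 2)"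
      by (intro sum.cong refl) (simp add: if_distrib sum.delta power2_eq_square cong: if_cong)
    finally have I: "((\<lambda>y. (P n y)\<^sup>2) has_integral (\<Sum>j<n. (a j)\<^sup>2 * (cmod (Z j))\<^sup>2 / 2)) {0..1}" .
    have c2: "continuous_on {0..1} (\<lambda>y. (P n y)\<^sup>2)" by (intro continuous_intros cP)
    have "(\<integral>\<^sup>+ y. ennreal ((P n y)\<^sup>2) * indicator {0..1} y \<partial>lborel) = (\<integral>\<^sup>+ y. ennreal (indicator {0..1} y *\<^sub>R (P n y)\<^sup>2) \<partial>lborel)"
      by (intro nn_integral_cong) (auto simp: indicator_def)
    also have "\<dots> = ennreal (LINT y:{0..1}|lborel. (P n y)\<^sup>2)"
      unfolding set_lebesgue_integral_def
      by (rule nn_integral_eq_integral) (use set_lint_continuous(1)[OF c2] in \<open>auto simp: set_integrable_def\<close>)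
    also have "\<dots> = ennreal (\<Sum>j<n. (a j)\<^sup>2 * (cmod (Z j))\<^sup>2 / 2)"
      using set_lint_continuous(2)[OF c2] integral_unique[OF I] by simp
    also have "\<dots> \<le> ennreal (\<Sum>j<n. (a j)\<^sup>2 * (cmod (Z j))\<^sup>2)"
      by (intro ennreal_leI sum_mono) simp
    also have "\<dots> = (\<Sum>j<n. ennreal ((a j)\<^sup>2 * (cmod (Z j))\<^sup>2))" by (simp add: sum_ennreal)
    also have "\<dots> \<le> ?B" by (rule sum_le_suminf) auto
    finally show ?thesis .
  qed
  have "(\<integral>\<^sup>+ y. ennreal ((\<Sum>k. a k * fourier_mode Z k y)\<^sup>2) * indicator {0..1} y \<partial>lborel)
     = (\<integral>\<^sup>+ y. liminf (\<lambda>n. ennreal ((P n y)\<^sup>2) * indicator {0..1} y) \<partial>lborel)"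
  proof (intro nn_integral_cong)
    fix y
    have "(\<lambda>n. P n y) \<longlonglongrightarrow> (\<Sum>k. a k * fourier_mode Z k y)"
      unfolding P_def by (rule summable_LIMSEQ[OF sum])
    then have "(\<lambda>n. ennreal ((P n y)\<^sup>2) * indicator {0..1} y) \<longlonglongrightarrow> ennreal ((\<Sum>k. a k * fourier_mode Z k y)\<^sup>2) * indicator {0..1} y"
      by (cases "y \<in> {0..1}") (auto intro!: tendsto_ennrealI tendsto_power)
    then show "ennreal ((\<Sum>k. a k * fourier_mode Z k y)\<^sup>2) * indicator {0..1} y = liminf (\<lambda>n. ennreal ((P n y)\<^sup>2) * indicator {0..1} y)"
      by (rule lim_imp_Liminf[OF sequentially_bot, symmetric])
  qed
  also have "\<dots> \<le> liminf (\<lambda>n. \<integral>\<^sup>+ y. ennreal ((P n y)\<^sup>2) * indicator {0..1} y \<partial>lborel)"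
    by (rule nn_integral_liminf) measurable
  also have "\<dots> \<le> limsup (\<lambda>n. \<integral>\<^sup>+ y. ennreal ((P n y)\<^sup>2) * indicator {0..1} y \<partial>lborel)"
    by (rule Liminf_le_Limsup) simp
  also have "\<dots> \<le> ?B" by (rule Limsup_bounded) (simp add: Pn)
  finally show ?thesis .
qed

text \<open>The factor 2 joins the frequencies k + 1 and -(k + 1).\<close>

definition heat_coef :: "real \<Rightarrow> nat \<Rightarrow> real" where
  "heat_coef r k = 2 * exp (- 4 * pi\<^sup>2 * (real (Suc k))\<^sup>2 * r)"

definition heat_series :: "(nat \<Rightarrow> complex) \<Rightarrow> real \<Rightarrow> real \<Rightarrow> real" where
  "heat_series Z r y = (\<Sum>k. heat_coef r k * fourier_mode Z k y)"

lemma heat_coef_summable: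
  assumes "0 < r"
  shows "summable (heat_coef r)"
proof -
  define q where "q = exp (- 4 * pi\<^sup>2 * r)"
  have q: "0 < q" "q < 1" using assms by (auto simp: q_def)
  have "summable (\<lambda>k. 2 * q ^ k)" using q by (intro summable_mult summable_geometric) auto
  then show ?thesis
  proof (rule summable_comparison_test')
    fix k
    have "real k \<le> (real (Suc k))\<^sup>2" by (simp add: power2_eq_square algebra_simps)
    then have "(4 * pi\<^sup>2 * r) * real k \<le> (4 * pi\<^sup>2 * r) * (real (Suc k))\<^sup>2" using assms by (intro mult_left_mono) auto
    then have "exp (- 4 * pi\<^sup>2 * (real (Suc k))\<^sup>2 * r) \<le> exp (real k * (- 4 * pi\<^sup>2 * r))"
      by (simp add: mult_ac del: of_nat_Suc)
    also have "\<dots> = q ^ k" unfolding q_def by (rule exp_of_nat_mult)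
    finally show "norm (heat_coef r k) \<le> 2 * q ^ k" by (simp add: heat_coef_def del: of_nat_Suc)
  qed
qed

lemma heat_series_summable:
  assumes r: "0 < r" and Z: "\<And>k. cmod (Z k) \<le> 2"
  shows "summable (\<lambda>k. \<bar>heat_coef r k * fourier_mode Z k y\<bar>)"
    "summable (\<lambda>k. heat_coef r k * fourier_mode Z k y)"
proof -
  have "summable (\<lambda>k. heat_coef r k * 2)" by (rule summable_mult2[OF heat_coef_summable[OF r]])
  then show *: "summable (\<lambda>k. \<bar>heat_coef r k * fourier_mode Z k y\<bar>)"
  proof (rule summable_comparison_test')
    show "norm \<bar>heat_coef r k * fourier_mode Z k y\<bar> \<le> heat_coef r k * 2" for k
      using fourier_mode_bound[of Z k y] Z[of k]
      by (simp add: abs_mult heat_coef_def del: of_nat_Suc)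
  qed
  show "summable (\<lambda>k. heat_coef r k * fourier_mode Z k y)"
    by (rule summable_rabs_cancel[OF *])
qed

lemma heat_kernel_series:
  "heat_kernel r (x - y) = 1 + heat_series (\<lambda>k. cis (2 * pi * real (Suc k) * x)) r y"
  unfolding heat_kernel_def heat_series_def heat_coef_def fourier_mode_def cis_mult
  by (simp add: algebra_simps)

lemma heat_series_measurable [measurable]:
  "(\<lambda>(r, y). heat_series Z r y) \<in> borel_measurable borel"
  unfolding heat_series_def heat_coef_def fourier_mode_def borel_prod[symmetric] split_beta cis.sel
  by (simp del: of_nat_Suc)

lemma heat_series_integral:
  assumes r: "0 < r" and Z: "\<And>k. cmod (Z k) \<le> 2"
  shows "set_integrable lborel {0..1} (heat_series Z r)" "(LINT y:{0..1}|lborel. heat_series Z r y) = 0"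
proof -
  let ?f = "\<lambda>k y. indicator {0..1} y *\<^sub>R (heat_coef r k * fourier_mode Z k y)"
  have c: "continuous_on {0..1} (\<lambda>y. heat_coef r k * fourier_mode Z k y)" for k
    by (intro continuous_intros fourier_mode_continuous)
  have i: "integrable lborel (?f k)" for k
    using set_lint_continuous(1)[OF c[of k]] by (simp add: set_integrable_def)
  have s1: "AE y in lborel. summable (\<lambda>k. norm (?f k y))"
    using summable_mult[OF heat_series_summable(1)[OF r Z]] by (auto simp: abs_mult)
  have s2: "summable (\<lambda>k. \<integral>y. norm (?f k y) \<partial>lborel)"
  proof (rule summable_comparison_test'[OF summable_mult2[OF heat_coef_summable[OF r], of 2]])
    fix k
    have "(\<integral>y. norm (?f k y) \<partial>lborel) \<le> (\<integral>y. indicator {0..1::real} y *\<^sub>R (heat_coef r k * 2) \<partial>lborel)"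
    proof (rule integral_mono)
      show "integrable lborel (\<lambda>y. norm (?f k y))" using i[of k] by (rule integrable_norm)
      show "integrable lborel (\<lambda>y. indicator {0..1::real} y *\<^sub>R (heat_coef r k * 2))" by simp
      show "norm (?f k y) \<le> indicator {0..1} y *\<^sub>R (heat_coef r k * 2)" for y
        using fourier_mode_bound[of Z k y] Z[of k]
        by (auto simp: abs_mult heat_coef_def indicator_def simp del: of_nat_Suc)
    qed
    then show "norm (\<integral>y. norm (?f k y) \<partial>lborel) \<le> heat_coef r k * 2" by simp
  qed
  have e: "(\<Sum>k. ?f k y) = indicator {0..1} y *\<^sub>R heat_series Z r y" for y
    unfolding heat_series_def by (cases "y \<in> {0..1}") auto
  show "set_integrable lborel {0..1} (heat_series Z r)"
    using integrable_suminf[OF i s1 s2] unfolding e set_integrable_def .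
  have "(LINT y:{0..1}|lborel. heat_series Z r y) = (\<Sum>k. integral\<^sup>L lborel (?f k))"
    using integral_suminf[OF i s1 s2] unfolding e set_lebesgue_integral_def .
  also have "\<dots> = (\<Sum>k. 0)"
  proof (intro arg_cong[where f=suminf] ext)
    fix k
    have "integral\<^sup>L lborel (?f k) = integral {0..1} (\<lambda>y. heat_coef r k * fourier_mode Z k y)"
      using set_lint_continuous(2)[OF c[of k]] unfolding set_lebesgue_integral_def .
    also have "\<dots> = 0" 
      using integral_unique[OF has_integral_mult_right[OF fourier_mode_integral[of Z k], of "heat_coef r k"]] unfolding mult_zero_right .
    finally show "integral\<^sup>L lborel (?f k) = 0" .
  qed
  finally show "(LINT y:{0..1}|lborel. heat_series Z r y) = 0" by simp
qed

text \<open>For s < t, \<open>c\<close> is the spatial mean: 1 for the heat kernel, 0 after the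
  projection and for differences of two kernels.\<close>

definition heat_field :: "real \<Rightarrow> real \<Rightarrow> (nat \<Rightarrow> complex) \<Rightarrow> real \<times> real \<Rightarrow> real" where
  "heat_field c t Z = (\<lambda>(s, y). if s < t then c + heat_series Z (t - s) y else 0)"

lemma heat_field_measurable [measurable]: "heat_field c t Z \<in> borel_measurable borel"
proof -
  have "(\<lambda>p. (\<lambda>(r, y). heat_series Z r y) (t - fst p, snd p)) \<in> borel_measurable (borel \<Otimes>\<^sub>M borel)"
    by (rule measurable_compose[OF _ heat_series_measurable]) (simp add: borel_prod[symmetric])
  then show ?thesis
    unfolding heat_field_def borel_prod[symmetric] split_beta by simp
qed

text \<open>Squaring doubles the decay rate, so the time integral is at most 4 c / (8 pi^2 (k+1)^2),
  whatever t is. Here the uniformity in time of all noise moments originates.\<close>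

lemma nn_integral_heat_coef:
  "(\<integral>\<^sup>+ s. ennreal ((heat_coef (t - s) k)\<^sup>2 * c) * indicator {0..t} s \<partial>lborel) \<le> ennreal (c / (real (Suc k))\<^sup>2)"
  if "0 \<le> c" for c
proof (cases "0 \<le> t")
  case True
  define \<beta> where "\<beta> = 8 * pi\<^sup>2 * (real (Suc k))\<^sup>2"
  have \<beta>: "0 < \<beta>" by (simp add: \<beta>_def)
  define F where "F = (\<lambda>s. 4 * c * exp (- \<beta> * (t - s)) / \<beta>)"
  have h2: "(heat_coef (t - s) k)\<^sup>2 = 4 * exp (- \<beta> * (t - s))" for s
    by (simp add: heat_coef_def \<beta>_def power_mult_distrib exp_double[symmetric] algebra_simps del: of_nat_Suc)
  have "(\<integral>\<^sup>+ s. ennreal ((heat_coef (t - s) k)\<^sup>2 * c) * indicator {0..t} s \<partial>lborel) = ennreal (F t - F 0)"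
  proof (rule nn_integral_FTC_Icc)
    show "(F has_real_derivative ((heat_coef (t - s) k)\<^sup>2 * c)) (at s)" for s
      unfolding F_def h2 using \<beta> by (auto intro!: derivative_eq_intros)
  qed (use True that in \<open>auto simp: h2\<close>)
  also have "\<dots> \<le> ennreal (c / (real (Suc k))\<^sup>2)"
  proof (rule ennreal_leI)
    have "F t - F 0 \<le> 4 * c / \<beta>" using \<beta> that by (simp add: F_def)
    also have "\<dots> \<le> c / (real (Suc k))\<^sup>2"
    proof -
      have "1 \<le> pi\<^sup>2" using pi_gt3 by (intro one_le_power) simp
      then have "4 * (real (Suc k))\<^sup>2 \<le> \<beta>" unfolding \<beta>_def by (intro mult_right_mono) auto
      then have "c * (4 * (real (Suc k))\<^sup>2) \<le> c * \<beta>" by (rule mult_left_mono) fact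
      then show ?thesis using \<beta> by (simp add: field_simps del: of_nat_Suc)
    qed
    finally show "F t - F 0 \<le> c / (real (Suc k))\<^sup>2" .
  qed
  finally show ?thesis .
qed simp

text \<open>Tonelli reduces the square to time slices, to which
  \<open>nn_integral_square_series\<close> applies; nonnegativity then lets the time integral act
  term by term.\<close>

lemma heat_field_square:
  assumes Z: "\<And>k. cmod (Z k) \<le> 2"
  shows "(\<integral>\<^sup>+ z. ennreal ((heat_field 0 t Z z)\<^sup>2) * indicator st_dom z \<partial>lborel)
    \<le> (\<Sum>k. ennreal ((cmod (Z k))\<^sup>2 / (real (Suc k))\<^sup>2))"
proof -
  have mst [measurable]: "st_dom \<in> sets borel" unfolding st_dom_def borel_prod[symmetric] by simp
  have "(\<integral>\<^sup>+ z. ennreal ((heat_field 0 t Z z)\<^sup>2) * indicator st_dom z \<partial>lborel)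
     = (\<integral>\<^sup>+ s. \<integral>\<^sup>+ y. ennreal ((heat_field 0 t Z (s, y))\<^sup>2) * indicator st_dom (s, y) \<partial>lborel \<partial>lborel)"
    unfolding lborel_prod[symmetric]
    by (rule lborel.nn_integral_fst[symmetric]) (simp add: lborel_prod)
  also have "\<dots> \<le> (\<integral>\<^sup>+ s. (\<Sum>k. ennreal ((heat_coef (t - s) k)\<^sup>2 * (cmod (Z k))\<^sup>2) * indicator {0..t} s) \<partial>lborel)"
  proof (intro nn_integral_mono)
    fix s
    show "(\<integral>\<^sup>+ y. ennreal ((heat_field 0 t Z (s, y))\<^sup>2) * indicator st_dom (s, y) \<partial>lborel)
      \<le> (\<Sum>k. ennreal ((heat_coef (t - s) k)\<^sup>2 * (cmod (Z k))\<^sup>2) * indicator {0..t} s)"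
    proof (cases "0 \<le> s \<and> s < t")
      case True
      have "(\<integral>\<^sup>+ y. ennreal ((heat_field 0 t Z (s, y))\<^sup>2) * indicator st_dom (s, y) \<partial>lborel)
         = (\<integral>\<^sup>+ y. ennreal ((\<Sum>k. heat_coef (t - s) k * fourier_mode Z k y)\<^sup>2) * indicator {0..1} y \<partial>lborel)"
        using True by (intro nn_integral_cong) (auto simp: heat_field_def heat_series_def st_dom_def indicator_def)
      also have "\<dots> \<le> (\<Sum>k. ennreal ((heat_coef (t - s) k)\<^sup>2 * (cmod (Z k))\<^sup>2))"
        by (rule nn_integral_square_series) (rule heat_series_summable(2)[OF _ Z], use True in simp)
      finally show ?thesis using True by simp
    next
      case False
      then have "(\<integral>\<^sup>+ y. ennreal ((heat_field 0 t Z (s, y))\<^sup>2) * indicator st_dom (s, y) \<partial>lborel) = (\<integral>\<^sup>+ y. 0 \<partial>(lborel :: real measure))"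
        by (intro nn_integral_cong) (auto simp: heat_field_def st_dom_def indicator_def)
      then show ?thesis by simp
    qed
  qed
  also have "\<dots> = (\<Sum>k. \<integral>\<^sup>+ s. ennreal ((heat_coef (t - s) k)\<^sup>2 * (cmod (Z k))\<^sup>2) * indicator {0..t} s \<partial>lborel)"
    by (rule nn_integral_suminf) (simp add: heat_coef_def)
  also have "\<dots> \<le> (\<Sum>k. ennreal ((cmod (Z k))\<^sup>2 / (real (Suc k))\<^sup>2))"
    by (intro suminf_le nn_integral_heat_coef) auto
  finally show ?thesis .
qed

text \<open>The oscillating part integrates to zero over the circle, so the projection removes the
  constant and nothing else.\<close>

lemma spatial_proj_heat_field:
  assumes Z: "\<And>k. cmod (Z k) \<le> 2"
  shows "spatial_proj (heat_field c t Z) = heat_field 0 t Z"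
proof
  fix z :: "real \<times> real"
  obtain s y where z: "z = (s, y)" by (cases z)
  show "spatial_proj (heat_field c t Z) z = heat_field 0 t Z z"
  proof (cases "s < t")
    case True
    have "(LINT y:{0..1}|lborel. c + heat_series Z (t - s) y) = (LINT y:{0..1::real}|lborel. c) + (LINT y:{0..1}|lborel. heat_series Z (t - s) y)"
      by (rule set_integral_add(2)) (use heat_series_integral(1)[OF _ Z, of "t - s"] True in \<open>auto simp: set_integrable_def\<close>)
    also have "\<dots> = c" using heat_series_integral(2)[OF _ Z, of "t - s"] True by (simp add: set_lebesgue_integral_def)
    finally show ?thesis using True by (simp add: z spatial_proj_def heat_field_def)
  next
    case False
    then show ?thesis by (simp add: z spatial_proj_def heat_field_def set_lebesgue_integral_def)
  qed
qed

text \<open>Square integrability concerns the unprojected field, whose constant part is supported on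
  times in [0, t) and has finite norm there; the variance involves only the projected field.\<close>

lemma heat_field_variance:
  assumes Z: "\<And>k. cmod (Z k) \<le> 2" and S: "summable (\<lambda>k. (cmod (Z k))\<^sup>2 / (real (Suc k))\<^sup>2)"
  shows "sq_int (heat_field c t Z)"
    and "(LINT z:st_dom|lborel. (spatial_proj (heat_field c t Z) z)\<^sup>2) \<le> (\<Sum>k. (cmod (Z k))\<^sup>2 / (real (Suc k))\<^sup>2)"
proof -
  let ?S = "\<Sum>k. (cmod (Z k))\<^sup>2 / (real (Suc k))\<^sup>2"
  have mst [measurable]: "st_dom \<in> sets borel" unfolding st_dom_def borel_prod[symmetric] by simp
  have D: "(\<integral>\<^sup>+ z. ennreal ((heat_field 0 t Z z)\<^sup>2) * indicator st_dom z \<partial>lborel) \<le> ennreal ?S"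
  proof -
    have "(\<Sum>k. ennreal ((cmod (Z k))\<^sup>2 / (real (Suc k))\<^sup>2)) = ennreal ?S"
      by (rule suminf_ennreal2[OF _ S]) simp
    then show ?thesis using heat_field_square[of Z t, OF Z] by (simp only:)
  qed
  have S0: "0 \<le> ?S" by (rule suminf_nonneg[OF S]) simp
  have nn: "(\<integral>\<^sup>+ z. ennreal (norm (indicator st_dom z *\<^sub>R (heat_field c t Z z)\<^sup>2)) \<partial>lborel) = (\<integral>\<^sup>+ z. ennreal ((heat_field c t Z z)\<^sup>2) * indicator st_dom z \<partial>lborel)" for c
    by (intro nn_integral_cong) (auto simp: indicator_def)
  have "(\<integral>\<^sup>+ z. ennreal ((heat_field c t Z z)\<^sup>2) * indicator st_dom z \<partial>lborel)
     \<le> (\<integral>\<^sup>+ z. (ennreal (2 * c\<^sup>2) * indicator ({0..\<bar>t\<bar>} \<times> {0..1}) z + 2 * (ennreal ((heat_field 0 t Z z)\<^sup>2) * indicator st_dom z)) \<partial>lborel)"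
  proof (intro nn_integral_mono)
    fix z :: "real \<times> real"
    obtain s y where z: "z = (s, y)" by (cases z)
    show "ennreal ((heat_field c t Z z)\<^sup>2) * indicator st_dom z
       \<le> ennreal (2 * c\<^sup>2) * indicator ({0..\<bar>t\<bar>} \<times> {0..1}) z + 2 * (ennreal ((heat_field 0 t Z z)\<^sup>2) * indicator st_dom z)"
    proof (cases "z \<in> st_dom \<and> s < t")
      case True
      have "(c + d)\<^sup>2 \<le> 2 * c\<^sup>2 + 2 * d\<^sup>2" for d :: real
        using sum_squares_bound[of c d] by (simp add: power2_sum)
      then have "ennreal ((heat_field c t Z z)\<^sup>2) \<le> ennreal (2 * c\<^sup>2 + 2 * (heat_field 0 t Z z)\<^sup>2)"
        using True by (intro ennreal_leI) (simp add: z heat_field_def)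
      also have "\<dots> = ennreal (2 * c\<^sup>2) + 2 * ennreal ((heat_field 0 t Z z)\<^sup>2)"
        by (simp add: ennreal_plus ennreal_mult)
      finally show ?thesis using True by (simp add: z st_dom_def indicator_def)
    qed (auto simp: z heat_field_def indicator_def)
  qed
  also have "\<dots> = ennreal (2 * c\<^sup>2) * emeasure lborel ({0..\<bar>t\<bar>} \<times> {0..1::real}) + 2 * (\<integral>\<^sup>+ z. ennreal ((heat_field 0 t Z z)\<^sup>2) * indicator st_dom z \<partial>lborel)"
  proof -
    have [measurable]: "{0..\<bar>t\<bar>} \<times> {0..1::real} \<in> sets borel" unfolding borel_prod[symmetric] by simp
    show ?thesis by (subst nn_integral_add) (auto simp: nn_integral_cmult)
  qed
  also have "\<dots> < \<infinity>"
  proof -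
    have "emeasure lborel ({0..\<bar>t\<bar>} \<times> {0..1::real}) = ennreal \<bar>t\<bar>"
      unfolding lborel_prod[symmetric] by (subst lborel.emeasure_pair_measure_Times) auto
    then show ?thesis using le_less_trans[OF D, of \<infinity>] by (auto simp: ennreal_mult_less_top ennreal_add_less_top)
  qed
  finally have fin: "(\<integral>\<^sup>+ z. ennreal ((heat_field c t Z z)\<^sup>2) * indicator st_dom z \<partial>lborel) < \<infinity>" .
  show "sq_int (heat_field c t Z)"
    unfolding sq_int_def set_integrable_def
  proof (intro conjI integrableI_bounded heat_field_measurable)
    show "(\<lambda>z. indicator st_dom z *\<^sub>R (heat_field c t Z z)\<^sup>2) \<in> borel_measurable lborel" by measurable
    show "(\<integral>\<^sup>+ z. ennreal (norm (indicator st_dom z *\<^sub>R (heat_field c t Z z)\<^sup>2)) \<partial>lborel) < \<infinity>"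
      unfolding nn by (rule fin)
  qed
  show "(LINT z:st_dom|lborel. (spatial_proj (heat_field c t Z) z)\<^sup>2) \<le> ?S"
    unfolding spatial_proj_heat_field[OF Z] set_lebesgue_integral_def
  proof (subst integral_eq_nn_integral)
    show "enn2real (\<integral>\<^sup>+ z. ennreal (indicator st_dom z *\<^sub>R (heat_field 0 t Z z)\<^sup>2) \<partial>lborel) \<le> ?S"
      using D S0 nn[of 0] by (intro enn2real_leI) (auto simp: indicator_def)
  qed auto
qed

lemma heat_field_kernel:
  "(\<lambda>(s, y). if s < t then heat_kernel (t - s) (x - y) else 0) = heat_field 1 t (\<lambda>k. cis (2 * pi * real (Suc k) * x))"
  unfolding heat_field_def heat_kernel_series ..

text \<open>Written with the scalars 1 and -1 to fit the linearity clause of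
  \<open>mean_free_white_noise\<close>; the constant parts cancel.\<close>

lemma heat_field_diff:
  assumes Z: "\<And>k. cmod (Z k) \<le> 1" and W: "\<And>k. cmod (W k) \<le> 1"
  shows "(\<lambda>z. 1 * heat_field 1 t Z z + (-1) * heat_field 1 t W z) = heat_field 0 t (\<lambda>k. Z k - W k)"
proof
  fix z :: "real \<times> real"
  obtain s y where z: "z = (s, y)" by (cases z)
  show "1 * heat_field 1 t Z z + (-1) * heat_field 1 t W z = heat_field 0 t (\<lambda>k. Z k - W k) z"
  proof (cases "s < t")
    case True
    have "heat_series Z (t - s) y - heat_series W (t - s) y = (\<Sum>k. heat_coef (t - s) k * fourier_mode Z k y - heat_coef (t - s) k * fourier_mode W k y)"
      unfolding heat_series_def using True order_trans[OF Z] order_trans[OF W]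
      by (intro suminf_diff heat_series_summable(2)) auto
    also have "\<dots> = heat_series (\<lambda>k. Z k - W k) (t - s) y"
      unfolding heat_series_def fourier_mode_def by (simp add: algebra_simps)
    finally show ?thesis using True by (simp add: z heat_field_def)
  qed (simp add: z heat_field_def)
qed

lemma cmod_cis_diff: "cmod (cis a - cis b) \<le> \<bar>a - b\<bar>"
proof -
  have "(cmod (cis a - cis b))\<^sup>2 = 2 - 2 * cos (a - b)"
    using sin_cos_squared_add[of a] sin_cos_squared_add[of b]
    unfolding cmod_power2 cos_diff by (simp add: power2_eq_square algebra_simps)
  also have "\<dots> = (2 * sin ((a - b) / 2))\<^sup>2"
  proof -
    have "2 * ((a - b) / 2) = a - b" by simp
    from cos_double_sin[of "(a - b) / 2", unfolded this] show ?thesis by (simp add: power_mult_distrib)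
  qed
  finally have "(cmod (cis a - cis b))\<^sup>2 = \<bar>2 * sin ((a - b) / 2)\<bar>\<^sup>2" by simp
  then have "cmod (cis a - cis b) = \<bar>2 * sin ((a - b) / 2)\<bar>" by (rule power2_eq_imp_eq) auto
  also have "\<dots> \<le> \<bar>a - b\<bar>" using abs_sin_x_le_abs_x[of "(a - b) / 2"] by simp
  finally show ?thesis .
qed

lemma summable_Suc_powr: "summable (\<lambda>k. real (Suc k) powr (-3/2))" "summable (\<lambda>k. 1 / (real (Suc k))\<^sup>2)"
proof -
  have "summable (\<lambda>k. real k powr (-3/2))" by (simp add: summable_real_powr_iff)
  then show "summable (\<lambda>k. real (Suc k) powr (-3/2))" by (rule summable_Suc_iff[THEN iffD2])
  show "summable (\<lambda>k. 1 / (real (Suc k))\<^sup>2)"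
  proof -
    have "summable (\<lambda>k. 1 / (real k)\<^sup>2)" using inverse_power_summable[of 2, where 'a=real] by (simp add: divide_inverse)
    then show ?thesis by (rule summable_Suc_iff[THEN iffD2])
  qed
qed

section \<open>Moments of the stochastic heat equation\<close>

definition circle_mode :: "real \<Rightarrow> nat \<Rightarrow> complex" where
  "circle_mode x k = cis (2 * pi * real (Suc k) * x)"

text \<open>Interpolation between the trivial bound 2 and the Lipschitz bound d, which together give
  X^2 <= 4 sqrt d. The square root costs (k+1)^(1/2), which leaves the summable power -3/2 and a
  variance of order |x - y|^(1/2).\<close>

lemma cmod_circle_mode_diff:
  "(cmod (circle_mode x k - circle_mode y k))\<^sup>2 / (real (Suc k))\<^sup>2
     \<le> 4 * sqrt (2 * pi) * sqrt \<bar>x - y\<bar> * real (Suc k) powr (-3/2)"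
proof -
  define X where "X = cmod (circle_mode x k - circle_mode y k)"
  define d where "d = 2 * pi * real (Suc k) * \<bar>x - y\<bar>"
  have d: "0 \<le> d" by (simp add: d_def)
  have X0: "0 \<le> X" by (simp add: X_def)
  have "X \<le> 2" unfolding X_def circle_mode_def
    using norm_triangle_ineq4[of "cis (2 * pi * real (Suc k) * x)" "cis (2 * pi * real (Suc k) * y)"] by simp
  moreover have "X \<le> d"
  proof -
    have "2 * pi * real (Suc k) * x - 2 * pi * real (Suc k) * y = 2 * pi * real (Suc k) * (x - y)" by (simp only: right_diff_distrib)
    then show ?thesis
      using cmod_cis_diff[of "2 * pi * real (Suc k) * x" "2 * pi * real (Suc k) * y"]
      unfolding X_def d_def circle_mode_def by (simp add: abs_mult del: of_nat_Suc)
  qed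
  ultimately have "X\<^sup>2 \<le> 4 * sqrt d"
  proof (cases "d \<le> 1")
    case True
    have "X\<^sup>2 \<le> d\<^sup>2" using X0 \<open>X \<le> d\<close> by (intro power_mono)
    also have "d\<^sup>2 \<le> d" using True d by (simp add: power2_eq_square mult_left_le)
    also have "d \<le> sqrt d" using True d by (intro real_le_rsqrt) (simp add: power2_eq_square mult_left_le)
    also have "\<dots> \<le> 4 * sqrt d" using d by simp
    finally show ?thesis .
  next
    case False
    have "X\<^sup>2 \<le> 2\<^sup>2" using X0 \<open>X \<le> 2\<close> by (intro power_mono)
    also have "\<dots> \<le> 4 * sqrt d" using False by simp
    finally show ?thesis .
  qed
  then have "X\<^sup>2 / (real (Suc k))\<^sup>2 \<le> 4 * sqrt d / (real (Suc k))\<^sup>2" by (rule divide_right_mono) simp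
  also have "4 * sqrt d / (real (Suc k))\<^sup>2 = 4 * sqrt (2 * pi) * sqrt \<bar>x - y\<bar> * (sqrt (real (Suc k)) / (real (Suc k))\<^sup>2)"
    by (simp add: d_def real_sqrt_mult del: of_nat_Suc)
  also have "sqrt (real (Suc k)) / (real (Suc k))\<^sup>2 = real (Suc k) powr (-3/2)"
  proof -
    have "sqrt (real (Suc k)) / (real (Suc k))\<^sup>2 = real (Suc k) powr (1/2) / real (Suc k) powr 2"
      by (simp add: powr_half_sqrt del: of_nat_Suc)
    also have "\<dots> = real (Suc k) powr (1/2 - 2)" by (simp only: powr_diff)
    finally show ?thesis by simp
  qed
  finally show ?thesis unfolding X_def .
qed

text \<open>Values and increments at one time are Gaussian with variances at most c1 and c2 |x -
  y|^(1/2), independently of t; the moment of order 2 j is a multiple of the j-th power of the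
  variance.\<close>

lemma stoch_heat_moments:
  assumes \<xi>: "mean_free_white_noise M \<xi>" and v: "stoch_heat M \<xi> v"
  shows "\<exists>C\<ge>0. \<forall>t\<ge>0. \<forall>x y. (\<integral>\<^sup>+ \<omega>. ennreal (v \<omega> t x ^ (2 * j)) \<partial>M) \<le> ennreal C \<and>
     (\<integral>\<^sup>+ \<omega>. ennreal ((v \<omega> t x - v \<omega> t y) ^ (2 * j)) \<partial>M) \<le> ennreal (C * sqrt \<bar>x - y\<bar> ^ j)"
proof -
  define c1 where "c1 = (\<Sum>k. 1 / (real (Suc k))\<^sup>2)"
  define c2 where "c2 = (\<Sum>k. 4 * sqrt (2 * pi) * real (Suc k) powr (-3/2))"
  define g where "g = (fact (2 * j) / (2 ^ j * fact j) :: real)"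
  have g: "0 \<le> g" by (simp add: g_def)
  have c1: "0 \<le> c1" unfolding c1_def by (rule suminf_nonneg[OF summable_Suc_powr(2)]) simp
  have s2: "summable (\<lambda>k. 4 * sqrt (2 * pi) * real (Suc k) powr (-3/2))"
    by (rule summable_mult[OF summable_Suc_powr(1)])
  have c2: "0 \<le> c2" unfolding c2_def by (rule suminf_nonneg[OF s2]) simp
  have prob: "prob_space M" using \<xi> by (simp add: mean_free_white_noise_def)
  have gauss: "(\<integral>\<^sup>+ \<omega>. ennreal (\<xi> \<omega> \<phi> ^ (2 * j)) \<partial>M) \<le> ennreal (g * S ^ j)"
    if \<phi>: "sq_int \<phi>" "(LINT z:st_dom|lborel. (spatial_proj \<phi> z)\<^sup>2) \<le> S" for \<phi> S
  proof -
    have nn: "0 \<le> (LINT z:st_dom|lborel. (spatial_proj \<phi> z)\<^sup>2)"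
      unfolding set_lebesgue_integral_def by (rule Bochner_Integration.integral_nonneg) (simp add: indicator_def)
    have "centered_gaussian M (\<lambda>\<omega>. \<xi> \<omega> \<phi>) (LINT z:st_dom|lborel. (spatial_proj \<phi> z)\<^sup>2)"
      using \<xi> \<phi>(1) by (simp add: mean_free_white_noise_def)
    from gaussian_even_moment[OF prob this nn, of j]
    have "(\<integral>\<^sup>+ \<omega>. ennreal (\<xi> \<omega> \<phi> ^ (2 * j)) \<partial>M) \<le> ennreal (g * (LINT z:st_dom|lborel. (spatial_proj \<phi> z)\<^sup>2) ^ j)"
      by (simp add: g_def)
    also have "\<dots> \<le> ennreal (g * S ^ j)"
      using \<phi>(2) nn g by (intro ennreal_leI mult_left_mono power_mono)
    finally show ?thesis .
  qed
  have n1: "cmod (circle_mode x k) = 1" for x k by (simp add: circle_mode_def)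
  have sq1: "sq_int (heat_field 1 t (circle_mode x))"
    and var1: "(LINT z:st_dom|lborel. (spatial_proj (heat_field 1 t (circle_mode x)) z)\<^sup>2) \<le> c1" for t x
  proof -
    have b: "cmod (circle_mode x k) \<le> 2" for k by (simp add: n1)
    have s: "summable (\<lambda>k. (cmod (circle_mode x k))\<^sup>2 / (real (Suc k))\<^sup>2)"
      using summable_Suc_powr(2) by (simp add: n1)
    show "sq_int (heat_field 1 t (circle_mode x))"
      by (rule heat_field_variance(1)) (use b s in auto)
    show "(LINT z:st_dom|lborel. (spatial_proj (heat_field 1 t (circle_mode x)) z)\<^sup>2) \<le> c1"
      using heat_field_variance(2)[of "circle_mode x" 1 t, OF b s] by (simp add: n1 c1_def)
  qed
  have sq2: "sq_int (heat_field 0 t (\<lambda>k. circle_mode x k - circle_mode y k))"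
    and var2: "(LINT z:st_dom|lborel. (spatial_proj (heat_field 0 t (\<lambda>k. circle_mode x k - circle_mode y k)) z)\<^sup>2) \<le> c2 * sqrt \<bar>x - y\<bar>" for t x y
  proof -
    let ?Z = "\<lambda>k. circle_mode x k - circle_mode y k"
    have b: "cmod (?Z k) \<le> 2" for k using norm_triangle_ineq4[of "circle_mode x k" "circle_mode y k"] by (simp add: n1)
    have le: "(cmod (?Z k))\<^sup>2 / (real (Suc k))\<^sup>2 \<le> 4 * sqrt (2 * pi) * real (Suc k) powr (-3/2) * sqrt \<bar>x - y\<bar>" for k
      using cmod_circle_mode_diff[of x k y] by (simp only: ac_simps)
    have s2': "summable (\<lambda>k. 4 * sqrt (2 * pi) * real (Suc k) powr (-3/2) * sqrt \<bar>x - y\<bar>)"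
      by (rule summable_mult2[OF s2])
    have s: "summable (\<lambda>k. (cmod (?Z k))\<^sup>2 / (real (Suc k))\<^sup>2)"
      by (rule summable_comparison_test'[OF s2', of 0]) (use le in \<open>simp del: of_nat_Suc\<close>)
    show "sq_int (heat_field 0 t ?Z)"
      by (rule heat_field_variance(1)) (use b s in auto)
    have "(LINT z:st_dom|lborel. (spatial_proj (heat_field 0 t ?Z) z)\<^sup>2) \<le> (\<Sum>k. (cmod (?Z k))\<^sup>2 / (real (Suc k))\<^sup>2)"
      by (rule heat_field_variance(2)) (use b s in auto)
    also have "\<dots> \<le> (\<Sum>k. 4 * sqrt (2 * pi) * real (Suc k) powr (-3/2) * sqrt \<bar>x - y\<bar>)"
      by (rule suminf_le[OF le s s2'])
    also have "\<dots> = c2 * sqrt \<bar>x - y\<bar>" unfolding c2_def by (rule suminf_mult2[OF s2, symmetric])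
    finally show "(LINT z:st_dom|lborel. (spatial_proj (heat_field 0 t ?Z) z)\<^sup>2) \<le> c2 * sqrt \<bar>x - y\<bar>" .
  qed
  have vx: "AE \<omega> in M. v \<omega> t x = \<xi> \<omega> (heat_field 1 t (circle_mode x))" if "t \<ge> 0" for t x
    using v that unfolding stoch_heat_def heat_field_kernel circle_mode_def[abs_def] by blast
  define C where "C = g * (c1 ^ j + c2 ^ j)"
  show ?thesis
  proof (intro exI[of _ C] conjI allI impI)
    show "0 \<le> C" using g c1 c2 by (simp add: C_def)
    fix t x y :: real assume t: "0 \<le> t"
    have "(\<integral>\<^sup>+ \<omega>. ennreal (v \<omega> t x ^ (2 * j)) \<partial>M) = (\<integral>\<^sup>+ \<omega>. ennreal (\<xi> \<omega> (heat_field 1 t (circle_mode x)) ^ (2 * j)) \<partial>M)"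
      using vx[OF t, of x] by (intro nn_integral_cong_AE) auto
    also have "\<dots> \<le> ennreal (g * c1 ^ j)" by (rule gauss[OF sq1 var1])
    also have "\<dots> \<le> ennreal C" using g c2 by (intro ennreal_leI) (simp add: C_def distrib_left)
    finally show "(\<integral>\<^sup>+ \<omega>. ennreal (v \<omega> t x ^ (2 * j)) \<partial>M) \<le> ennreal C" .
    have lin: "AE \<omega> in M. \<xi> \<omega> (\<lambda>z. 1 * heat_field 1 t (circle_mode x) z + (-1) * heat_field 1 t (circle_mode y) z)
        = 1 * \<xi> \<omega> (heat_field 1 t (circle_mode x)) + (-1) * \<xi> \<omega> (heat_field 1 t (circle_mode y))"
      using \<xi> sq1[of t x] sq1[of t y] unfolding mean_free_white_noise_def by blast
    have "(\<integral>\<^sup>+ \<omega>. ennreal ((v \<omega> t x - v \<omega> t y) ^ (2 * j)) \<partial>M)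
       = (\<integral>\<^sup>+ \<omega>. ennreal (\<xi> \<omega> (heat_field 0 t (\<lambda>k. circle_mode x k - circle_mode y k)) ^ (2 * j)) \<partial>M)"
    proof (rule nn_integral_cong_AE)
      have e: "(\<lambda>z. 1 * heat_field 1 t (circle_mode x) z + (-1) * heat_field 1 t (circle_mode y) z) = heat_field 0 t (\<lambda>k. circle_mode x k - circle_mode y k)"
        by (rule heat_field_diff) (simp_all add: n1)
      show "AE \<omega> in M. ennreal ((v \<omega> t x - v \<omega> t y) ^ (2 * j)) = ennreal (\<xi> \<omega> (heat_field 0 t (\<lambda>k. circle_mode x k - circle_mode y k)) ^ (2 * j))"
        using vx[OF t, of x] vx[OF t, of y] lin unfolding e by eventually_elim simp
    qed
    also have "\<dots> \<le> ennreal (g * (c2 * sqrt \<bar>x - y\<bar>) ^ j)" by (rule gauss[OF sq2 var2])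
    also have "\<dots> \<le> ennreal (C * sqrt \<bar>x - y\<bar> ^ j)"
      using g c1 by (intro ennreal_leI) (simp add: C_def power_mult_distrib distrib_left distrib_right mult.assoc)
    finally show "(\<integral>\<^sup>+ \<omega>. ennreal ((v \<omega> t x - v \<omega> t y) ^ (2 * j)) \<partial>M) \<le> ennreal (C * sqrt \<bar>x - y\<bar> ^ j)" .
  qed
qed

section \<open>A measurable version of the stochastic heat field\<close>

lemma ceiling_grid_tendsto: "(\<lambda>n. of_int \<lceil>real (Suc n) * x\<rceil> / real (Suc n)) \<longlonglongrightarrow> x"
proof (rule tendsto_sandwich)
  show "(\<lambda>_. x) \<longlonglongrightarrow> x" by simp
  have "(\<lambda>n. x + 1 / real (Suc n)) \<longlonglongrightarrow> x + 0"
    by (intro tendsto_add tendsto_const LIMSEQ_inverse_real_of_nat[unfolded inverse_eq_divide])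
  then show "(\<lambda>n. x + 1 / real (Suc n)) \<longlonglongrightarrow> x" by simp
  have "real (Suc n) * x \<le> of_int \<lceil>real (Suc n) * x\<rceil>" for n by linarith
  then have "real (Suc n) * x / real (Suc n) \<le> of_int \<lceil>real (Suc n) * x\<rceil> / real (Suc n)" for n by (rule divide_right_mono) simp
  then show "eventually (\<lambda>n. x \<le> of_int \<lceil>real (Suc n) * x\<rceil> / real (Suc n)) sequentially" by simp
  have "of_int \<lceil>real (Suc n) * x\<rceil> \<le> real (Suc n) * x + 1" for n by linarith
  then have "of_int \<lceil>real (Suc n) * x\<rceil> / real (Suc n) \<le> (real (Suc n) * x + 1) / real (Suc n)" for n by (rule divide_right_mono) simp
  then show "eventually (\<lambda>n. of_int \<lceil>real (Suc n) * x\<rceil> / real (Suc n) \<le> x + 1 / real (Suc n)) sequentially"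
    by (simp add: add_divide_distrib del: of_nat_Suc)
qed

lemma ceiling_grid_nonneg:
  assumes "0 \<le> x"
  shows "0 \<le> of_int \<lceil>real (Suc n) * x\<rceil> / real (Suc n)"
  by (intro divide_nonneg_nonneg order_trans[OF _ le_of_int_ceiling] mult_nonneg_nonneg) (use assms in auto)

lemma continuous_on_sequence:
  assumes "continuous_on ({0..} \<times> UNIV) (\<lambda>(t, x). f t x)" "a \<longlonglongrightarrow> t" "b \<longlonglongrightarrow> x" "\<And>n. 0 \<le> a n" "0 \<le> (t::real)"
  shows "(\<lambda>n. f (a n) (b n :: real)) \<longlonglongrightarrow> (f t x :: real)"
proof -
  have "((\<lambda>n. (\<lambda>(t, x). f t x) (a n, b n)) \<longlongrightarrow> (\<lambda>(t, x). f t x) (t, x)) sequentially"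
    by (rule continuous_on_tendsto_compose[OF assms(1)]) (use assms in \<open>auto intro!: tendsto_Pair\<close>)
  then show ?thesis by simp
qed

text \<open>The field v is tied to the noise only almost surely at each point, hence need not be measurable;
  continuity allows a measurable modification off a single null set.\<close>

lemma stoch_heat_version:
  assumes \<xi>: "mean_free_white_noise M \<xi>" and v: "stoch_heat M \<xi> v"
  obtains v' where "AE \<omega> in M. v' \<omega> = v \<omega>"
    "\<And>t x. 0 \<le> t \<Longrightarrow> (\<lambda>\<omega>. v' \<omega> t x) \<in> borel_measurable M"
    "\<And>x. (\<lambda>(\<omega>, s). v' \<omega> (max s 0) x) \<in> borel_measurable (M \<Otimes>\<^sub>M lborel)"
proof -
  define \<phi> where "\<phi> = (\<lambda>t x. heat_field 1 t (circle_mode x))"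
  define D where "D = (\<rat> \<inter> {0::real..}) \<times> (\<rat> :: real set)"
  have cD: "countable D" unfolding D_def by (intro countable_SIGMA countable_Int1 countable_rat)
  have vc: "continuous_on ({0..} \<times> UNIV) (\<lambda>(t, x). v \<omega> t x)" for \<omega> using v by (simp add: stoch_heat_def)
  \<comment> \<open>Rational space-time points are countable, so one exceptional null set serves all
    of them; continuity then carries measurability to the remaining points.\<close>
  have "AE \<omega> in M. \<forall>d\<in>D. v \<omega> (fst d) (snd d) = \<xi> \<omega> (\<phi> (fst d) (snd d))"
  proof (subst AE_ball_countable[OF cD], intro ballI)
    fix d assume "d \<in> D"
    then show "AE \<omega> in M. v \<omega> (fst d) (snd d) = \<xi> \<omega> (\<phi> (fst d) (snd d))"
      using v unfolding stoch_heat_def heat_field_kernel \<phi>_def circle_mode_def[abs_def] D_def by auto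
  qed
  then obtain N where N: "{\<omega> \<in> space M. \<not> (\<forall>d\<in>D. v \<omega> (fst d) (snd d) = \<xi> \<omega> (\<phi> (fst d) (snd d)))} \<subseteq> N" "N \<in> null_sets M"
    by (auto elim!: AE_E intro: that null_setsI)
  define v' where "v' = (\<lambda>\<omega>. if \<omega> \<in> N then (\<lambda>_ _. 0) else v \<omega>)"
  have Ns [measurable]: "N \<in> sets M" using N(2) by auto
  have v'c: "continuous_on ({0..} \<times> UNIV) (\<lambda>(t, x). v' \<omega> t x)" for \<omega>
    using vc[of \<omega>] by (auto simp: v'_def split_beta)
  have \<phi>m: "(\<lambda>\<omega>. \<xi> \<omega> (\<phi> t x)) \<in> borel_measurable M" for t x
  proof -
    have "sq_int (\<phi> t x)" unfolding \<phi>_def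
      by (rule heat_field_variance(1)) (use summable_Suc_powr(2) in \<open>simp_all add: circle_mode_def\<close>)
    then show ?thesis using \<xi> unfolding mean_free_white_noise_def centered_gaussian_def by blast
  qed
  have rat: "(\<lambda>\<omega>. v' \<omega> t x) \<in> borel_measurable M" if "(t, x) \<in> D" for t x
  proof -
    have "v' \<omega> t x = (if \<omega> \<in> N then 0 else \<xi> \<omega> (\<phi> t x))" if "\<omega> \<in> space M" for \<omega>
    proof (cases "\<omega> \<in> N")
      case False
      then have "\<forall>d\<in>D. v \<omega> (fst d) (snd d) = \<xi> \<omega> (\<phi> (fst d) (snd d))" using N(1) that by blast
      from bspec[OF this \<open>(t, x) \<in> D\<close>] show ?thesis using False by (simp add: v'_def)
    qed (simp add: v'_def)
    moreover have "(\<lambda>\<omega>. if \<omega> \<in> N then 0 else \<xi> \<omega> (\<phi> t x)) \<in> borel_measurable M"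
      using \<phi>m[of t x] by measurable
    ultimately show ?thesis by (subst measurable_cong) auto
  qed
  have mt: "(\<lambda>\<omega>. v' \<omega> t x) \<in> borel_measurable M" if "0 \<le> t" for t x
  proof (rule borel_measurable_LIMSEQ_real)
    let ?a = "\<lambda>y n. of_int \<lceil>real (Suc n) * y\<rceil> / real (Suc n) :: real"
    have a0: "0 \<le> ?a t n" for n by (rule ceiling_grid_nonneg[OF that])
    show "(\<lambda>n. v' \<omega> (?a t n) (?a x n)) \<longlonglongrightarrow> v' \<omega> t x" for \<omega>
      by (rule continuous_on_sequence[OF v'c ceiling_grid_tendsto ceiling_grid_tendsto]) (use a0 that in auto)
    show "(\<lambda>\<omega>. v' \<omega> (?a t n) (?a x n)) \<in> borel_measurable M" for n
      by (rule rat) (use a0 in \<open>auto simp: D_def\<close>)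
  qed
  have joint: "(\<lambda>(\<omega>, s). v' \<omega> (max s 0) x) \<in> borel_measurable (M \<Otimes>\<^sub>M lborel)" for x
  proof (rule borel_measurable_LIMSEQ_real)
    \<comment> \<open>Rounding time up to a grid makes it take countably many values, for each of
      which measurability in \<omega> alone is known.\<close>
    define h where "h = (\<lambda>n (p :: 'a \<times> real). v' (fst p) (real (nat \<lceil>real (Suc n) * max (snd p) 0\<rceil>) / real (Suc n)) x)"
    show "h n \<in> borel_measurable (M \<Otimes>\<^sub>M lborel)" for n
    proof -
      have "(\<lambda>p. (\<lambda>i p. v' (fst p) (real i / real (Suc n)) x) (nat \<lceil>real (Suc n) * max (snd p) 0\<rceil>) p) \<in> borel_measurable (M \<Otimes>\<^sub>M lborel)"
      proof (rule measurable_compose_countable[where f = "\<lambda>i p. v' (fst p) (real i / real (Suc n)) x"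
            and g = "\<lambda>p. nat \<lceil>real (Suc n) * max (snd p) 0\<rceil>"])
        show "(\<lambda>p. v' (fst p) (real i / real (Suc n)) x) \<in> borel_measurable (M \<Otimes>\<^sub>M lborel)" for i
          by (rule measurable_compose[OF measurable_fst mt]) simp
        show "(\<lambda>p. nat \<lceil>real (Suc n) * max (snd p) 0\<rceil>) \<in> measurable (M \<Otimes>\<^sub>M lborel) (count_space UNIV)"
          by measurable
      qed
      then show ?thesis by (simp add: h_def)
    qed
    show "(\<lambda>n. h n p) \<longlonglongrightarrow> (case p of (\<omega>, s) \<Rightarrow> v' \<omega> (max s 0) x)" for p
    proof -
      define s where "s = max (snd p) 0"
      have "(\<lambda>n. v' (fst p) (of_int \<lceil>real (Suc n) * s\<rceil> / real (Suc n)) x) \<longlonglongrightarrow> v' (fst p) s x"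
        by (rule continuous_on_sequence[OF v'c ceiling_grid_tendsto tendsto_const ceiling_grid_nonneg]) (simp_all add: s_def)
      moreover have "real (nat \<lceil>real (Suc n) * s\<rceil>) = of_int \<lceil>real (Suc n) * s\<rceil>" for n
        by (rule of_nat_nat) (simp add: s_def ceiling_mono[of 0, simplified])
      ultimately show ?thesis by (simp add: h_def s_def split_beta)
    qed
  qed
  have ae: "AE \<omega> in M. v' \<omega> = v \<omega>"
    using AE_not_in[OF N(2)] by eventually_elim (simp add: v'_def)
  show thesis by (rule that[OF ae mt joint])
qed

lemma dyadic_energy_measurable:
  assumes "\<And>x. (\<lambda>p. f p x) \<in> borel_measurable N"
  shows "(\<lambda>p. dyadic_energy L (f p)) \<in> borel_measurable N"
  unfolding dyadic_energy_def using assms by measurable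

text \<open>There are 2^k intervals, each with weight 2^(k L) and moment of order 2^(-2 k L); the
  product 2^(k (1 - L)) is at most 2^(-k) once L >= 2.\<close>

lemma dyadic_weight_sum:
  assumes "2 \<le> L" and C: "0 \<le> C"
  shows "(\<Sum>i<(2::nat) ^ k. ennreal (2 ^ (k * L)) * ennreal (C * sqrt (1 / 2 ^ k) ^ (4 * L))) \<le> ennreal (C * (1/2) ^ k)"
proof -
  have "sqrt (1 / 2 ^ k) ^ (4 * L) = ((sqrt (1 / 2 ^ k))\<^sup>2) ^ (2 * L)" by (simp only: power_mult[symmetric]) simp
  also have "\<dots> = (1 / 2 ^ k) ^ (2 * L)" by simp
  finally have s: "sqrt (1 / 2 ^ k) ^ (4 * L) = 1 / 2 ^ (k * (2 * L))" by (simp add: power_one_over power_mult)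
  have "(\<Sum>i<(2::nat) ^ k. ennreal (2 ^ (k * L)) * ennreal (C * sqrt (1 / 2 ^ k) ^ (4 * L)))
     = ennreal (2 ^ k * (2 ^ (k * L) * (C / 2 ^ (k * (2 * L)))))"
    unfolding s using C by (simp add: ennreal_mult[symmetric] ennreal_of_nat_eq_real_of_nat)
  also have "\<dots> \<le> ennreal (C * (1/2) ^ k)"
  proof (rule ennreal_leI)
    have "(2::real) ^ (k * 2 + k * L) \<le> 2 ^ (k * (2 * L))"
    proof (rule power_increasing)
      have "k * 2 + k * L \<le> k * L + k * L" using assms by simp
      then show "k * 2 + k * L \<le> k * (2 * L)" by (simp add: algebra_simps)
    qed simp
    then have "2 ^ k * 2 ^ k * 2 ^ (k * L) \<le> (2::real) ^ (k * (2 * L))" by (simp add: power_add mult_2_right)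
    then have "2 ^ k * (2 ^ (k * L) * (1 / 2 ^ (k * (2 * L)))) \<le> (1/2 :: real) ^ k"
      by (simp add: field_simps power_one_over)
    from mult_left_mono[OF this C] show "2 ^ k * (2 ^ (k * L) * (C / 2 ^ (k * (2 * L)))) \<le> C * (1/2) ^ k"
      by (simp add: mult_ac)
  qed
  finally show ?thesis .
qed

text \<open>The last two bounds serve the two places where the noise enters: through
  \<open>v\<close> at the final time, and integrated over the window. \<open>g\<close> is built from
  the measurable version and, off one null set, agrees with the roughness of \<open>v\<close> at all
  times simultaneously.\<close>

lemma roughness_moment:
  fixes M :: "'w measure"
  assumes \<xi>: "mean_free_white_noise M \<xi>" and v: "stoch_heat M \<xi> v" and L: "2 \<le> L"
  obtains B :: real and g :: "'w \<Rightarrow> real \<Rightarrow> ennreal" where "0 \<le> B"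
    "AE \<omega> in M. \<forall>s\<ge>0. g \<omega> s = 1 + ennreal (v \<omega> s 0 ^ (2 * L)) + dyadic_energy L (v \<omega> s)"
    "(\<lambda>(\<omega>, s). g \<omega> s) \<in> borel_measurable (M \<Otimes>\<^sub>M lborel)"
    "\<And>t. (\<lambda>\<omega>. g \<omega> t) \<in> borel_measurable M"
    "\<And>t. (\<integral>\<^sup>+ \<omega>. g \<omega> t \<partial>M) \<le> ennreal B"
    "\<And>a b. a \<le> b \<Longrightarrow> (\<integral>\<^sup>+ \<omega>. \<integral>\<^sup>+ s. g \<omega> s * indicator {a..b} s \<partial>lborel \<partial>M) \<le> ennreal (B * (b - a))"
proof -
  interpret prob_space M using \<xi> by (simp add: mean_free_white_noise_def)
  obtain v' where v': "AE \<omega> in M. v' \<omega> = v \<omega>"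
    "\<And>t x. 0 \<le> t \<Longrightarrow> (\<lambda>\<omega>. v' \<omega> t x) \<in> borel_measurable M"
    "\<And>x. (\<lambda>(\<omega>, s). v' \<omega> (max s 0) x) \<in> borel_measurable (M \<Otimes>\<^sub>M lborel)"
    using stoch_heat_version[OF \<xi> v] by blast
  obtain C1 where C1: "C1 \<ge> 0" "\<And>t x. t \<ge> 0 \<Longrightarrow> (\<integral>\<^sup>+ \<omega>. ennreal (v \<omega> t x ^ (2 * L)) \<partial>M) \<le> ennreal C1"
    using stoch_heat_moments[OF \<xi> v, of L] by blast
  \<comment> \<open>Moments of order 8 L are taken with j = 4 L, so that the variance bound |x -
    y|^(1/2) yields 2^(-2 k L) at dyadic scale k.\<close>
  obtain C2 where C2: "C2 \<ge> 0" "\<And>t x y. t \<ge> 0 \<Longrightarrow> (\<integral>\<^sup>+ \<omega>. ennreal ((v \<omega> t x - v \<omega> t y) ^ (2 * (4 * L))) \<partial>M) \<le> ennreal (C2 * sqrt \<bar>x - y\<bar> ^ (4 * L))"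
    using stoch_heat_moments[OF \<xi> v, of "4 * L"] by blast
  define B where "B = 1 + C1 + 2 * C2"
  define g where "g = (\<lambda>f. 1 + ennreal (f 0 ^ (2 * L)) + dyadic_energy L f)"
  have E: "(\<integral>\<^sup>+ \<omega>. dyadic_energy L (v' \<omega> t) \<partial>M) \<le> ennreal (2 * C2)" if t: "0 \<le> t" for t
  proof -
    note [measurable] = v'(2)[OF t]
    have "(\<integral>\<^sup>+ \<omega>. dyadic_energy L (v' \<omega> t) \<partial>M) = (\<Sum>k. \<integral>\<^sup>+ \<omega>. ennreal (2 ^ (k * L)) *
       (\<Sum>i<2 ^ k. ennreal ((v' \<omega> t ((real i + 1) / 2 ^ k) - v' \<omega> t (real i / 2 ^ k)) ^ (8 * L))) \<partial>M)"
      unfolding dyadic_energy_def by (rule nn_integral_suminf) measurable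
    also have "\<dots> \<le> (\<Sum>k. ennreal (C2 * (1/2) ^ k))"
    proof (rule suminf_le)
      fix k
      have "(\<integral>\<^sup>+ \<omega>. ennreal (2 ^ (k * L)) * (\<Sum>i<2 ^ k. ennreal ((v' \<omega> t ((real i + 1) / 2 ^ k) - v' \<omega> t (real i / 2 ^ k)) ^ (8 * L))) \<partial>M)
        = (\<Sum>i<2 ^ k. ennreal (2 ^ (k * L)) * (\<integral>\<^sup>+ \<omega>. ennreal ((v' \<omega> t ((real i + 1) / 2 ^ k) - v' \<omega> t (real i / 2 ^ k)) ^ (8 * L)) \<partial>M))"
        by (simp add: nn_integral_cmult nn_integral_sum sum_distrib_left)
      also have "\<dots> \<le> (\<Sum>i<(2::nat) ^ k. ennreal (2 ^ (k * L)) * ennreal (C2 * sqrt (1 / 2 ^ k) ^ (4 * L)))"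
      proof (intro sum_mono mult_left_mono)
        fix i
        have "(\<integral>\<^sup>+ \<omega>. ennreal ((v' \<omega> t ((real i + 1) / 2 ^ k) - v' \<omega> t (real i / 2 ^ k)) ^ (8 * L)) \<partial>M)
          = (\<integral>\<^sup>+ \<omega>. ennreal ((v \<omega> t ((real i + 1) / 2 ^ k) - v \<omega> t (real i / 2 ^ k)) ^ (2 * (4 * L))) \<partial>M)"
          by (rule nn_integral_cong_AE) (use v'(1) in \<open>eventually_elim, simp\<close>)
        also have "\<dots> \<le> ennreal (C2 * sqrt \<bar>(real i + 1) / 2 ^ k - real i / 2 ^ k\<bar> ^ (4 * L))" by (rule C2(2)[OF t])
        also have "\<bar>(real i + 1) / 2 ^ k - real i / 2 ^ k\<bar> = 1 / 2 ^ k" by (simp add: diff_divide_distrib[symmetric])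
        finally show "(\<integral>\<^sup>+ \<omega>. ennreal ((v' \<omega> t ((real i + 1) / 2 ^ k) - v' \<omega> t (real i / 2 ^ k)) ^ (8 * L)) \<partial>M)
          \<le> ennreal (C2 * sqrt (1 / 2 ^ k) ^ (4 * L))" .
      qed simp
      also have "\<dots> \<le> ennreal (C2 * (1/2) ^ k)" by (rule dyadic_weight_sum[OF L C2(1)])
      finally show "(\<integral>\<^sup>+ \<omega>. ennreal (2 ^ (k * L)) * (\<Sum>i<2 ^ k. ennreal ((v' \<omega> t ((real i + 1) / 2 ^ k) - v' \<omega> t (real i / 2 ^ k)) ^ (8 * L))) \<partial>M)
         \<le> ennreal (C2 * (1/2) ^ k)" .
    qed auto
    also have "\<dots> = ennreal (\<Sum>k. C2 * (1/2) ^ k)"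
      by (rule suminf_ennreal2) (use C2(1) in \<open>auto intro!: summable_mult summable_geometric\<close>)
    also have "(\<Sum>k. C2 * (1/2) ^ k) = 2 * C2"
      by (subst suminf_mult) (auto simp: suminf_geometric intro: summable_geometric)
    finally show ?thesis .
  qed
  have G': "(\<integral>\<^sup>+ \<omega>. g (v' \<omega> t) \<partial>M) \<le> ennreal B" if t: "0 \<le> t" for t
  proof -
    note [measurable] = v'(2)[OF t] dyadic_energy_measurable[OF v'(2)[OF t]]
    have "(\<integral>\<^sup>+ \<omega>. g (v' \<omega> t) \<partial>M) = (\<integral>\<^sup>+ \<omega>. 1 \<partial>M) + (\<integral>\<^sup>+ \<omega>. ennreal (v' \<omega> t 0 ^ (2 * L)) \<partial>M) + (\<integral>\<^sup>+ \<omega>. dyadic_energy L (v' \<omega> t) \<partial>M)"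
      unfolding g_def by ((subst nn_integral_add, measurable)+)
    also have "(\<integral>\<^sup>+ \<omega>. ennreal (v' \<omega> t 0 ^ (2 * L)) \<partial>M) = (\<integral>\<^sup>+ \<omega>. ennreal (v \<omega> t 0 ^ (2 * L)) \<partial>M)"
      by (rule nn_integral_cong_AE) (use v'(1) in \<open>eventually_elim, simp\<close>)
    also have "(\<integral>\<^sup>+ \<omega>. 1 \<partial>M) + (\<integral>\<^sup>+ \<omega>. ennreal (v \<omega> t 0 ^ (2 * L)) \<partial>M) + (\<integral>\<^sup>+ \<omega>. dyadic_energy L (v' \<omega> t) \<partial>M)
       \<le> 1 + ennreal C1 + ennreal (2 * C2)"
      by (intro add_mono C1(2)[OF t] E[OF t]) (simp add: emeasure_space_1)
    also have "\<dots> = ennreal B" using C1(1) C2(1) by (simp add: B_def ennreal_plus flip: ennreal_1)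
    finally show ?thesis .
  qed
  have B0: "0 \<le> B" using C1(1) C2(1) by (simp add: B_def)
  define \<Gamma> where "\<Gamma> = (\<lambda>\<omega> s. g (v' \<omega> (max s 0)))"
  have joint: "(\<lambda>(\<omega>, s). \<Gamma> \<omega> s) \<in> borel_measurable (M \<Otimes>\<^sub>M lborel)"
  proof -
    have [measurable]: "(\<lambda>p. v' (fst p) (max (snd p) 0) x) \<in> borel_measurable (M \<Otimes>\<^sub>M lborel)" for x
      using v'(3)[of x] by (simp add: split_beta)
    have [measurable]: "(\<lambda>p. dyadic_energy L (v' (fst p) (max (snd p) 0))) \<in> borel_measurable (M \<Otimes>\<^sub>M lborel)"
      by (rule dyadic_energy_measurable) measurable
    show ?thesis unfolding \<Gamma>_def g_def split_beta by measurable
  qed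
  have E\<Gamma>: "(\<integral>\<^sup>+ \<omega>. \<Gamma> \<omega> t \<partial>M) \<le> ennreal B" for t unfolding \<Gamma>_def by (rule G') simp
  show thesis
  proof (rule that[OF B0 _ joint _ E\<Gamma>])
    show "AE \<omega> in M. \<forall>s\<ge>0. \<Gamma> \<omega> s = 1 + ennreal (v \<omega> s 0 ^ (2 * L)) + dyadic_energy L (v \<omega> s)"
      using v'(1) by eventually_elim (simp add: \<Gamma>_def g_def max_absorb1)
    show "(\<lambda>\<omega>. \<Gamma> \<omega> t) \<in> borel_measurable M" for t
    proof -
      have t: "0 \<le> max t 0" by simp
      note [measurable] = v'(2)[OF t] dyadic_energy_measurable[OF v'(2)[OF t]]
      show ?thesis unfolding \<Gamma>_def g_def by measurable
    qed
    fix a b :: real assume ab: "a \<le> b"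
    interpret pair_sigma_finite M lborel ..
    have "(\<integral>\<^sup>+ \<omega>. \<integral>\<^sup>+ s. \<Gamma> \<omega> s * indicator {a..b} s \<partial>lborel \<partial>M) = (\<integral>\<^sup>+ s. \<integral>\<^sup>+ \<omega>. \<Gamma> \<omega> s * indicator {a..b} s \<partial>M \<partial>lborel)"
      using Fubini[of "\<lambda>(\<omega>, s). \<Gamma> \<omega> s * indicator {a..b} s"] joint by (simp add: split_beta)
    also have "\<dots> \<le> (\<integral>\<^sup>+ s. ennreal B * indicator {a..b} s \<partial>lborel)"
      by (rule nn_integral_mono) (use E\<Gamma> in \<open>auto simp: indicator_def\<close>)
    also have "\<dots> = ennreal (B * (b - a))"
      using ab B0 by (simp add: nn_integral_cmult_indicator ennreal_mult)
    finally show "(\<integral>\<^sup>+ \<omega>. \<integral>\<^sup>+ s. \<Gamma> \<omega> s * indicator {a..b} s \<partial>lborel \<partial>M) \<le> ennreal (B * (b - a))" .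
  qed
qed

section \<open>The uniform moment bound\<close>

lemma powr_le_one_plus_power:
  fixes x p :: real
  assumes "0 \<le> x" "0 \<le> p" "p \<le> real P"
  shows "x powr p \<le> 1 + x ^ P"
proof (cases "x \<le> 1")
  case True
  then have "x powr p \<le> 1" using assms by (intro powr_le1) auto
  then show ?thesis using zero_le_power[OF \<open>0 \<le> x\<close>, of P] by linarith
next
  case False
  then have "x powr p \<le> x powr real P" using assms by (intro powr_mono) auto
  also have "\<dots> = x ^ P" using False by (intro powr_realpow) simp
  finally show ?thesis by simp
qed

text \<open>No measurability is assumed: the solution w need not depend measurably on the noise, and the
  integral is then a lower integral.\<close>

lemma nn_integral_cmult_ge: "c * (\<integral>\<^sup>+ x. f x \<partial>M) \<le> (\<integral>\<^sup>+ x. c * f x \<partial>M)"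
  unfolding nn_integral_def SUP_mult_left_ennreal
proof (rule SUP_mono)
  fix h assume "h \<in> {h. simple_function M h \<and> h \<le> f}"
  then have h: "simple_function M h" "h \<le> f" by auto
  have "simple_function M (\<lambda>x. c * h x)" using h(1) by simp
  moreover have "(\<lambda>x. c * h x) \<le> (\<lambda>x. c * f x)" using h(2) by (auto simp: le_fun_def intro: mult_left_mono)
  moreover have "c * integral\<^sup>S M h = integral\<^sup>S M (\<lambda>x. c * h x)" using h(1) by simp
  ultimately show "\<exists>k\<in>{h. simple_function M h \<and> h \<le> (\<lambda>x. c * f x)}. c * integral\<^sup>S M h \<le> integral\<^sup>S M k"
    by (intro bexI[of _ "\<lambda>x. c * h x"]) auto
qed

text \<open>Scaling u by sqrt \<tau> before comparing the exponents p and 2 n + 2 produces the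
  weight \<tau>^(n+1) on the higher powers; the additive 1 covers small values.\<close>

lemma Lp_pow_bound:
  assumes p: "0 \<le> p" "p \<le> real (2 * n + 2)" and \<tau>: "0 < \<tau>"
    and w: "continuous_on UNIV w" and vc: "continuous_on UNIV v" and v: "\<And>x. \<bar>v x\<bar> \<le> H"
  shows "ennreal (\<tau> powr (p / 2)) * Lp_pow p (\<lambda>x. w x + v x)
    \<le> 1 + 2 ^ (2 * n + 2) * (ennreal (\<tau> ^ (n + 1) * integral {0..1} (\<lambda>x. w x ^ (2 * n + 2))) + ennreal (\<tau> ^ (n + 1) * H ^ (2 * n + 2)))"
proof -
  let ?P = "2 * n + 2"
  have H0: "0 \<le> H" using v[of 0] by linarith
  have cw: "continuous_on {0..1} (\<lambda>x. w x ^ ?P)" by (intro continuous_intros continuous_on_subset[OF w]) simp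
  have pt: "ennreal (\<tau> powr (p / 2)) * ennreal (\<bar>w x + v x\<bar> powr p)
      \<le> 1 + 2 ^ ?P * (ennreal (\<tau> ^ (n + 1) * w x ^ ?P) + ennreal (\<tau> ^ (n + 1) * H ^ ?P))" for x
  proof -
    let ?u = "\<bar>w x + v x\<bar>"
    have "\<tau> powr (p / 2) * ?u powr p = (sqrt \<tau> * ?u) powr p"
      using \<tau> by (simp add: powr_mult powr_half_sqrt[symmetric] powr_powr)
    also have "\<dots> \<le> 1 + (sqrt \<tau> * ?u) ^ ?P" by (rule powr_le_one_plus_power) (use p \<tau> in auto)
    also have "(sqrt \<tau> * ?u) ^ ?P = \<tau> ^ (n + 1) * ?u ^ ?P"
    proof -
      have "sqrt \<tau> ^ ?P = ((sqrt \<tau>)\<^sup>2) ^ (n + 1)" by (simp only: power_mult[symmetric]) simp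
      then show ?thesis using \<tau> by (simp add: power_mult_distrib)
    qed
    also have "?u ^ ?P \<le> (\<bar>w x\<bar> + H) ^ ?P" using v[of x] by (intro power_mono) linarith+
    also have "\<dots> \<le> 2 ^ ?P * (\<bar>w x\<bar> ^ ?P + H ^ ?P)" by (rule add_power_le) (use H0 in auto)
    also have "\<bar>w x\<bar> ^ ?P = w x ^ ?P" by (rule power_even_abs) simp
    finally have "\<tau> powr (p / 2) * ?u powr p \<le> 1 + \<tau> ^ (n + 1) * (2 ^ ?P * (w x ^ ?P + H ^ ?P))"
      using \<tau> by (simp add: mult_left_mono)
    also have "\<dots> = 1 + 2 ^ ?P * (\<tau> ^ (n + 1) * w x ^ ?P + \<tau> ^ (n + 1) * H ^ ?P)"
      by (simp only: distrib_left mult.left_commute)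
    finally have "ennreal (\<tau> powr (p / 2) * ?u powr p) \<le> ennreal (1 + 2 ^ ?P * (\<tau> ^ (n + 1) * w x ^ ?P + \<tau> ^ (n + 1) * H ^ ?P))"
      by (rule ennreal_leI)
    moreover have "0 \<le> \<tau> ^ (n + 1) * w x ^ ?P" "0 \<le> \<tau> ^ (n + 1) * H ^ ?P"
    proof -
      have "0 \<le> w x ^ ?P" "0 \<le> H ^ ?P" by (rule zero_le_even_power, simp)+
      then show "0 \<le> \<tau> ^ (n + 1) * w x ^ ?P" "0 \<le> \<tau> ^ (n + 1) * H ^ ?P" using \<tau> by (metis less_imp_le mult_nonneg_nonneg zero_le_power)+
    qed
    ultimately show ?thesis
      by (simp only: ennreal_plus ennreal_mult ennreal_1 ennreal_power[symmetric] ennreal_numeral zero_le_power zero_le_numeral zero_le_one add_nonneg_nonneg mult_nonneg_nonneg powr_ge_zero)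
  qed
  have [measurable]: "w \<in> borel_measurable borel" "v \<in> borel_measurable borel"
    by (rule borel_measurable_continuous_onI[OF w] borel_measurable_continuous_onI[OF vc])+
  have "ennreal (\<tau> powr (p / 2)) * Lp_pow p (\<lambda>x. w x + v x)
      \<le> (\<integral>\<^sup>+ x. (1 + 2 ^ ?P * (ennreal (\<tau> ^ (n + 1) * w x ^ ?P) + ennreal (\<tau> ^ (n + 1) * H ^ ?P))) * indicator {0..1} x \<partial>lborel)"
  proof -
    have "ennreal (\<tau> powr (p / 2)) * Lp_pow p (\<lambda>x. w x + v x)
       = (\<integral>\<^sup>+ x. ennreal (\<tau> powr (p / 2)) * (ennreal (\<bar>w x + v x\<bar> powr p) * indicator {0..1} x) \<partial>lborel)"
      unfolding Lp_pow_def by (rule nn_integral_cmult[symmetric]) measurable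
    also have "\<dots> \<le> (\<integral>\<^sup>+ x. (1 + 2 ^ ?P * (ennreal (\<tau> ^ (n + 1) * w x ^ ?P) + ennreal (\<tau> ^ (n + 1) * H ^ ?P))) * indicator {0..1} x \<partial>lborel)"
      using pt by (intro nn_integral_mono) (auto simp: indicator_def)
    finally show ?thesis .
  qed
  also have "\<dots> = (\<integral>\<^sup>+ x. indicator {0..1::real} x + (2 ^ ?P * (ennreal (\<tau> ^ (n + 1) * w x ^ ?P) * indicator {0..1} x) + 2 ^ ?P * (ennreal (\<tau> ^ (n + 1) * H ^ ?P) * indicator {0..1} x)) \<partial>lborel)"
    by (intro nn_integral_cong) (simp only: distrib_left distrib_right mult_1_left mult.assoc)
  also have "\<dots> = 1 + (2 ^ ?P * (\<integral>\<^sup>+ x. ennreal (\<tau> ^ (n + 1) * w x ^ ?P) * indicator {0..1} x \<partial>lborel) + 2 ^ ?P * ennreal (\<tau> ^ (n + 1) * H ^ ?P))"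
    by (simp add: nn_integral_add nn_integral_cmult nn_integral_cmult_indicator)
  also have "(\<integral>\<^sup>+ x. ennreal (\<tau> ^ (n + 1) * w x ^ ?P) * indicator {0..1} x \<partial>lborel) = ennreal (\<tau> ^ (n + 1) * integral {0..1} (\<lambda>x. w x ^ ?P))"
  proof -
    have c: "continuous_on {0..1} (\<lambda>x. \<tau> ^ (n + 1) * w x ^ ?P)" by (intro continuous_intros continuous_on_subset[OF w]) simp
    have nn: "0 \<le> \<tau> ^ (n + 1) * w x ^ ?P" for x
    proof -
      have "0 \<le> w x ^ ?P" by (rule zero_le_even_power) simp
      then show ?thesis using \<tau> by (metis less_imp_le mult_nonneg_nonneg zero_le_power)
    qed
    have "(\<integral>\<^sup>+ x. ennreal (\<tau> ^ (n + 1) * w x ^ ?P) * indicator {0..1} x \<partial>lborel) = (\<integral>\<^sup>+ x. ennreal (indicator {0..1} x *\<^sub>R (\<tau> ^ (n + 1) * w x ^ ?P)) \<partial>lborel)"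
      by (intro nn_integral_cong) (simp add: indicator_def)
    also have "\<dots> = ennreal (LINT x:{0..1}|lborel. \<tau> ^ (n + 1) * w x ^ ?P)"
      unfolding set_lebesgue_integral_def
      by (rule nn_integral_eq_integral)
         (use set_lint_continuous(1)[OF c] nn in \<open>auto simp: set_integrable_def indicator_def simp del: mult_nonneg_nonneg\<close>)
    also have "\<dots> = ennreal (\<tau> ^ (n + 1) * integral {0..1} (\<lambda>x. w x ^ ?P))"
      unfolding set_lint_continuous(2)[OF c] by (rule arg_cong[where f=ennreal], rule integral_mult_right)
    finally show ?thesis .
  qed
  finally show ?thesis by (simp only: distrib_left)
qed

theorem theorem5p3:
  fixes \<alpha>0 \<alpha> \<eta> m p :: real
    and M :: "'w measure"
    and \<xi> :: "'w \<Rightarrow> (real \<times> real \<Rightarrow> real) \<Rightarrow> real"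
    and v :: "'w \<Rightarrow> real \<Rightarrow> real \<Rightarrow> real"
  assumes "- 1/2 < \<alpha>0" and "\<alpha>0 < 0"
    and "0 < \<alpha>" and "\<alpha> < \<alpha>0 + 1/2"
    and "(\<alpha> - \<alpha>0) / 2 < \<eta>" and "\<eta> < 1/4"
    and "1 \<le> p"
    and "mean_free_white_noise M \<xi>"
    and "stoch_heat M \<xi> v"
  shows "\<exists>C::real. \<forall>\<zeta> w. \<zeta> \<in> holder_besov_m \<alpha>0 m \<longrightarrow>
           (AE \<omega> in M. mild_solution \<alpha> \<eta> \<zeta> (v \<omega>) (w \<omega>)) \<longrightarrow>
           (\<forall>T>0. \<forall>t\<in>{0<..T}.
              ennreal (min (t powr (p / 2)) 1) *
                (\<integral>\<^sup>+ \<omega>. Lp_pow p (\<lambda>x. w \<omega> t x + v \<omega> t x) \<partial>M) \<le> ennreal C)"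
proof -
  note \<xi> = assms(8) and v = assms(9)
  interpret prob_space M using \<xi> by (simp add: mean_free_white_noise_def)
  have vc: "continuous_on ({0..} \<times> UNIV) (\<lambda>(t, x). v \<omega> t x)" and vp: "periodic1 (v \<omega> t)" for \<omega> t
    using v by (auto simp: stoch_heat_def)
  define n where "n = nat \<lceil>p\<rceil>"
  let ?P = "2 * n + 2"
  have p: "0 \<le> p" "p \<le> real ?P"
  proof -
    have "p \<le> real n" unfolding n_def by (rule real_nat_ceiling_ge)
    then show "p \<le> real ?P" by simp
  qed (use assms(7) in simp)
  obtain \<epsilon> C0 :: real and K :: nat where pw: "0 < \<epsilon>" "0 < C0"
    "\<And>\<alpha> \<eta> \<zeta> v w s0 t g. \<lbrakk>0 < \<alpha>; mild_solution \<alpha> \<eta> \<zeta> v w; \<zeta> 0 = complex_of_real m;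
       continuous_on ({0..} \<times> UNIV) (\<lambda>(t, x). v t x); \<And>t. periodic1 (v t); 0 < s0; s0 < t;
       \<And>s. s \<in> {s0..t} \<Longrightarrow> g s < \<infinity> \<Longrightarrow> \<exists>H\<ge>1. smooth_approx \<epsilon> H (v s) \<and> ennreal (H ^ K) \<le> g s\<rbrakk>
     \<Longrightarrow> ennreal ((t - s0) ^ (n + 2) * integral {0..1} (\<lambda>x. w t x ^ (2 * n + 2)))
        \<le> (\<integral>\<^sup>+ s. (ennreal C0 * (1 + ennreal ((t - s0) ^ (n + 2)) * g s)) * indicator {s0..t} s \<partial>lborel)"
  proof (rule pathwise_bound[of m n], goal_cases)
    case (1 \<epsilon> C0 K)
    show thesis by (rule 1(1)[of \<epsilon> C0 K, OF 1(2) 1(3)]) (rule 1(4); assumption)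
  qed
  \<comment> \<open>Large enough for both the power K of H in the pathwise bound and the power
    \<open>?P\<close> of H that bounds \<open>v\<close> at the final time.\<close>
  define L where "L = K + ?P"
  have L: "1 \<le> L" "2 \<le> L" "K \<le> L" "?P \<le> L" by (auto simp: L_def)
  obtain C1 where C1: "0 < C1" "\<And>f. continuous_on UNIV f \<Longrightarrow> periodic1 f \<Longrightarrow> dyadic_energy L f < \<infinity> \<Longrightarrow>
     \<exists>H\<ge>1. smooth_approx \<epsilon> H f \<and> ennreal (H ^ L) \<le> ennreal C1 * (1 + ennreal (f 0 ^ (2 * L)) + dyadic_energy L f)"
    using smooth_approx_of_energy[OF pw(1) L(1)] by blast
  obtain B :: real and g where B: "0 \<le> B"
    and g: "AE \<omega> in M. \<forall>s\<ge>0. g \<omega> s = 1 + ennreal (v \<omega> s 0 ^ (2 * L)) + dyadic_energy L (v \<omega> s)"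
    and gm: "(\<lambda>(\<omega>, s). g \<omega> s) \<in> borel_measurable (M \<Otimes>\<^sub>M lborel)"
      "\<And>t. (\<lambda>\<omega>. g \<omega> t) \<in> borel_measurable M"
    and gB: "\<And>t. (\<integral>\<^sup>+ \<omega>. g \<omega> t \<partial>M) \<le> ennreal B"
      "\<And>a b. a \<le> b \<Longrightarrow> (\<integral>\<^sup>+ \<omega>. \<integral>\<^sup>+ s. g \<omega> s * indicator {a..b} s \<partial>lborel \<partial>M) \<le> ennreal (B * (b - a))"
    by (rule roughness_moment[OF \<xi> v L(2)]) blast
  \<comment> \<open>The term with C0 is the contribution of the window, the last C1 B that of the
    noise at the final time. The factor 2^(p/2) in \<open>C\<close> undoes the halving in the window
    length \<tau>.\<close>
  define A where "A = 1 + 2 ^ ?P * (C0 * (1 + C1 * B) + C1 * B)"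
  define C where "C = 2 powr (p / 2) * A"
  have A: "0 \<le> A" using B C1(1) pw(2) by (simp add: A_def)
  show ?thesis
  proof (intro exI[of _ C] allI impI ballI)
    fix \<zeta> w and T t :: real
    assume \<zeta>: "\<zeta> \<in> holder_besov_m \<alpha>0 m" and mild: "AE \<omega> in M. mild_solution \<alpha> \<eta> \<zeta> (v \<omega>) (w \<omega>)"
      and t: "t \<in> {0<..T}"
    have \<zeta>0: "\<zeta> 0 = complex_of_real m" using \<zeta> by (simp add: holder_besov_m_def)
    \<comment> \<open>Half of min t 1: the start s0 = t - \<tau> stays positive, away from the
      possible singularity at time 0, and powers of \<tau> stay below 1.\<close>
    define \<tau> where "\<tau> = min t 1 / 2"
    define s0 where "s0 = t - \<tau>"
    have \<tau>: "0 < \<tau>" "\<tau> \<le> 1" and s0: "0 < s0" "s0 < t" "t - s0 = \<tau>"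
      using t by (auto simp: \<tau>_def s0_def min_def)
    have \<tau>1: "\<tau> ^ k \<le> 1" for k using \<tau> by (intro power_le_one) auto
    define J where "J = (\<lambda>\<omega>. \<integral>\<^sup>+ s. g \<omega> s * indicator {s0..t} s \<partial>lborel)"
    have Jm: "J \<in> borel_measurable M"
      unfolding J_def by (rule lborel.borel_measurable_nn_integral) (use gm(1) in \<open>simp add: split_beta\<close>)
    have key: "AE \<omega> in M. ennreal (\<tau> powr (p / 2)) * Lp_pow p (\<lambda>x. w \<omega> t x + v \<omega> t x)
       \<le> 1 + 2 ^ ?P * (ennreal (1 / \<tau>) * (ennreal C0 * (ennreal \<tau> + ennreal C1 * J \<omega>)) + ennreal C1 * g \<omega> t)"
      using mild g AE_space
    proof eventually_elim
      fix \<omega>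
      assume ms: "mild_solution \<alpha> \<eta> \<zeta> (v \<omega>) (w \<omega>)" and \<omega>: "\<omega> \<in> space M"
        and ge: "\<forall>s\<ge>0. g \<omega> s = 1 + ennreal (v \<omega> s 0 ^ (2 * L)) + dyadic_energy L (v \<omega> s)"
      have vcs: "continuous_on UNIV (v \<omega> s)" if "0 \<le> s" for s
        by (rule continuous_on_slice[OF vc]) (use that in simp)
      have H: "\<exists>H\<ge>1. smooth_approx \<epsilon> H (v \<omega> s) \<and> ennreal (H ^ L) \<le> ennreal C1 * g \<omega> s"
        if "0 \<le> s" "ennreal C1 * g \<omega> s < \<infinity>" for s
      proof -
        have "dyadic_energy L (v \<omega> s) \<le> g \<omega> s" using ge that(1) by (simp add: add_increasing)
        moreover have "g \<omega> s < \<infinity>" using that(2) C1(1) by (auto simp: ennreal_mult_less_top)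
        ultimately have "dyadic_energy L (v \<omega> s) < \<infinity>" by (rule le_less_trans)
        then show ?thesis using C1(2)[OF vcs[OF that(1)] vp] ge that(1) by simp
      qed
      have gs [measurable]: "g \<omega> \<in> borel_measurable lborel"
        using measurable_compose[OF measurable_Pair1'[OF \<omega>] gm(1)] by simp
      have "ennreal (\<tau> ^ (n + 2) * integral {0..1} (\<lambda>x. w \<omega> t x ^ ?P))
         \<le> (\<integral>\<^sup>+ s. (ennreal C0 * (1 + ennreal (\<tau> ^ (n + 2)) * (ennreal C1 * g \<omega> s))) * indicator {s0..t} s \<partial>lborel)"
        unfolding s0(3)[symmetric]
      proof (rule pw(3)[OF assms(3) ms \<zeta>0 vc vp s0(1,2)])
        fix s assume s: "s \<in> {s0..t}" "ennreal C1 * g \<omega> s < \<infinity>"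
        then obtain H where H': "1 \<le> H" "smooth_approx \<epsilon> H (v \<omega> s)" "ennreal (H ^ L) \<le> ennreal C1 * g \<omega> s"
          using H[of s] s0(1) by auto
        have "ennreal (H ^ K) \<le> ennreal (H ^ L)" by (intro ennreal_leI power_increasing L H')
        then show "\<exists>H\<ge>1. smooth_approx \<epsilon> H (v \<omega> s) \<and> ennreal (H ^ K) \<le> ennreal C1 * g \<omega> s"
          using H' order_trans by blast
      qed
      also have "\<dots> \<le> (\<integral>\<^sup>+ s. ennreal C0 * (indicator {s0..t} s + ennreal C1 * (g \<omega> s * indicator {s0..t} s)) \<partial>lborel)"
      proof (rule nn_integral_mono)
        fix s
        have "ennreal (\<tau> ^ (n + 2)) * (ennreal C1 * g \<omega> s) \<le> 1 * (ennreal C1 * g \<omega> s)"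
          using \<tau>1 by (intro mult_right_mono) (auto simp flip: ennreal_1 simp del: power_add power_Suc)
        then show "(ennreal C0 * (1 + ennreal (\<tau> ^ (n + 2)) * (ennreal C1 * g \<omega> s))) * indicator {s0..t} s
           \<le> ennreal C0 * (indicator {s0..t} s + ennreal C1 * (g \<omega> s * indicator {s0..t} s))"
          by (cases "s \<in> {s0..t}") (auto intro!: mult_left_mono add_left_mono)
      qed
      also have "\<dots> = ennreal C0 * (ennreal \<tau> + ennreal C1 * J \<omega>)"
        using s0 by (simp add: nn_integral_cmult nn_integral_add J_def)
      finally have I: "ennreal (\<tau> ^ (n + 2) * integral {0..1} (\<lambda>x. w \<omega> t x ^ ?P)) \<le> ennreal C0 * (ennreal \<tau> + ennreal C1 * J \<omega>)" .
      \<comment> \<open>Dividing by \<tau> lowers the weight to the required n + 1 and turns the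
        time integral into an average over the window, whose expectation is bounded independently of
        \<tau>.\<close>
      have I': "ennreal (\<tau> ^ (n + 1) * integral {0..1} (\<lambda>x. w \<omega> t x ^ ?P)) \<le> ennreal (1 / \<tau>) * (ennreal C0 * (ennreal \<tau> + ennreal C1 * J \<omega>))"
      proof -
        have "\<tau> ^ (n + 1) * integral {0..1} (\<lambda>x. w \<omega> t x ^ ?P) = 1 / \<tau> * (\<tau> ^ (n + 2) * integral {0..1} (\<lambda>x. w \<omega> t x ^ ?P))"
          using \<tau> by simp
        then have "ennreal (\<tau> ^ (n + 1) * integral {0..1} (\<lambda>x. w \<omega> t x ^ ?P)) = ennreal (1 / \<tau>) * ennreal (\<tau> ^ (n + 2) * integral {0..1} (\<lambda>x. w \<omega> t x ^ ?P))"
          using \<tau> by (simp only: ennreal_mult' divide_nonneg_pos zero_le_one)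
        then show ?thesis using mult_left_mono[OF I, of "ennreal (1 / \<tau>)"] by simp
      qed
      have t0: "0 < t" using t by simp
      show "ennreal (\<tau> powr (p / 2)) * Lp_pow p (\<lambda>x. w \<omega> t x + v \<omega> t x)
       \<le> 1 + 2 ^ ?P * (ennreal (1 / \<tau>) * (ennreal C0 * (ennreal \<tau> + ennreal C1 * J \<omega>)) + ennreal C1 * g \<omega> t)"
      proof (cases "ennreal C1 * g \<omega> t < \<infinity>")
        case True
        obtain H where H': "1 \<le> H" "smooth_approx \<epsilon> H (v \<omega> t)" "ennreal (H ^ L) \<le> ennreal C1 * g \<omega> t"
          using H[OF _ True] t0 by auto
        have "\<tau> ^ (n + 1) * H ^ ?P \<le> 1 * H ^ L"
          by (intro mult_mono power_increasing \<tau>1 H'(1) L(4)) (use H'(1) in auto)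
        then have HL: "ennreal (\<tau> ^ (n + 1) * H ^ ?P) \<le> ennreal C1 * g \<omega> t"
          using order_trans[OF ennreal_leI H'(3)] by simp
        have wc: "continuous_on UNIV (w \<omega> t)" using ms t0 by (simp add: mild_solution_def)
        have vb: "\<bar>v \<omega> t x\<bar> \<le> H" for x using H'(2) by (auto simp: smooth_approx_def)
        show ?thesis
          by (rule order_trans[OF Lp_pow_bound[OF p \<tau>(1) wc vcs[OF less_imp_le[OF t0]] vb]])
             (intro add_left_mono mult_left_mono add_mono I' HL, simp)
      next
        case False
        then have "ennreal C1 * g \<omega> t = \<top>" by (simp add: less_top[symmetric])
        then show ?thesis by (simp add: ennreal_mult_eq_top_iff)
      qed
    qed
    have "ennreal (\<tau> powr (p / 2)) * (\<integral>\<^sup>+ \<omega>. Lp_pow p (\<lambda>x. w \<omega> t x + v \<omega> t x) \<partial>M) \<le> ennreal A"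
    proof -
      have "ennreal (\<tau> powr (p / 2)) * (\<integral>\<^sup>+ \<omega>. Lp_pow p (\<lambda>x. w \<omega> t x + v \<omega> t x) \<partial>M)
         \<le> (\<integral>\<^sup>+ \<omega>. ennreal (\<tau> powr (p / 2)) * Lp_pow p (\<lambda>x. w \<omega> t x + v \<omega> t x) \<partial>M)" by (rule nn_integral_cmult_ge)
      also have "\<dots> \<le> (\<integral>\<^sup>+ \<omega>. 1 + 2 ^ ?P * (ennreal (1 / \<tau>) * (ennreal C0 * (ennreal \<tau> + ennreal C1 * J \<omega>)) + ennreal C1 * g \<omega> t) \<partial>M)"
        by (rule nn_integral_mono_AE[OF key])
      also have "\<dots> = 1 + 2 ^ ?P * (ennreal (1 / \<tau>) * (ennreal C0 * (ennreal \<tau> + ennreal C1 * (\<integral>\<^sup>+ \<omega>. J \<omega> \<partial>M))) + ennreal C1 * (\<integral>\<^sup>+ \<omega>. g \<omega> t \<partial>M))"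
        using Jm gm(2)[of t] by (simp add: nn_integral_add nn_integral_cmult emeasure_space_1)
      also have "\<dots> \<le> 1 + 2 ^ ?P * (ennreal (1 / \<tau>) * (ennreal C0 * (ennreal \<tau> + ennreal C1 * ennreal (B * \<tau>))) + ennreal C1 * ennreal B)"
        using gB(1)[of t] gB(2)[of s0 t] s0 unfolding J_def
        by (intro add_left_mono mult_left_mono add_mono) auto
      also have "\<dots> = ennreal (1 + 2 ^ ?P * ((1 / \<tau>) * (C0 * (\<tau> + C1 * (B * \<tau>))) + C1 * B))"
      proof -
        have nn: "0 \<le> 1 / \<tau>" "0 \<le> \<tau>" "0 \<le> C0" "0 \<le> C1" using \<tau> C1(1) pw(2) by auto
        show ?thesis
          by (simp only: ennreal_plus ennreal_mult ennreal_1 ennreal_power[symmetric] ennreal_numeral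
              zero_le_power zero_le_numeral zero_le_one add_nonneg_nonneg mult_nonneg_nonneg nn B)
      qed
      also have "(1 / \<tau>) * (C0 * (\<tau> + C1 * (B * \<tau>))) = C0 * (1 + C1 * B)" using \<tau> by (simp add: field_simps)
      finally show ?thesis unfolding A_def .
    qed
    moreover have "min (t powr (p / 2)) 1 \<le> 2 powr (p / 2) * \<tau> powr (p / 2)"
    proof -
      have "min (t powr (p / 2)) 1 \<le> (2 * \<tau>) powr (p / 2)"
      proof (cases "t \<le> 1")
        case True
        then show ?thesis by (simp add: \<tau>_def)
      next
        case False
        then show ?thesis by (simp add: \<tau>_def min_def)
      qed
      then show ?thesis using \<tau> by (simp add: powr_mult)
    qed
    ultimately show "ennreal (min (t powr (p / 2)) 1) * (\<integral>\<^sup>+ \<omega>. Lp_pow p (\<lambda>x. w \<omega> t x + v \<omega> t x) \<partial>M) \<le> ennreal C"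
    proof -
      assume 1: "ennreal (\<tau> powr (p / 2)) * (\<integral>\<^sup>+ \<omega>. Lp_pow p (\<lambda>x. w \<omega> t x + v \<omega> t x) \<partial>M) \<le> ennreal A"
        and 2: "min (t powr (p / 2)) 1 \<le> 2 powr (p / 2) * \<tau> powr (p / 2)"
      have "ennreal (min (t powr (p / 2)) 1) * (\<integral>\<^sup>+ \<omega>. Lp_pow p (\<lambda>x. w \<omega> t x + v \<omega> t x) \<partial>M)
        \<le> ennreal (2 powr (p / 2) * \<tau> powr (p / 2)) * (\<integral>\<^sup>+ \<omega>. Lp_pow p (\<lambda>x. w \<omega> t x + v \<omega> t x) \<partial>M)"
        by (intro mult_right_mono ennreal_leI 2) simp
      also have "\<dots> = ennreal (2 powr (p / 2)) * (ennreal (\<tau> powr (p / 2)) * (\<integral>\<^sup>+ \<omega>. Lp_pow p (\<lambda>x. w \<omega> t x + v \<omega> t x) \<partial>M))"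
        by (simp add: ennreal_mult mult.assoc)
      also have "\<dots> \<le> ennreal (2 powr (p / 2)) * ennreal A" by (intro mult_left_mono 1) simp
      also have "\<dots> = ennreal C" using A by (simp add: C_def ennreal_mult)
      finally show ?thesis .
    qed
  qed
qed

end
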